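(* Suppose that $(H;+,\prec)$ is an ordered abelian group which admits only finitely many definable convex subgroups. Then $(H;+,\prec)$ is trace equivalent to the disjoint union $(H;+)\sqcup(\mathbb{R};+,<)$. In particular if $(H;+,\prec)$ is archimedean then $(H;+,\prec)$ is trace equivalent to $(H;+)\sqcup(\mathbb{R};+,<)$.
   Context: An ordered abelian group is archimedean if for all positive $a,b$ there is $n$ with $na\succ b$. The disjoint union $\mathcal{M}_1\sqcup\mathcal{M}_2$ is the structure with universe $M_1\sqcup M_2$, unary predicates naming $M_1,M_2$, and for each $i$ and each $\emptyset$-definable relation of $\mathcal{M}_i$ a relation symbol interpreted on $M_i$. For structures $\mathcal{M},\mathcal{O}$, $\mathcal{M}$ trace defines $\mathcal{O}$ if there is an injection $\tau\colon O\to M^m$ such that for every $\mathcal{O}$-definable (with parameters) $X\subseteq O^n$ there is an $\mathcal{M}$-definable (with parameters) $Y\subseteq M^{mn}$ with $(a_1,\dots,a_n)\in X\iff(\tau(a_1),\dots,\tau(a_n))\in Y$ for all $a_i\in O$. A complete theory $T$ trace defines $T'$ if every model of $T'$ is trace definable in a model of $T$. Two structures are trace equivalent if each one's complete theory trace defines the other's.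
   Formalization: The ordered abelian group H is assumed to be nontrivial; for H = {0} the claim fails, since every model of its theory has one element and so cannot trace define the infinite disjoint union with the real numbers. *)

theory Defs
  imports Complex_Main
begin

section \<open>First-order logic with equality\<close>

datatype 'f tm = Var nat | Fn 'f "'f tm list"

datatype ('f, 'p) fm =
    Eq "'f tm" "'f tm"
  | Rel 'p "'f tm list"
  | Neg "('f, 'p) fm"
  | Conj "('f, 'p) fm" "('f, 'p) fm"
  | Ex nat "('f, 'p) fm"

text \<open>A language lists its function and relation symbols together with their arities.\<close>

record ('f, 'p) language =
  Funs :: "('f \<times> nat) set"
  Rels :: "('p \<times> nat) set"

record ('f, 'p, 'a) struct =
  lang :: "('f, 'p) language"
  universe :: "'a set"
  fun_int :: "'f \<Rightarrow> 'a list \<Rightarrow> 'a"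
  rel_int :: "'p \<Rightarrow> 'a list set"

definition tuples :: "('f, 'p, 'a) struct \<Rightarrow> nat \<Rightarrow> 'a list set" where
  "tuples M n = {xs. length xs = n \<and> set xs \<subseteq> universe M}"

definition is_structure :: "('f, 'p, 'a) struct \<Rightarrow> bool" where
  "is_structure M \<longleftrightarrow>
     universe M \<noteq> {} \<and>
     (\<forall>(f, n) \<in> Funs (lang M). \<forall>xs \<in> tuples M n. fun_int M f xs \<in> universe M)"

primrec fv_tm :: "'f tm \<Rightarrow> nat set" where
  "fv_tm (Var i) = {i}"
| "fv_tm (Fn f ts) = \<Union> (set (map fv_tm ts))"

primrec fv :: "('f, 'p) fm \<Rightarrow> nat set" where
  "fv (Eq s t) = fv_tm s \<union> fv_tm t"
| "fv (Rel p ts) = \<Union> (set (map fv_tm ts))"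
| "fv (Neg \<phi>) = fv \<phi>"
| "fv (Conj \<phi> \<psi>) = fv \<phi> \<union> fv \<psi>"
| "fv (Ex i \<phi>) = fv \<phi> - {i}"

primrec is_term :: "('f, 'p) language \<Rightarrow> 'f tm \<Rightarrow> bool" where
  "is_term L (Var i) \<longleftrightarrow> True"
| "is_term L (Fn f ts) \<longleftrightarrow> (f, length ts) \<in> Funs L \<and> list_all id (map (is_term L) ts)"

primrec is_formula :: "('f, 'p) language \<Rightarrow> ('f, 'p) fm \<Rightarrow> bool" where
  "is_formula L (Eq s t) \<longleftrightarrow> is_term L s \<and> is_term L t"
| "is_formula L (Rel p ts) \<longleftrightarrow> (p, length ts) \<in> Rels L \<and> list_all (is_term L) ts"
| "is_formula L (Neg \<phi>) \<longleftrightarrow> is_formula L \<phi>"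
| "is_formula L (Conj \<phi> \<psi>) \<longleftrightarrow> is_formula L \<phi> \<and> is_formula L \<psi>"
| "is_formula L (Ex i \<phi>) \<longleftrightarrow> is_formula L \<phi>"

primrec tm_val :: "('f, 'p, 'a) struct \<Rightarrow> (nat \<Rightarrow> 'a) \<Rightarrow> 'f tm \<Rightarrow> 'a" where
  "tm_val M e (Var i) = e i"
| "tm_val M e (Fn f ts) = fun_int M f (map (tm_val M e) ts)"

primrec sat :: "('f, 'p, 'a) struct \<Rightarrow> (nat \<Rightarrow> 'a) \<Rightarrow> ('f, 'p) fm \<Rightarrow> bool" where
  "sat M e (Eq s t) \<longleftrightarrow> tm_val M e s = tm_val M e t"
| "sat M e (Rel p ts) \<longleftrightarrow> map (tm_val M e) ts \<in> rel_int M p"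
| "sat M e (Neg \<phi>) \<longleftrightarrow> \<not> sat M e \<phi>"
| "sat M e (Conj \<phi> \<psi>) \<longleftrightarrow> sat M e \<phi> \<and> sat M e \<psi>"
| "sat M e (Ex i \<phi>) \<longleftrightarrow> (\<exists>a \<in> universe M. sat M (e(i := a)) \<phi>)"

definition is_sentence :: "('f, 'p) language \<Rightarrow> ('f, 'p) fm \<Rightarrow> bool" where
  "is_sentence L \<phi> \<longleftrightarrow> is_formula L \<phi> \<and> fv \<phi> = {}"

definition holds :: "('f, 'p, 'a) struct \<Rightarrow> ('f, 'p) fm \<Rightarrow> bool" where
  "holds M \<phi> \<longleftrightarrow> (\<forall>e. range e \<subseteq> universe M \<longrightarrow> sat M e \<phi>)"

definition Th :: "('f, 'p, 'a) struct \<Rightarrow> ('f, 'p) fm set" where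
  "Th M = {\<phi>. is_sentence (lang M) \<phi> \<and> holds M \<phi>}"

definition is_model ::
    "('f, 'p) language \<Rightarrow> ('f, 'p) fm set \<Rightarrow> ('f, 'p, 'a) struct \<Rightarrow> bool" where
  "is_model L T M \<longleftrightarrow> is_structure M \<and> lang M = L \<and> (\<forall>\<phi> \<in> T. holds M \<phi>)"

text \<open>
  An \<open>n\<close>-tuple \<open>xs\<close> is assigned to the variables \<open>0, \<dots>, n - 1\<close>; the free variables
  \<open>\<ge> n\<close> stand for the parameters, whose values \<open>e\<close> must lie in \<open>A\<close>.
\<close>

definition definable_over ::
    "'a set \<Rightarrow> ('f, 'p, 'a) struct \<Rightarrow> nat \<Rightarrow> 'a list set \<Rightarrow> bool" where
  "definable_over A M n X \<longleftrightarrow>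
     (\<exists>\<phi> e. is_formula (lang M) \<phi> \<and> e ` (fv \<phi> - {..<n}) \<subseteq> A \<and>
        X = {xs \<in> tuples M n. sat M (\<lambda>i. if i < n then xs ! i else e i) \<phi>})"

abbreviation definable :: "('f, 'p, 'a) struct \<Rightarrow> nat \<Rightarrow> 'a list set \<Rightarrow> bool" where
  "definable M \<equiv> definable_over (universe M) M"

abbreviation zero_definable :: "('f, 'p, 'a) struct \<Rightarrow> nat \<Rightarrow> 'a list set \<Rightarrow> bool" where
  "zero_definable M \<equiv> definable_over {} M"


section \<open>Disjoint unions\<close>

text \<open>
  The relation symbols are the two predicates naming the components and the
  zero-definable relations of the components themselves.  A symbol of a language is a
  pair with an arity, so the empty relation yields one symbol for each arity.
\<close>

datatype ('a, 'b) du_sym =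
    In_Left | In_Right | Rel_Left "'a list set" | Rel_Right "'b list set"

definition disjoint_union ::
    "('f, 'p, 'a) struct \<Rightarrow> ('g, 'q, 'b) struct \<Rightarrow> (unit, ('a, 'b) du_sym, 'a + 'b) struct" where
  "disjoint_union M N =
     \<lparr> lang = \<lparr> Funs = {},
                Rels = {(In_Left, 1), (In_Right, 1)}
                  \<union> {(Rel_Left X, n) | X n. zero_definable M n X}
                  \<union> {(Rel_Right Y, n) | Y n. zero_definable N n Y} \<rparr>,
       universe = universe M <+> universe N,
       fun_int = (\<lambda>_ _. undefined),
       rel_int = (\<lambda>s. case s of
           In_Left \<Rightarrow> {[Inl a] | a. a \<in> universe M}
         | In_Right \<Rightarrow> {[Inr b] | b. b \<in> universe N}
         | Rel_Left X \<Rightarrow> map Inl ` X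
         | Rel_Right Y \<Rightarrow> map Inr ` Y) \<rparr>"


section \<open>Trace definability\<close>

definition trace_defines :: "('f, 'p, 'a) struct \<Rightarrow> ('g, 'q, 'b) struct \<Rightarrow> bool" where
  "trace_defines M N \<longleftrightarrow>
     (\<exists>m \<tau>. inj_on \<tau> (universe N) \<and> \<tau> ` universe N \<subseteq> tuples M m \<and>
        (\<forall>n X. definable N n X \<longrightarrow>
           (\<exists>Y. definable M (m * n) Y \<and>
              (\<forall>as \<in> tuples N n. as \<in> X \<longleftrightarrow> concat (map \<tau> as) \<in> Y))))"

text \<open>
  HOL has no quantifier over types, so universes of models have to be placed in types.
  The type \<open>'u\<close> hosting the universes of the models of \<open>T'\<close> is a parameter, to be left
  universally quantified in theorems.  The model of \<open>T\<close> is sought with universe in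
  \<open>'u + ('f, 'p) fm + ('g, 'q) fm\<close>.  This does not restrict the existential quantifier:
  if \<open>N\<close> is trace definable in some model \<open>M\<close> of \<open>T\<close>, then it is trace definable in every
  elementary submodel of \<open>M\<close> that contains the image of \<open>\<tau>\<close> and, for each definable set
  of \<open>N\<close>, the parameters of one suitable formula of \<open>M\<close>; by the downward
  Loewenheim-Skolem theorem one of these embeds into the given type, which has at least
  as many elements as \<open>N\<close> and as there are formulas of either language.
\<close>

definition theory_trace_defines ::
    "'u itself \<Rightarrow> ('f, 'p) language \<Rightarrow> ('f, 'p) fm set \<Rightarrow>
       ('g, 'q) language \<Rightarrow> ('g, 'q) fm set \<Rightarrow> bool" where
  "theory_trace_defines TYPE('u) L T L' T' \<longleftrightarrow>
     (\<forall>N :: ('g, 'q, 'u) struct. is_model L' T' N \<longrightarrow>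
        (\<exists>M :: ('f, 'p, 'u + ('f, 'p) fm + ('g, 'q) fm) struct.
           is_model L T M \<and> trace_defines M N))"

definition trace_equivalent ::
    "'u itself \<Rightarrow> ('f, 'p, 'a) struct \<Rightarrow> ('g, 'q, 'b) struct \<Rightarrow> bool" where
  "trace_equivalent TYPE('u) M N \<longleftrightarrow>
     theory_trace_defines TYPE('u) (lang M) (Th M) (lang N) (Th N) \<and>
     theory_trace_defines TYPE('u) (lang N) (Th N) (lang M) (Th M)"


section \<open>Ordered abelian groups\<close>

datatype group_fun = Plus
datatype order_rel = Less

definition group_struct :: "(group_fun, order_rel, 'h :: ab_group_add) struct" where
  "group_struct =
     \<lparr> lang = \<lparr> Funs = {(Plus, 2)}, Rels = {} \<rparr>,
       universe = UNIV,
       fun_int = (\<lambda>_ xs. xs ! 0 + xs ! 1),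
       rel_int = (\<lambda>_. {}) \<rparr>"

definition ordered_group_struct ::
    "(group_fun, order_rel, 'h :: linordered_ab_group_add) struct" where
  "ordered_group_struct =
     \<lparr> lang = \<lparr> Funs = {(Plus, 2)}, Rels = {(Less, 2)} \<rparr>,
       universe = UNIV,
       fun_int = (\<lambda>_ xs. xs ! 0 + xs ! 1),
       rel_int = (\<lambda>_. {[x, y] | x y. x < y}) \<rparr>"

definition convex_subgroup :: "'h :: linordered_ab_group_add set \<Rightarrow> bool" where
  "convex_subgroup C \<longleftrightarrow>
     0 \<in> C \<and> (\<forall>x \<in> C. \<forall>y \<in> C. x + y \<in> C) \<and> (\<forall>x \<in> C. - x \<in> C) \<and>
     (\<forall>x \<in> C. \<forall>z \<in> C. \<forall>y. x \<le> y \<and> y \<le> z \<longrightarrow> y \<in> C)"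

definition definable_convex_subgroups :: "'h :: linordered_ab_group_add set set" where
  "definable_convex_subgroups =
     {C. convex_subgroup C \<and> definable ordered_group_struct 1 ((\<lambda>x. [x]) ` C)}"

definition archimedean_group :: "'h :: linordered_ab_group_add itself \<Rightarrow> bool" where
  "archimedean_group TYPE('h) \<longleftrightarrow>
     (\<forall>a b :: 'h. 0 < a \<and> 0 < b \<longrightarrow> (\<exists>n :: nat. b < (\<Sum>i<n. a)))"

end

theory Submission
  imports Defs "HOL-Computational_Algebra.Primes"
begin

text \<open>
  Both directions rest on quantifier elimination.  If \<open>H\<close> has finitely many definable
  convex subgroups, then consecutive ones \<open>C \<subset> C'\<close> have regular quotient: otherwise some
  \<open>a \<in> C'\<close> would yield the definable convex subgroup \<open>{b. a \<notin> n H + \<langle>b\<rangle>}\<close> strictly between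
  them.  Along such a chain every definable set is a boolean combination of conditions
  \<open>f x > 0\<close> modulo \<open>C\<close> and \<open>f x \<in> C + k H\<close> with \<open>f\<close> affine: inside a long interval
  of a regular quotient all classes modulo \<open>k\<close> occur, which separates the order from the
  congruences, and the latter are eliminated by a Chinese remainder theorem for chains of
  pure subgroups and Neumann's lemma on coverings by cosets.

  Finitely many conditions of the two kinds on finitely many elements are realised by
  additive maps: a finitely generated subgroup of \<open>H\<close> splits over its intersection with
  \<open>C\<close>, which maps it into \<open>(H; +)\<close> preserving the congruences, and Fourier-Motzkin
  elimination maps it into \<open>\<real>\<close> preserving the signs.  Conversely the same lemma maps finite
  parts of \<open>\<real>\<close> into \<open>H\<close>.  Compactness glues these local maps into the
  injection required by trace definability.
\<close>

text \<open>A sign-preserving homomorphism from all of \<open>H\<close> to \<real> exists only for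
  archimedean \<open>H\<close>. Trace definability asks for less: a formula tests finitely many
  affine combinations of its arguments, so for each finite set of instances a map that is right on
  the values tested there will do. What must not depend on the instances is the translated formula.
  This is why quantifier elimination comes before the maps: it fixes, once for each formula,
  conditions with integer coefficients, which additive maps respect. Constants of \<open>H\<close>
  in these conditions are turned into further variables, so that they are mapped along with the
  arguments. Each subgroup \<open>C\<close> of the chain contributes its own pair of coordinates,
  because the maps belonging to \<open>C\<close> vanish on \<open>C\<close> and see nothing below
  it. Finiteness of the chain gives every proper member a successor and keeps the number of
  coordinates finite. In the other direction three coordinates suffice: a tag for the side, the
  group element itself, and the image of the real number. Injectivity is not arranged separately; it
  is the translation of equality.\<close>

section \<open>Free variables and renaming\<close>

lemma tm_val_cong:
  "(\<And>i. i \<in> fv_tm t \<Longrightarrow> e i = e' i) \<Longrightarrow> tm_val M e t = tm_val M e' t"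
proof (induction t)
  case (Fn f ts)
  have "map (tm_val M e) ts = map (tm_val M e') ts"
    using Fn by (intro map_cong) auto
  then show ?case by (metis tm_val.simps(2))
qed auto

lemma sat_cong:
  "(\<And>i. i \<in> fv \<phi> \<Longrightarrow> e i = e' i) \<Longrightarrow> sat M e \<phi> \<longleftrightarrow> sat M e' \<phi>"
proof (induction \<phi> arbitrary: e e')
  case (Eq s t)
  then show ?case using tm_val_cong[of s e e' M] tm_val_cong[of t e e' M] by auto
next
  case (Rel p ts)
  have "map (tm_val M e) ts = map (tm_val M e') ts"
    using Rel by (intro map_cong tm_val_cong) auto
  then show ?case by (metis sat.simps(2))
next
  case (Conj \<phi> \<psi>)
  have "sat M e \<phi> = sat M e' \<phi>" "sat M e \<psi> = sat M e' \<psi>"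
    using Conj.prems by (auto intro!: Conj.IH)
  then show ?case by simp
next
  case (Ex i \<phi>)
  have "sat M (e(i := a)) \<phi> = sat M (e'(i := a)) \<phi>" for a
    by (rule Ex.IH) (use Ex.prems in auto)
  then show ?case by simp
next
  case (Neg \<phi>)
  then show ?case by (metis fv.simps(3) sat.simps(3))
qed

lemma finite_fv_tm: "finite (fv_tm t)"
  by (induction t) auto

lemma finite_fv: "finite (fv \<phi>)"
  by (induction \<phi>) (auto simp: finite_fv_tm)

definition fresh :: "nat set \<Rightarrow> nat" where
  "fresh A = (SOME j. j \<notin> A)"

lemma fresh_notin: "finite A \<Longrightarrow> fresh A \<notin> A"
  unfolding fresh_def by (rule someI_ex) (use ex_new_if_finite infinite_UNIV_nat in blast)

primrec ren_tm :: "(nat \<Rightarrow> nat) \<Rightarrow> 'f tm \<Rightarrow> 'f tm" where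
  "ren_tm r (Var i) = Var (r i)"
| "ren_tm r (Fn f ts) = Fn f (map (ren_tm r) ts)"

text \<open>The map \<open>r\<close> need not be injective, which is why a bound variable is always
  moved outside the image of the other free variables.\<close>

primrec ren :: "(nat \<Rightarrow> nat) \<Rightarrow> ('f, 'p) fm \<Rightarrow> ('f, 'p) fm" where
  "ren r (Eq s t) = Eq (ren_tm r s) (ren_tm r t)"
| "ren r (Rel p ts) = Rel p (map (ren_tm r) ts)"
| "ren r (Neg \<phi>) = Neg (ren r \<phi>)"
| "ren r (Conj \<phi> \<psi>) = Conj (ren r \<phi>) (ren r \<psi>)"
| "ren r (Ex i \<phi>) = (let j = fresh (r ` (fv \<phi> - {i})) in Ex j (ren (r(i := j)) \<phi>))"

lemma tm_val_ren_tm: "tm_val M e (ren_tm r t) = tm_val M (e \<circ> r) t"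
  by (induction t) (auto cong: map_cong)

lemma sat_ren: "sat M e (ren r \<phi>) \<longleftrightarrow> sat M (e \<circ> r) \<phi>"
proof (induction \<phi> arbitrary: r e)
  case (Rel p ts)
  then show ?case by (simp add: tm_val_ren_tm comp_def)
next
  case (Ex i \<phi>)
  define j where "j = fresh (r ` (fv \<phi> - {i}))"
  have j: "j \<notin> r ` (fv \<phi> - {i})"
    unfolding j_def by (rule fresh_notin) (simp add: finite_fv)
  have "sat M ((e(j := a)) \<circ> (r(i := j))) \<phi> = sat M ((e \<circ> r)(i := a)) \<phi>" for a
    by (rule sat_cong) (use j in auto)
  then have "(\<exists>a\<in>universe M. sat M (e(j := a)) (ren (r(i := j)) \<phi>)) \<longleftrightarrow>
    (\<exists>a\<in>universe M. sat M ((e \<circ> r)(i := a)) \<phi>)"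
    unfolding Ex.IH by blast
  then show ?case unfolding ren.simps Let_def j_def[symmetric] sat.simps .
qed (auto simp: tm_val_ren_tm)

lemma fv_tm_ren_tm: "fv_tm (ren_tm r t) = r ` fv_tm t"
  by (induction t) auto

lemma fv_ren: "fv (ren r \<phi>) \<subseteq> r ` fv \<phi>"
proof (induction \<phi> arbitrary: r)
  case (Ex i \<phi>)
  then show ?case using Ex.IH[of "r(i := fresh (r ` (fv \<phi> - {i})))"]
    by (fastforce simp: Let_def)
next
  case (Conj \<phi> \<psi>)
  then show ?case by (simp add: image_Un le_supI1 le_supI2)
next
  case (Rel p ts)
  show ?case by (auto simp: fv_tm_ren_tm)
next
  case (Eq s t)
  show ?case by (auto simp: fv_tm_ren_tm)
next
  case (Neg \<phi>)
  then show ?case by simp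
qed

lemma is_term_ren_tm: "is_term L (ren_tm r t) \<longleftrightarrow> is_term L t"
  by (induction t) (auto simp: list_all_iff)

lemma is_formula_ren: "is_formula L (ren r \<phi>) \<longleftrightarrow> is_formula L \<phi>"
  by (induction \<phi> arbitrary: r) (auto simp: is_term_ren_tm list_all_iff Let_def)

primrec exs :: "nat \<Rightarrow> ('f, 'p) fm \<Rightarrow> ('f, 'p) fm" where
  "exs 0 \<phi> = \<phi>"
| "exs (Suc n) \<phi> = exs n (Ex n \<phi>)"

lemma fv_exs: "fv (exs n \<phi>) = fv \<phi> - {..<n}"
  by (induction n arbitrary: \<phi>) auto

lemma is_formula_exs: "is_formula L (exs n \<phi>) \<longleftrightarrow> is_formula L \<phi>"
  by (induction n arbitrary: \<phi>) auto

lemma sat_exs: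
  "sat M e (exs n \<phi>) \<longleftrightarrow>
    (\<exists>a. a ` {..<n} \<subseteq> universe M \<and> sat M (\<lambda>i. if i < n then a i else e i) \<phi>)"
proof (induction n arbitrary: \<phi>)
  case (Suc n)
  show ?case
  proof
    assume "sat M e (exs (Suc n) \<phi>)"
    then obtain a b where a: "a ` {..<n} \<subseteq> universe M" "b \<in> universe M"
      "sat M ((\<lambda>i. if i < n then a i else e i)(n := b)) \<phi>"
      by (auto simp: Suc.IH)
    then have "sat M (\<lambda>i. if i < Suc n then (a(n := b)) i else e i) \<phi>"
      by (elim sat_cong[THEN iffD1, rotated]) auto
    moreover have "(a(n := b)) ` {..<Suc n} \<subseteq> universe M"
      using a by (auto simp: less_Suc_eq)
    ultimately show "\<exists>a. a ` {..<Suc n} \<subseteq> universe M \<and>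
        sat M (\<lambda>i. if i < Suc n then a i else e i) \<phi>" by blast
  next
    assume "\<exists>a. a ` {..<Suc n} \<subseteq> universe M \<and>
        sat M (\<lambda>i. if i < Suc n then a i else e i) \<phi>"
    then obtain a where a: "a ` {..<Suc n} \<subseteq> universe M"
      "sat M (\<lambda>i. if i < Suc n then a i else e i) \<phi>" by blast
    then have "sat M ((\<lambda>i. if i < n then a i else e i)(n := a n)) \<phi>"
      by (elim sat_cong[THEN iffD1, rotated]) auto
    moreover have "a n \<in> universe M" "a ` {..<n} \<subseteq> universe M" using a(1) by auto
    ultimately show "sat M e (exs (Suc n) \<phi>)" by (auto simp: Suc.IH)
  qed
qed simp

text \<open>There is no formula constant for truth. The price of this empty conjunction is that
  variable \<open>0\<close> always occurs free.\<close>

primrec conjs :: "('f, 'p) fm list \<Rightarrow> ('f, 'p) fm" where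
  "conjs [] = Eq (Var 0) (Var 0)"
| "conjs (\<phi> # \<phi>s) = Conj \<phi> (conjs \<phi>s)"

lemma sat_conjs: "sat M e (conjs \<phi>s) \<longleftrightarrow> (\<forall>\<phi> \<in> set \<phi>s. sat M e \<phi>)"
  by (induction \<phi>s) auto

lemma is_formula_conjs: "is_formula L (conjs \<phi>s) \<longleftrightarrow> (\<forall>\<phi> \<in> set \<phi>s. is_formula L \<phi>)"
  by (induction \<phi>s) auto

lemma fv_conjs: "fv (conjs \<phi>s) = (if \<phi>s = [] then {0} else {0} \<union> \<Union> (fv ` set \<phi>s))"
  by (induction \<phi>s) auto

text \<open>All truth values in question are collected in one existential sentence. It holds in
  \<open>N\<close>, hence in \<open>A\<close>, because otherwise its negation would belong to
  \<open>Th A\<close>; \<open>g\<close> reads off the witnesses. This moves finitely many instances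
  from an arbitrary model to \<open>A\<close>, the only structure for which translations are
  known.\<close>

lemma elementarily_equivalent_local_map:
  assumes N: "is_model (lang A) (Th A) N"
    and A: "universe A \<noteq> {}"
    and S: "finite S" "\<And>\<phi> e. (\<phi>, e) \<in> S \<Longrightarrow> is_formula (lang A) \<phi> \<and> range e \<subseteq> universe N"
  shows "\<exists>g. (\<forall>x. g x \<in> universe A) \<and>
    (\<forall>(\<phi>, e) \<in> S. sat N e \<phi> \<longleftrightarrow> sat A (g \<circ> e) \<phi>)"
proof -
  have N': "is_structure N" "lang N = lang A" "\<And>\<phi>. \<phi> \<in> Th A \<Longrightarrow> holds N \<phi>"
    using N by (auto simp: is_model_def)
  then obtain d0 where d0: "d0 \<in> universe N" by (auto simp: is_structure_def)
  \<comment> \<open>The extra \<open>d0\<close> keeps \<open>D\<close> nonempty: variable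
    \<open>0\<close> is free in every \<open>conjs\<close>, so \<open>n\<close> must be
    positive.\<close>
  define D where "D = insert d0 (\<Union>(\<phi>, e) \<in> S. e ` fv \<phi>)"
  have finD: "finite D" using S(1) by (auto simp: D_def finite_fv)
  have DN: "D \<subseteq> universe N" using S(2) d0 by (fastforce simp: D_def)
  obtain ds where ds: "set ds = D" "distinct ds" using finite_distinct_list[OF finD] by blast
  define n where "n = length ds"
  define ix where "ix d = (SOME i. i < n \<and> ds ! i = d)" for d
  have ix: "ix d < n \<and> ds ! ix d = d" if "d \<in> D" for d
    unfolding ix_def by (rule someI_ex) (use that ds in \<open>auto simp: n_def in_set_conv_nth\<close>)
  have n0: "0 < n" using ds D_def by (cases ds) (auto simp: n_def)
  \<comment> \<open>Variables with the same value are identified, so that each element of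
    \<open>N\<close> receives a single witness and \<open>g\<close> is well defined.\<close>
  define lit where "lit = (\<lambda>(\<phi>, e). let \<phi>' = ren (\<lambda>i. if i \<in> fv \<phi> then ix (e i) else 0) \<phi> in
    if sat N e \<phi> then \<phi>' else Neg \<phi>')"
  obtain Sl where Sl: "set Sl = S" using finite_list[OF S(1)] by blast
  define \<theta> where "\<theta> = conjs (map lit Sl)"
  have form: "is_formula (lang A) \<theta>"
    using S(2) by (auto simp: \<theta>_def is_formula_conjs lit_def Sl is_formula_ren Let_def)
  have fvl: "fv (lit p) \<subseteq> {..<n}" if "p \<in> S" for p
  proof -
    obtain \<phi> e where p: "p = (\<phi>, e)" by (cases p)
    have "ix (e i) < n" if "i \<in> fv \<phi>" for i
      using ix[of "e i"] \<open>p \<in> S\<close> that by (fastforce simp: D_def p)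
    then show ?thesis using n0 fv_ren[of "\<lambda>i. if i \<in> fv \<phi> then ix (e i) else 0" \<phi>]
      by (auto simp: lit_def p Let_def split: if_splits)
  qed
  then have fv\<theta>: "fv \<theta> \<subseteq> {..<n}" using n0 by (auto simp: \<theta>_def fv_conjs Sl)
  have litN: "sat N (\<lambda>i. if i < n then ds ! i else e0 i) (lit (\<phi>, e))"
    if "(\<phi>, e) \<in> S" for \<phi> e e0
  proof -
    have "e i = ds ! ix (e i) \<and> ix (e i) < n" if "i \<in> fv \<phi>" for i
      using ix[of "e i"] \<open>(\<phi>, e) \<in> S\<close> that by (fastforce simp: D_def)
    then have "sat N ((\<lambda>i. if i < n then ds ! i else e0 i) \<circ>
      (\<lambda>i. if i \<in> fv \<phi> then ix (e i) else 0)) \<phi> = sat N e \<phi>"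
      by (intro sat_cong) auto
    then show ?thesis by (auto simp: lit_def Let_def sat_ren)
  qed
  have satN: "sat N e0 (exs n \<theta>)" for e0
    unfolding sat_exs
    using litN DN ds by (intro exI[of _ "\<lambda>i. ds ! i"]) (auto simp: \<theta>_def sat_conjs Sl n_def)
  have fvx: "fv (exs n \<theta>) = {}" using fv\<theta> by (auto simp: fv_exs)
  have "sat A e0 (exs n \<theta>)" if e0: "range e0 \<subseteq> universe A" for e0
  proof (rule ccontr)
    assume neg: "\<not> sat A e0 (exs n \<theta>)"
    have "sat A e (exs n \<theta>) = sat A e0 (exs n \<theta>)" for e
      by (rule sat_cong) (use fvx in auto)
    with neg have "holds A (Neg (exs n \<theta>))" by (simp add: holds_def)
    then have "Neg (exs n \<theta>) \<in> Th A"
      using form fvx by (auto simp: Th_def is_sentence_def is_formula_exs)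
    from N'(3)[OF this] have "sat N (\<lambda>_. d0) (Neg (exs n \<theta>))"
      using d0 by (auto simp: holds_def)
    with satN show False by simp
  qed
  moreover obtain a0 where a0: "a0 \<in> universe A" using A by blast
  ultimately have "sat A (\<lambda>_. a0) (exs n \<theta>)" by auto
  then obtain a where a: "a ` {..<n} \<subseteq> universe A"
    "sat A (\<lambda>i. if i < n then a i else a0) \<theta>" by (auto simp: sat_exs)
  define g where "g x = (if x \<in> D then a (ix x) else a0)" for x
  have "sat N e \<phi> \<longleftrightarrow> sat A (g \<circ> e) \<phi>" if p: "(\<phi>, e) \<in> S" for \<phi> e
  proof -
    have eD: "e i \<in> D" if "i \<in> fv \<phi>" for i using p that by (fastforce simp: D_def)
    have "sat A (\<lambda>i. if i < n then a i else a0) (lit (\<phi>, e))"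
      using a(2) p by (auto simp: \<theta>_def sat_conjs Sl)
    moreover have "sat A ((\<lambda>i. if i < n then a i else a0) \<circ>
      (\<lambda>i. if i \<in> fv \<phi> then ix (e i) else 0)) \<phi> = sat A (g \<circ> e) \<phi>"
      using eD ix by (intro sat_cong) (auto simp: g_def)
    ultimately show ?thesis by (auto simp: lit_def Let_def sat_ren split: if_splits)
  qed
  moreover have "g x \<in> universe A" for x
    using a(1) a0 ix by (auto simp: g_def)
  ultimately show ?thesis by blast
qed

section \<open>Compactness\<close>

definition fip :: "'i set set \<Rightarrow> bool" where
  "fip \<F> \<longleftrightarrow> (\<forall>\<G>. finite \<G> \<longrightarrow> \<G> \<subseteq> \<F> \<longrightarrow> \<Inter> \<G> \<noteq> {})"

lemma fip_insert:
  assumes "fip U" "\<not> fip (insert X U)"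
  shows "\<exists>\<G>. finite \<G> \<and> \<G> \<subseteq> U \<and> X \<inter> \<Inter> \<G> = {}"
proof -
  obtain \<G> where "finite \<G>" "\<G> \<subseteq> insert X U" "\<Inter> \<G> = {}"
    using assms(2) by (auto simp: fip_def)
  then show ?thesis by (intro exI[of _ "\<G> - {X}"]) auto
qed

text \<open>Zorn's lemma is applied to families with the finite intersection property instead of
  filters, so that a set can be added to a family without generating a filter; a maximal such family
  is an ultrafilter.\<close>

lemma ultrafilter_exists:
  assumes "fip \<F>"
  obtains U where "\<F> \<subseteq> U" "{} \<notin> U" "\<And>X Y. X \<in> U \<Longrightarrow> Y \<in> U \<Longrightarrow> X \<inter> Y \<in> U"
    "\<And>X Y. X \<in> U \<Longrightarrow> X \<subseteq> Y \<Longrightarrow> Y \<in> U" "\<And>X. X \<in> U \<or> - X \<in> U"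
proof -
  have "\<exists>U \<in> {U. fip U \<and> \<F> \<subseteq> U}. \<forall>V \<in> {U. fip U \<and> \<F> \<subseteq> U}. U \<subseteq> V \<longrightarrow> V = U"
  proof (rule subset_Zorn_nonempty)
    show "{U. fip U \<and> \<F> \<subseteq> U} \<noteq> {}" using assms by auto
  next
    fix C assume C: "C \<noteq> {}" "subset.chain {U. fip U \<and> \<F> \<subseteq> U} C"
    have "fip (\<Union> C)"
      unfolding fip_def
    proof (intro allI impI)
      fix \<G> assume \<G>: "finite \<G>" "\<G> \<subseteq> \<Union> C"
      obtain B where "B \<in> C" "\<G> \<subseteq> B"
        using finite_subset_Union_chain[OF \<G> C(1) C(2)] by blast
      then show "\<Inter> \<G> \<noteq> {}" using C(2) \<G>(1) by (auto simp: subset.chain_def fip_def)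
    qed
    moreover obtain V where "V \<in> C" using C(1) by blast
    moreover have "\<F> \<subseteq> V" using C(2) \<open>V \<in> C\<close> by (auto simp: subset.chain_def)
    ultimately show "\<Union> C \<in> {U. fip U \<and> \<F> \<subseteq> U}" by blast
  qed
  then obtain U where "U \<in> {U. fip U \<and> \<F> \<subseteq> U}"
    and U_max: "\<forall>V \<in> {U. fip U \<and> \<F> \<subseteq> U}. U \<subseteq> V \<longrightarrow> V = U" by (rule bexE)
  then have U: "fip U" "\<F> \<subseteq> U" by simp_all
  have max: "V = U" if "fip V" "U \<subseteq> V" for V
    using U_max that U(2) by (metis (mono_tags) mem_Collect_eq subset_trans)
  have mem: "X \<in> U" if "fip (insert X U)" for X
    using max[OF that] by blast
  have fin: "\<Inter> \<G> \<noteq> {}" if "finite \<G>" "\<G> \<subseteq> U" for \<G>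
    using U(1) that by (auto simp: fip_def)
  have compl: "X \<in> U \<or> - X \<in> U" for X
  proof (rule ccontr)
    assume "\<not> (X \<in> U \<or> - X \<in> U)"
    then have "\<not> fip (insert X U)" "\<not> fip (insert (- X) U)" using mem by blast+
    then obtain \<G> \<H> where "finite \<G>" "\<G> \<subseteq> U" "X \<inter> \<Inter> \<G> = {}" "finite \<H>" "\<H> \<subseteq> U" "- X \<inter> \<Inter> \<H> = {}"
      using fip_insert[OF U(1)] by metis
    moreover from this obtain x where "x \<in> \<Inter> (\<G> \<union> \<H>)" using fin[of "\<G> \<union> \<H>"] by auto
    ultimately show False by (cases "x \<in> X") blast+
  qed
  have empty: "{} \<notin> U" using fin[of "{{}}"] by auto
  have inter: "X \<inter> Y \<in> U" if "X \<in> U" "Y \<in> U" for X Y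
    using compl[of "X \<inter> Y"] fin[of "{X, Y, - (X \<inter> Y)}"] that by auto
  have up: "Y \<in> U" if "X \<in> U" "X \<subseteq> Y" for X Y
    using compl[of Y] fin[of "{X, - Y}"] that by auto
  show ?thesis by (rule that[OF U(2) empty inter up compl])
qed

text \<open>In \<open>Sk \<phi> i ts\<close> the list gives the values of the variables
  \<open>0, 1, ...\<close> of \<phi>. Function symbols get no constructor of their own, since a
  function value is the witness of an equation.\<close>

datatype ('fm, 'c) sk = Cn 'c | Sk 'fm nat "('fm, 'c) sk list"

text \<open>
  An ultrapower restricted to the functions named by Skolem terms over the constants, coded in
  a given type.  Closure under witnesses suffices for the theorem of Los, and the
  restriction bounds the cardinality of the result, so that no separate
  Loewenheim-Skolem argument is needed.
\<close>

locale skolem_ultrapower =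
  fixes B :: "('f, 'p, 'b) struct" and b0 :: 'b and asg :: "'i \<Rightarrow> 'c \<Rightarrow> 'b"
    and U :: "'i set set" and enc :: "(('f, 'p) fm, 'c) sk \<Rightarrow> 'x"
  assumes struct: "is_structure B" and b0: "b0 \<in> universe B"
    and asg: "\<And>i c. asg i c \<in> universe B"
    and inj: "inj enc"
    and U_empty: "{} \<notin> U" and U_int: "\<And>X Y. X \<in> U \<Longrightarrow> Y \<in> U \<Longrightarrow> X \<inter> Y \<in> U"
    and U_up: "\<And>X Y. X \<in> U \<Longrightarrow> X \<subseteq> Y \<Longrightarrow> Y \<in> U" and U_compl: "\<And>X. X \<in> U \<or> - X \<in> U"
begin

definition env :: "'b list \<Rightarrow> nat \<Rightarrow> 'b" where
  "env xs j = (if j < length xs then xs ! j else b0)"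

definition wit :: "('f, 'p) fm \<Rightarrow> nat \<Rightarrow> 'b list \<Rightarrow> 'b" where
  "wit \<phi> i xs = (SOME y. y \<in> universe B \<and>
     ((\<exists>z \<in> universe B. sat B ((env xs)(i := z)) \<phi>) \<longrightarrow> sat B ((env xs)(i := y)) \<phi>))"

primrec ev :: "'i \<Rightarrow> (('f, 'p) fm, 'c) sk \<Rightarrow> 'b" where
  "ev k (Cn c) = asg k c"
| "ev k (Sk \<phi> i ts) = wit \<phi> i (map (ev k) ts)"

lemma wit: "wit \<phi> i xs \<in> universe B"
    "z \<in> universe B \<Longrightarrow> sat B ((env xs)(i := z)) \<phi> \<Longrightarrow> sat B ((env xs)(i := wit \<phi> i xs)) \<phi>"
proof -
  have "\<exists>y. y \<in> universe B \<and>
     ((\<exists>z \<in> universe B. sat B ((env xs)(i := z)) \<phi>) \<longrightarrow> sat B ((env xs)(i := y)) \<phi>)"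
    using b0 by blast
  from someI_ex[OF this, folded wit_def]
  show "wit \<phi> i xs \<in> universe B"
    "z \<in> universe B \<Longrightarrow> sat B ((env xs)(i := z)) \<phi> \<Longrightarrow> sat B ((env xs)(i := wit \<phi> i xs)) \<phi>"
    by blast+
qed

lemma ev_universe: "ev k s \<in> universe B"
  by (cases s) (auto simp: asg wit(1))

definition ae_eq :: "(('f, 'p) fm, 'c) sk \<Rightarrow> (('f, 'p) fm, 'c) sk \<Rightarrow> bool" where
  "ae_eq s t \<longleftrightarrow> {k. ev k s = ev k t} \<in> U"

text \<open>A chosen representative stands for the class: the class itself is a set of terms and
  could not be coded in \<open>'x\<close>.\<close>

definition rep :: "(('f, 'p) fm, 'c) sk \<Rightarrow> (('f, 'p) fm, 'c) sk" where
  "rep s = (SOME t. ae_eq t s)"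

lemma U_UNIV: "UNIV \<in> U" using U_compl[of UNIV] U_empty by auto

lemma U_Compl_iff: "- X \<in> U \<longleftrightarrow> X \<notin> U"
  using U_compl[of X] U_int[of X "- X"] U_empty by auto

lemma U_fin: "finite T \<Longrightarrow> (\<And>t. t \<in> T \<Longrightarrow> {k. P t k} \<in> U) \<Longrightarrow> {k. \<forall>t \<in> T. P t k} \<in> U"
proof (induction T rule: finite_induct)
  case empty then show ?case using U_UNIV by simp
next
  case (insert t T)
  then have "{k. P t k} \<inter> {k. \<forall>t \<in> T. P t k} \<in> U" by (intro U_int) auto
  then show ?case by (rule U_up) auto
qed

lemma ae_refl: "ae_eq s s" using U_UNIV by (simp add: ae_eq_def)

lemma ae_sym: "ae_eq s t \<Longrightarrow> ae_eq t s" by (simp add: ae_eq_def eq_commute)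

lemma ae_trans: "ae_eq s t \<Longrightarrow> ae_eq t u \<Longrightarrow> ae_eq s u"
  unfolding ae_eq_def by (drule (1) U_int) (erule U_up, auto)

lemma rep_ae: "ae_eq (rep s) s"
  unfolding rep_def by (rule someI[of _ s]) (rule ae_refl)

lemma rep_eq: "rep s = rep t \<longleftrightarrow> ae_eq s t"
proof
  assume "rep s = rep t"
  then show "ae_eq s t" using rep_ae[of s] rep_ae[of t] ae_sym ae_trans by metis
next
  assume "ae_eq s t"
  then have "ae_eq u s = ae_eq u t" for u using ae_sym ae_trans by blast
  then show "rep s = rep t" by (simp add: rep_def)
qed

definition cl :: "(('f, 'p) fm, 'c) sk \<Rightarrow> 'x" where "cl s = enc (rep s)"

lemma cl_eq: "cl s = cl t \<longleftrightarrow> ae_eq s t"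
  by (simp add: cl_def inj_eq[OF inj] rep_eq)

definition ult :: "('f, 'p, 'x) struct" where
  "ult = \<lparr> lang = lang B, universe = range cl,
     fun_int = (\<lambda>f xs. let n = length xs in
       cl (Sk (Eq (Var n) (Fn f (map Var [0..<n]))) n (map (inv enc) xs))),
     rel_int = (\<lambda>p. {xs. {k. map (ev k \<circ> inv enc) xs \<in> rel_int B p} \<in> U}) \<rparr>"

lemma ult_simps [simp]: "lang ult = lang B" "universe ult = range cl"
  by (simp_all add: ult_def)

lemma inv_enc [simp]: "inv enc (enc s) = s" by (simp add: inj)

lemma tm_val_ult:
  "is_term (lang B) t \<Longrightarrow>
    \<exists>s. tm_val ult (cl \<circ> e) t = cl s \<and> {k. ev k s = tm_val B (\<lambda>j. ev k (e j)) t} \<in> U"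
proof (induction t)
  case (Var j)
  then show ?case using U_UNIV by (intro exI[of _ "e j"]) auto
next
  case (Fn f ts)
  have "\<forall>t \<in> set ts. \<exists>s. tm_val ult (cl \<circ> e) t = cl s \<and>
      {k. ev k s = tm_val B (\<lambda>j. ev k (e j)) t} \<in> U"
  proof -
    have "\<forall>t \<in> set ts. is_term (lang B) t" using Fn.prems by (auto simp: list_all_iff)
    with Fn.IH show ?thesis by blast
  qed
  from bchoice[OF this] obtain g where g0: "\<forall>t \<in> set ts. tm_val ult (cl \<circ> e) t = cl (g t) \<and>
      {k. ev k (g t) = tm_val B (\<lambda>j. ev k (e j)) t} \<in> U" ..
  have g: "\<And>t. t \<in> set ts \<Longrightarrow> tm_val ult (cl \<circ> e) t = cl (g t)"
      "\<And>t. t \<in> set ts \<Longrightarrow> {k. ev k (g t) = tm_val B (\<lambda>j. ev k (e j)) t} \<in> U"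
    using g0 by blast+
  let ?n = "length ts"
  let ?\<psi> = "Eq (Var ?n) (Fn f (map Var [0..<?n])) :: ('f, 'p) fm"
  let ?s = "Sk ?\<psi> ?n (map (rep \<circ> g) ts)"
  have "map (tm_val ult (cl \<circ> e)) ts = map (cl \<circ> g) ts" using g(1) by auto
  then have "tm_val ult (cl \<circ> e) (Fn f ts) = fun_int ult f (map (cl \<circ> g) ts)" by (metis tm_val.simps(2))
  also have "\<dots> = cl ?s" by (simp add: ult_def Let_def cl_def comp_def)
  finally have 1: "tm_val ult (cl \<circ> e) (Fn f ts) = cl ?s" .
  \<comment> \<open>The equation \<open>?\<psi>\<close> has exactly one solution, so its Skolem
    witness is the function value.\<close>
  have ev: "ev k ?s = fun_int B f (map (\<lambda>t. ev k (rep (g t))) ts)" for k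
  proof -
    let ?xs = "map (\<lambda>t. ev k (rep (g t))) ts"
    have "?xs \<in> tuples B ?n" using ev_universe by (auto simp: tuples_def)
    moreover have "\<forall>xs \<in> tuples B ?n. fun_int B f xs \<in> universe B"
      using struct Fn.prems by (auto simp: is_structure_def)
    ultimately have fin: "fun_int B f ?xs \<in> universe B" by blast
    have *: "map (tm_val B ((env ?xs)(?n := z))) (map Var [0..<?n]) = ?xs" for z
      by (rule nth_equalityI) (auto simp: env_def)
    have "sat B ((env ?xs)(?n := fun_int B f ?xs)) ?\<psi>"
      using * by (simp del: map_map)
    from wit(2)[OF fin this] have "sat B ((env ?xs)(?n := wit ?\<psi> ?n ?xs)) ?\<psi>" .
    then have "wit ?\<psi> ?n ?xs = fun_int B f ?xs" using * by (simp del: map_map)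
    then show ?thesis by (simp add: comp_def)
  qed
  have "{k. ev k (rep (g t)) = tm_val B (\<lambda>j. ev k (e j)) t} \<in> U" if "t \<in> set ts" for t
    using U_int[OF rep_ae[of "g t", unfolded ae_eq_def] g(2)[OF that]] by (rule U_up) auto
  then have "{k. \<forall>t \<in> set ts. ev k (rep (g t)) = tm_val B (\<lambda>j. ev k (e j)) t} \<in> U"
    by (intro U_fin) auto
  then have "{k. ev k ?s = tm_val B (\<lambda>j. ev k (e j)) (Fn f ts)} \<in> U"
  proof (rule U_up, intro subsetI CollectI)
    fix k assume "k \<in> {k. \<forall>t \<in> set ts. ev k (rep (g t)) = tm_val B (\<lambda>j. ev k (e j)) t}"
    then have "map (\<lambda>t. ev k (rep (g t))) ts = map (tm_val B (\<lambda>j. ev k (e j))) ts"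
      by (intro map_cong) auto
    then show "ev k ?s = tm_val B (\<lambda>j. ev k (e j)) (Fn f ts)" unfolding ev tm_val.simps by (rule arg_cong)
  qed
  with 1 show ?case by blast
qed

lemma sat_ult:
  "is_formula (lang B) \<phi> \<Longrightarrow>
    sat ult (cl \<circ> e) \<phi> \<longleftrightarrow> {k. sat B (\<lambda>j. ev k (e j)) \<phi>} \<in> U"
proof (induction \<phi> arbitrary: e)
  case (Eq t1 t2)
  obtain s1 where s1: "tm_val ult (cl \<circ> e) t1 = cl s1" "{k. ev k s1 = tm_val B (\<lambda>j. ev k (e j)) t1} \<in> U"
    using tm_val_ult[of t1 e] Eq by auto
  obtain s2 where s2: "tm_val ult (cl \<circ> e) t2 = cl s2" "{k. ev k s2 = tm_val B (\<lambda>j. ev k (e j)) t2} \<in> U"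
    using tm_val_ult[of t2 e] Eq by auto
  note I = U_int[OF s1(2) s2(2)]
  have "{k. ev k s1 = ev k s2} \<in> U \<longleftrightarrow>
      {k. tm_val B (\<lambda>j. ev k (e j)) t1 = tm_val B (\<lambda>j. ev k (e j)) t2} \<in> U"
    by (rule iffI; drule U_int[OF I]; erule U_up) auto
  then show ?case unfolding sat.simps s1(1) s2(1) cl_eq ae_eq_def .
next
  case (Rel p ts)
  have "\<forall>t \<in> set ts. \<exists>s. tm_val ult (cl \<circ> e) t = cl s \<and>
      {k. ev k s = tm_val B (\<lambda>j. ev k (e j)) t} \<in> U"
    using Rel tm_val_ult by (auto simp: list_all_iff)
  from bchoice[OF this] obtain g where g0: "\<forall>t \<in> set ts. tm_val ult (cl \<circ> e) t = cl (g t) \<and>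
      {k. ev k (g t) = tm_val B (\<lambda>j. ev k (e j)) t} \<in> U" ..
  have g: "\<And>t. t \<in> set ts \<Longrightarrow> tm_val ult (cl \<circ> e) t = cl (g t)"
      "\<And>t. t \<in> set ts \<Longrightarrow> {k. ev k (g t) = tm_val B (\<lambda>j. ev k (e j)) t} \<in> U"
    using g0 by blast+
  have m: "map (tm_val ult (cl \<circ> e)) ts = map (cl \<circ> g) ts" using g(1) by auto
  have "{k. ev k (rep (g t)) = tm_val B (\<lambda>j. ev k (e j)) t} \<in> U" if "t \<in> set ts" for t
    using U_int[OF rep_ae[of "g t", unfolded ae_eq_def] g(2)[OF that]] by (rule U_up) auto
  then have I: "{k. \<forall>t \<in> set ts. ev k (rep (g t)) = tm_val B (\<lambda>j. ev k (e j)) t} \<in> U"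
    by (intro U_fin) auto
  have *: "map (\<lambda>t. ev k (rep (g t))) ts = map (tm_val B (\<lambda>j. ev k (e j))) ts"
    if "\<forall>t \<in> set ts. ev k (rep (g t)) = tm_val B (\<lambda>j. ev k (e j)) t" for k
    using that by (intro map_cong) auto
  have "{k. map (\<lambda>t. ev k (rep (g t))) ts \<in> rel_int B p} \<in> U \<longleftrightarrow>
      {k. map (tm_val B (\<lambda>j. ev k (e j))) ts \<in> rel_int B p} \<in> U" (is "?a \<in> U \<longleftrightarrow> ?b \<in> U")
  proof
    assume "?a \<in> U"
    from U_int[OF I this] show "?b \<in> U" by (rule U_up) (clarsimp simp only: mem_Collect_eq Int_iff *)
  next
    assume "?b \<in> U"
    from U_int[OF I this] show "?a \<in> U" by (rule U_up) (clarsimp simp only: mem_Collect_eq Int_iff *)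
  qed
  then show ?case unfolding sat.simps m by (simp add: ult_def comp_def cl_def)
next
  case (Neg \<phi>)
  have "{k. \<not> sat B (\<lambda>j. ev k (e j)) \<phi>} = - {k. sat B (\<lambda>j. ev k (e j)) \<phi>}" by auto
  with Neg show ?case by (simp add: U_Compl_iff)
next
  case (Conj \<phi> \<psi>)
  have "{k. sat B (\<lambda>j. ev k (e j)) (Conj \<phi> \<psi>)} \<in> U \<longleftrightarrow>
      {k. sat B (\<lambda>j. ev k (e j)) \<phi>} \<in> U \<and> {k. sat B (\<lambda>j. ev k (e j)) \<psi>} \<in> U"
    (is "?l \<in> U \<longleftrightarrow> ?a \<in> U \<and> ?b \<in> U")
  proof
    assume "?l \<in> U"
    then show "?a \<in> U \<and> ?b \<in> U"
      by (intro conjI; elim U_up) (simp_all add: subset_iff)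
  next
    assume "?a \<in> U \<and> ?b \<in> U"
    then have "?a \<inter> ?b \<in> U" using U_int by blast
    then show "?l \<in> U" by (rule U_up) auto
  qed
  with Conj show ?case by simp
next
  case (Ex i \<phi>)
  have upd: "(\<lambda>j. ev k ((e(i := s)) j)) = (\<lambda>j. ev k (e j))(i := ev k s)" for k s by auto
  have step: "sat ult ((cl \<circ> e)(i := cl s)) \<phi> \<longleftrightarrow>
      {k. sat B ((\<lambda>j. ev k (e j))(i := ev k s)) \<phi>} \<in> U" for s
  proof -
    have *: "(cl \<circ> e)(i := cl s) = cl \<circ> e(i := s)" by auto
    have "is_formula (lang B) \<phi>" using Ex.prems by simp
    from Ex.IH[OF this, of "e(i := s)"] show ?thesis unfolding * upd .
  qed
  show ?case
  proof
    assume "sat ult (cl \<circ> e) (Ex i \<phi>)"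
    then obtain s where "sat ult ((cl \<circ> e)(i := cl s)) \<phi>" by auto
    then have "{k. sat B ((\<lambda>j. ev k (e j))(i := ev k s)) \<phi>} \<in> U" using step by blast
    then show "{k. sat B (\<lambda>j. ev k (e j)) (Ex i \<phi>)} \<in> U"
      by (rule U_up) (use ev_universe in auto)
  next
    assume A: "{k. sat B (\<lambda>j. ev k (e j)) (Ex i \<phi>)} \<in> U"
    obtain n where n: "\<And>j. j \<in> fv \<phi> \<Longrightarrow> j < n"
      using finite_fv[of \<phi>] by (meson finite_nat_set_iff_bounded)
    \<comment> \<open>One Skolem term gathers the witnesses for all \<open>k\<close>; its arguments
      are the values of all variables below a bound for \<open>fv \<phi>\<close>.\<close>
    let ?s = "Sk \<phi> i (map e [0..<n])"
    have "sat B ((\<lambda>j. ev k (e j))(i := ev k ?s)) \<phi>"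
      if ex: "sat B (\<lambda>j. ev k (e j)) (Ex i \<phi>)" for k
    proof -
      let ?xs = "map (\<lambda>j. ev k (e j)) [0..<n]"
      have *: "sat B ((env ?xs)(i := z)) \<phi> = sat B ((\<lambda>j. ev k (e j))(i := z)) \<phi>" for z
        by (rule sat_cong) (use n in \<open>auto simp: env_def\<close>)
      obtain z where "z \<in> universe B" "sat B ((\<lambda>j. ev k (e j))(i := z)) \<phi>" using ex by auto
      then have "sat B ((env ?xs)(i := wit \<phi> i ?xs)) \<phi>" using wit(2) * by blast
      then show ?thesis by (simp add: * comp_def)
    qed
    then have "{k. sat B ((\<lambda>j. ev k (e j))(i := ev k ?s)) \<phi>} \<in> U"
      by (intro U_up[OF A]) blast
    then have "sat ult ((cl \<circ> e)(i := cl ?s)) \<phi>" unfolding step .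
    then show "sat ult (cl \<circ> e) (Ex i \<phi>)" unfolding sat.simps ult_simps by blast
  qed
qed

lemma ult_model: "is_model (lang B) (Th B) ult"
  unfolding is_model_def
proof (intro conjI ballI)
  show "is_structure ult"
    unfolding is_structure_def by (auto simp: ult_def Let_def)
  fix \<phi> assume \<phi>: "\<phi> \<in> Th B"
  show "holds ult \<phi>"
    unfolding holds_def
  proof (intro allI impI)
    fix e :: "nat \<Rightarrow> 'x" assume "range e \<subseteq> universe ult"
    then have "\<forall>j. \<exists>s. e j = cl s" by auto
    then obtain e' where "\<And>j. e j = cl (e' j)" by metis
    then have e': "e = cl \<circ> e'" by auto
    have "range (\<lambda>j. ev k (e' j)) \<subseteq> universe B" for k using ev_universe by auto
    with \<phi> have "{k. sat B (\<lambda>j. ev k (e' j)) \<phi>} = UNIV" by (simp add: Th_def holds_def)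
    then show "sat ult e \<phi>"
      using sat_ult[of \<phi> e'] \<phi> U_UNIV by (simp add: e' Th_def is_sentence_def)
  qed
qed simp

end

text \<open>\<open>p\<close> is meant as a pairing and \<open>c\<close> as a copy of the natural
  numbers inside \<open>'x\<close>, whose first two values serve as constructor tags.\<close>

primrec enc_list :: "('x \<times> 'x \<Rightarrow> 'x) \<Rightarrow> (nat \<Rightarrow> 'x) \<Rightarrow> 'x list \<Rightarrow> 'x" where
  "enc_list p c [] = p (c 0, c 0)"
| "enc_list p c (x # xs) = p (c 1, p (x, enc_list p c xs))"

primrec enc_sk :: "('x \<times> 'x \<Rightarrow> 'x) \<Rightarrow> (nat \<Rightarrow> 'x) \<Rightarrow> ('c \<Rightarrow> 'x) \<Rightarrow> ('fm \<Rightarrow> 'x) \<Rightarrow> ('fm, 'c) sk \<Rightarrow> 'x" where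
  "enc_sk p c a f (Cn k) = p (c 0, a k)"
| "enc_sk p c a f (Sk \<phi> i ts) =
    p (c 1, p (f \<phi>, p (c i, enc_list p c (map (enc_sk p c a f) ts))))"

lemma inj_enc_list:
  assumes "inj p" "inj c"
  shows "enc_list p c xs = enc_list p c ys \<Longrightarrow> xs = ys"
proof (induction xs arbitrary: ys)
  case Nil
  then show ?case using assms by (cases ys) (auto simp: inj_eq)
next
  case (Cons x xs)
  then show ?case using assms by (cases ys) (auto simp: inj_eq)
qed

lemma inj_enc_sk:
  assumes "inj p" "inj c" "inj a" "inj f"
  shows "inj (enc_sk p c a f)"
proof (rule injI)
  show "enc_sk p c a f s = enc_sk p c a f t \<Longrightarrow> s = t" for s t
  proof (induction s arbitrary: t)
    case (Cn k)
    then show ?case using assms by (cases t) (auto simp: inj_eq)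
  next
    case (Sk \<phi> i ts)
    then obtain us where t: "t = Sk \<phi> i us"
      using assms by (cases t) (auto simp: inj_eq)
    have m: "map (enc_sk p c a f) ts = map (enc_sk p c a f) us"
      using Sk.prems assms by (auto simp: t inj_eq dest: inj_enc_list)
    then have len: "length ts = length us" by (metis length_map)
    have "ts = us"
    proof (rule nth_equalityI[OF len])
      fix l assume l: "l < length ts"
      then have "enc_sk p c a f (ts ! l) = enc_sk p c a f (us ! l)"
        using m len by (metis nth_map)
      then show "ts ! l = us ! l" using Sk.IH l by auto
    qed
    then show ?case by (simp add: t)
  qed
qed

text \<open>The indices of the ultrapower are the finite parts of \<Gamma>, each with an assignment
  that satisfies it, and the ultrafilter contains, for every member of \<Gamma>, the set of finite
  parts that contain it. The injections \<open>p\<close>, \<open>a\<close> and \<open>f\<close> code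
  the Skolem terms in the prescribed type.\<close>

theorem compactness:
  fixes B :: "('f, 'p, 'b) struct" and \<Gamma> :: "(('f, 'p) fm \<times> (nat \<Rightarrow> 'c)) set"
    and p :: "'x \<times> 'x \<Rightarrow> 'x" and a :: "'c \<Rightarrow> 'x" and f :: "('f, 'p) fm \<Rightarrow> 'x"
  assumes B: "is_structure B"
    and inj: "inj p" "inj a" "inj f"
    and form: "\<And>\<phi> v. (\<phi>, v) \<in> \<Gamma> \<Longrightarrow> is_formula (lang B) \<phi>"
    and fin: "\<And>\<Gamma>0. finite \<Gamma>0 \<Longrightarrow> \<Gamma>0 \<subseteq> \<Gamma> \<Longrightarrow>
      \<exists>\<alpha>. range \<alpha> \<subseteq> universe B \<and> (\<forall>(\<phi>, v) \<in> \<Gamma>0. sat B (\<alpha> \<circ> v) \<phi>)"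
  shows "\<exists>M :: ('f, 'p, 'x) struct. is_model (lang B) (Th B) M \<and>
    (\<exists>\<alpha>. range \<alpha> \<subseteq> universe M \<and> (\<forall>(\<phi>, v) \<in> \<Gamma>. sat M (\<alpha> \<circ> v) \<phi>))"
proof -
  obtain b0 where b0: "b0 \<in> universe B" using B by (auto simp: is_structure_def)
  \<comment> \<open>The index type contains all sets; those that are not finite parts of \<Gamma>
    receive a dummy assignment.\<close>
  have "\<forall>\<Gamma>0. \<exists>\<alpha>. range \<alpha> \<subseteq> universe B \<and>
      (finite \<Gamma>0 \<and> \<Gamma>0 \<subseteq> \<Gamma> \<longrightarrow> (\<forall>(\<phi>, v) \<in> \<Gamma>0. sat B (\<alpha> \<circ> v) \<phi>))" (is "\<forall>\<Gamma>0. \<exists>\<alpha>. ?P \<Gamma>0 \<alpha>")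
  proof
    fix \<Gamma>0
    show "\<exists>\<alpha>. ?P \<Gamma>0 \<alpha>"
    proof (cases "finite \<Gamma>0 \<and> \<Gamma>0 \<subseteq> \<Gamma>")
      case True then show ?thesis using fin[of \<Gamma>0] by auto
    next
      case False then show ?thesis using b0 by (intro exI[of _ "\<lambda>_. b0"]) auto
    qed
  qed
  then obtain asg where asgP: "\<And>\<Gamma>0. ?P \<Gamma>0 (asg \<Gamma>0)" by metis
  define \<F> where "\<F> = (\<lambda>\<gamma>. {\<Gamma>0. finite \<Gamma>0 \<and> \<Gamma>0 \<subseteq> \<Gamma> \<and> \<gamma> \<in> \<Gamma>0}) ` \<Gamma>"
  have "fip \<F>"
    unfolding fip_def
  proof (intro allI impI)
    fix \<G> assume "finite \<G>" "\<G> \<subseteq> \<F>"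
    then obtain \<Gamma>0 where G: "\<Gamma>0 \<subseteq> \<Gamma>" "finite \<Gamma>0"
        "\<G> = (\<lambda>\<gamma>. {\<Gamma>0. finite \<Gamma>0 \<and> \<Gamma>0 \<subseteq> \<Gamma> \<and> \<gamma> \<in> \<Gamma>0}) ` \<Gamma>0"
      unfolding \<F>_def by (meson finite_subset_image)
    then have "\<Gamma>0 \<in> \<Inter> \<G>" by auto
    then show "\<Inter> \<G> \<noteq> {}" by blast
  qed
  then obtain U where U: "\<F> \<subseteq> U" "{} \<notin> U" "\<And>X Y. X \<in> U \<Longrightarrow> Y \<in> U \<Longrightarrow> X \<inter> Y \<in> U"
    "\<And>X Y. X \<in> U \<Longrightarrow> X \<subseteq> Y \<Longrightarrow> Y \<in> U" "\<And>X. X \<in> U \<or> - X \<in> U"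
    by (rule ultrafilter_exists) blast
  \<comment> \<open>The formulas supply infinitely many elements of \<open>'x\<close>, which serve
    as the natural numbers.\<close>
  define c where "c n = f (Eq (Var n) (Var n))" for n
  have "inj c" using inj(3) by (auto simp: c_def inj_def)
  have asg_in: "asg k x \<in> universe B" for k x
    using conjunct1[OF asgP[of k]] by blast
  interpret skolem_ultrapower B b0 asg U "enc_sk p c a f"
    by unfold_locales (use B b0 asg_in inj U \<open>inj c\<close> in \<open>auto intro!: inj_enc_sk\<close>)
  have "sat ult ((cl \<circ> Cn) \<circ> v) \<phi>" if "(\<phi>, v) \<in> \<Gamma>" for \<phi> v
  proof -
    have "{\<Gamma>0. finite \<Gamma>0 \<and> \<Gamma>0 \<subseteq> \<Gamma> \<and> (\<phi>, v) \<in> \<Gamma>0} \<in> U"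
      using U(1) that by (auto simp: \<F>_def)
    then have "{k. sat B (\<lambda>j. ev k (Cn (v j))) \<phi>} \<in> U"
    proof (rule U(4), intro subsetI CollectI)
      fix k assume "k \<in> {\<Gamma>0. finite \<Gamma>0 \<and> \<Gamma>0 \<subseteq> \<Gamma> \<and> (\<phi>, v) \<in> \<Gamma>0}"
      with asgP[of k] have "sat B (asg k \<circ> v) \<phi>" by blast
      then show "sat B (\<lambda>j. ev k (Cn (v j))) \<phi>" by (simp add: comp_def)
    qed
    then show ?thesis using sat_ult[of \<phi> "Cn \<circ> v"] form[OF that] by (simp add: comp_assoc comp_def)
  qed
  moreover have "range (cl \<circ> Cn) \<subseteq> universe ult" by auto
  ultimately show ?thesis using ult_model by blast
qed

section \<open>Trace definability from local translations\<close>

lemma ex_inj_pair: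
  assumes "infinite (UNIV :: 'x set)"
  shows "\<exists>p :: 'x \<times> 'x \<Rightarrow> 'x. inj p"
proof -
  have "\<exists>p. inj_on p ((UNIV :: 'x set) \<times> (UNIV :: 'x set)) \<and>
      p ` ((UNIV :: 'x set) \<times> (UNIV :: 'x set)) \<subseteq> (UNIV :: 'x set)"
    by (rule iffD2[OF card_of_ordLeq ordIso_imp_ordLeq[OF card_of_Times_same_infinite[OF assms]]])
  then show ?thesis by auto
qed

lemma nth_concat_uniform:
  assumes "\<And>xs. xs \<in> set xss \<Longrightarrow> length xs = m"
  shows "length (concat xss) = m * length xss"
    and "l < m * length xss \<Longrightarrow> concat xss ! l = xss ! (l div m) ! (l mod m)"
proof -
  show len: "length (concat xss) = m * length xss"
    using assms by (induction xss) auto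
  show "l < m * length xss \<Longrightarrow> concat xss ! l = xss ! (l div m) ! (l mod m)"
    using assms
  proof (induction xss arbitrary: l)
    case (Cons xs xss)
    show ?case
    proof (cases "l < m")
      case True
      then show ?thesis using Cons.prems by (simp add: nth_append)
    next
      case False
      have m: "0 < m" using Cons.prems(1) by (cases m) auto
      have "l = (l - m) + m" using False by simp
      then have "l div m = Suc ((l - m) div m)" "l mod m = (l - m) mod m"
        using m by (metis add_Suc_right add.right_neutral div_add_self2 One_nat_def not_gr_zero, metis mod_add_self2)
      moreover have "l - m < m * length xss" using Cons.prems(1) False by simp
      ultimately show ?thesis using Cons False by (auto simp: nth_append)
    qed
  qed simp
qed

text \<open>
  The element assigned to variable \<open>i\<close> of a formula of \<open>A\<close> is coded by the values of the
  variables \<open>m * i, \<dots>, m * i + m - 1\<close> of its translation.  The blocks of variables not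
  occurring in the formula hold the codes of constants \<open>cst \<phi>\<close> from \<open>A\<close>.
  The coding \<open>\<kappa>\<close> is allowed to depend on the finitely many instances considered.
\<close>

definition block_env :: "nat \<Rightarrow> ('a \<Rightarrow> nat \<Rightarrow> 'b) \<Rightarrow> (nat \<Rightarrow> 'a) \<Rightarrow> nat \<Rightarrow> 'b" where
  "block_env m \<kappa> e l = \<kappa> (e (l div m)) (l mod m)"

definition locally_translates ::
    "('f, 'p, 'b) struct \<Rightarrow> ('g, 'q, 'a) struct \<Rightarrow> nat \<Rightarrow>
      (('g, 'q) fm \<Rightarrow> ('f, 'p) fm) \<Rightarrow> (('g, 'q) fm \<Rightarrow> nat \<Rightarrow> 'a) \<Rightarrow> bool" where
  "locally_translates B A m \<psi> cst \<longleftrightarrow>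
    (\<forall>\<phi>. is_formula (lang A) \<phi> \<longrightarrow> is_formula (lang B) (\<psi> \<phi>)) \<and>
    (\<forall>S. finite S \<longrightarrow> (\<forall>(\<phi>, e) \<in> S. is_formula (lang A) \<phi> \<and> range e \<subseteq> universe A) \<longrightarrow>
      (\<exists>\<kappa>. (\<forall>a j. \<kappa> a j \<in> universe B) \<and>
        (\<forall>(\<phi>, e) \<in> S. sat A e \<phi> \<longleftrightarrow>
          sat B (block_env m \<kappa> (\<lambda>i. if i \<in> fv \<phi> then e i else cst \<phi> i)) (\<psi> \<phi>))))"

text \<open>Compactness is applied to unknown coordinates of all elements of \<open>N\<close>: for
  every formula and every assignment in \<open>N\<close>, the translation or its negation is
  demanded. Finitely many demands are first moved from \<open>N\<close> to \<open>A\<close> by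
  \<open>elementarily_equivalent_local_map\<close> and then met in \<open>B\<close> by a coding. The
  map \<open>h\<close> makes room in the target type for the constants from
  \<open>A\<close>.\<close>

theorem locally_translates_trace_defines:
  fixes A :: "('g, 'q, 'a) struct" and B :: "('f, 'p, 'b) struct"
    and h :: "'a \<Rightarrow> ('f, 'p) fm + ('g, 'q) fm"
  assumes A: "is_structure A" and B: "is_structure B" and h: "inj h" and m: "0 < m"
    and tr: "locally_translates B A m \<psi> cst"
  shows "theory_trace_defines TYPE('u) (lang B) (Th B) (lang A) (Th A)"
  unfolding theory_trace_defines_def
proof (intro allI impI)
  fix N :: "('g, 'q, 'u) struct"
  assume N: "is_model (lang A) (Th A) N"
  have N': "universe N \<noteq> {}" "lang N = lang A"
    using N by (auto simp: is_model_def is_structure_def)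
  have "inj (\<lambda>n. Inr (Inl (Eq (Var n) (Var n))) :: 'u + ('f, 'p) fm + ('g, 'q) fm)"
    by (auto simp: inj_def)
  then have "infinite (UNIV :: ('u + ('f, 'p) fm + ('g, 'q) fm) set)"
    by (meson finite_UNIV_inj_surj finite_imageD finite_subset infinite_UNIV_nat subset_UNIV)
  then obtain p :: "('u + ('f, 'p) fm + ('g, 'q) fm) \<times> ('u + ('f, 'p) fm + ('g, 'q) fm)
      \<Rightarrow> 'u + ('f, 'p) fm + ('g, 'q) fm" where p: "inj p"
    using ex_inj_pair by blast
  define f where "f = (\<lambda>\<phi>. Inr (Inl \<phi>) :: 'u + ('f, 'p) fm + ('g, 'q) fm)"
  have f: "inj f" by (auto simp: f_def inj_def)
  define num where "num n = f (Eq (Var n) (Var n))" for n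
  have num: "inj num" using f by (auto simp: num_def inj_def)
  \<comment> \<open>An unknown is a coordinate \<open>j\<close> of an element of \<open>N\<close> or
    of a constant from \<open>A\<close>; the latter reaches the target type only through
    \<open>h\<close>.\<close>
  define cn :: "('u + 'a) \<times> nat \<Rightarrow> 'u + ('f, 'p) fm + ('g, 'q) fm" where
    "cn = (\<lambda>(x, j). p (num j, case x of Inl u \<Rightarrow> p (num 0, Inl u) | Inr a \<Rightarrow> p (num 1, Inr (h a))))"
  have cn: "inj cn"
    using p num h by (auto simp: cn_def inj_eq intro!: injI split: sum.splits)
  define v where "v \<phi> e l = ((if l div m \<in> fv \<phi> then Inl (e (l div m)) else Inr (cst \<phi> (l div m))),
    l mod m)" for \<phi> :: "('g, 'q) fm" and e :: "nat \<Rightarrow> 'u" and l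
  define lit where "lit = (\<lambda>(\<phi>, e). (if sat N e \<phi> then \<psi> \<phi> else Neg (\<psi> \<phi>), v \<phi> e))"
  define I where "I = {(\<phi>, e :: nat \<Rightarrow> 'u). is_formula (lang A) \<phi> \<and> range e \<subseteq> universe N}"
  have "\<exists>M :: ('f, 'p, 'u + ('f, 'p) fm + ('g, 'q) fm) struct. is_model (lang B) (Th B) M \<and>
    (\<exists>\<alpha>. range \<alpha> \<subseteq> universe M \<and> (\<forall>(\<phi>, v) \<in> lit ` I. sat M (\<alpha> \<circ> v) \<phi>))"
  proof (rule compactness[OF B p cn f])
    fix \<phi> v assume "(\<phi>, v) \<in> lit ` I"
    then show "is_formula (lang B) \<phi>"
      using tr by (auto simp: lit_def I_def locally_translates_def)
  next
    fix \<Gamma>0 assume "finite \<Gamma>0" "\<Gamma>0 \<subseteq> lit ` I"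
    then obtain S where S: "finite S" "S \<subseteq> I" "\<Gamma>0 = lit ` S" by (meson finite_subset_image)
    have "\<exists>g. (\<forall>x. g x \<in> universe A) \<and> (\<forall>(\<phi>, e) \<in> S. sat N e \<phi> \<longleftrightarrow> sat A (g \<circ> e) \<phi>)"
      by (rule elementarily_equivalent_local_map[OF N _ S(1)])
        (use A S(2) in \<open>auto simp: is_structure_def I_def\<close>)
    then obtain g where g0: "\<forall>x. g x \<in> universe A"
        "\<forall>(\<phi>, e) \<in> S. sat N e \<phi> \<longleftrightarrow> sat A (g \<circ> e) \<phi>" by (elim exE conjE)
    have g: "g x \<in> universe A" "(\<phi>, e) \<in> S \<Longrightarrow> sat N e \<phi> \<longleftrightarrow> sat A (g \<circ> e) \<phi>" for x \<phi> e
      using g0(1) bspec[OF g0(2), of "(\<phi>, e)"] by auto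
    let ?S = "(\<lambda>(\<phi>, e). (\<phi>, g \<circ> e)) ` S"
    have "finite ?S" "\<forall>(\<phi>, e) \<in> ?S. is_formula (lang A) \<phi> \<and> range e \<subseteq> universe A"
      using S g(1) by (auto simp: I_def)
    with tr obtain \<kappa> where \<kappa>: "\<And>a j. \<kappa> a j \<in> universe B"
        "\<forall>(\<phi>, e) \<in> ?S. sat A e \<phi> \<longleftrightarrow>
          sat B (block_env m \<kappa> (\<lambda>i. if i \<in> fv \<phi> then e i else cst \<phi> i)) (\<psi> \<phi>)"
      unfolding locally_translates_def by meson
    define \<alpha> where "\<alpha> = (\<lambda>(x, j). case x of Inl u \<Rightarrow> \<kappa> (g u) j | Inr a \<Rightarrow> \<kappa> a j)"
    have "sat B (\<alpha> \<circ> snd (lit (\<phi>, e))) (fst (lit (\<phi>, e)))" if "(\<phi>, e) \<in> S" for \<phi> e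
    proof -
      have "sat A (g \<circ> e) \<phi> \<longleftrightarrow>
          sat B (block_env m \<kappa> (\<lambda>i. if i \<in> fv \<phi> then (g \<circ> e) i else cst \<phi> i)) (\<psi> \<phi>)"
        using \<kappa>(2) that by fastforce
      moreover have "block_env m \<kappa> (\<lambda>i. if i \<in> fv \<phi> then (g \<circ> e) i else cst \<phi> i) = \<alpha> \<circ> v \<phi> e"
        by (auto simp: fun_eq_iff block_env_def \<alpha>_def v_def)
      ultimately show ?thesis using g(2)[OF that] by (simp add: lit_def)
    qed
    then have "\<forall>(\<phi>, v) \<in> \<Gamma>0. sat B (\<alpha> \<circ> v) \<phi>" unfolding S(3) by (auto simp: case_prod_unfold)
    moreover have "range \<alpha> \<subseteq> universe B"
      using \<kappa>(1) by (auto simp: \<alpha>_def split: sum.splits)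
    ultimately show "\<exists>\<alpha>. range \<alpha> \<subseteq> universe B \<and> (\<forall>(\<phi>, v) \<in> \<Gamma>0. sat B (\<alpha> \<circ> v) \<phi>)"
      by blast
  qed
  then obtain M :: "('f, 'p, 'u + ('f, 'p) fm + ('g, 'q) fm) struct" and \<alpha>
    where M: "is_model (lang B) (Th B) M" and \<alpha>: "range \<alpha> \<subseteq> universe M"
      "\<forall>(\<phi>, v) \<in> lit ` I. sat M (\<alpha> \<circ> v) \<phi>" by blast
  have langM: "lang M = lang B" using M by (simp add: is_model_def)
  have satM: "sat N e \<phi> \<longleftrightarrow> sat M (\<alpha> \<circ> v \<phi> e) (\<psi> \<phi>)"
    if "is_formula (lang A) \<phi>" "range e \<subseteq> universe N" for \<phi> e
  proof -
    have "lit (\<phi>, e) \<in> lit ` I" using that by (auto simp: I_def)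
    with \<alpha>(2) have "case lit (\<phi>, e) of (\<phi>, v) \<Rightarrow> sat M (\<alpha> \<circ> v) \<phi>" by (rule bspec)
    then show ?thesis by (cases "sat N e \<phi>") (simp_all add: lit_def)
  qed
  define \<tau> where "\<tau> x = map (\<lambda>j. \<alpha> (Inl x, j)) [0..<m]" for x
  have def: "\<exists>Y. definable M (m * n) Y \<and>
      (\<forall>as \<in> tuples N n. as \<in> X \<longleftrightarrow> concat (map \<tau> as) \<in> Y)" if X: "definable N n X" for n X
  proof -
    obtain \<phi> e0 where \<phi>: "is_formula (lang N) \<phi>" "e0 ` (fv \<phi> - {..<n}) \<subseteq> universe N"
      "X = {xs \<in> tuples N n. sat N (\<lambda>i. if i < n then xs ! i else e0 i) \<phi>}"
      using X by (auto simp: definable_over_def)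
    obtain d0 where d0: "d0 \<in> universe N" using N' by blast
    define e where "e i = (if i \<in> fv \<phi> - {..<n} then e0 i else d0)" for i
    have e: "range e \<subseteq> universe N" using \<phi>(2) d0 by (auto simp: e_def)
    \<comment> \<open>The trivial equations make all of the first \<open>n\<close> variables free,
      so that no block below \<open>m * n\<close> is filled with constants.\<close>
    define \<phi>' where "\<phi>' = Conj \<phi> (conjs (map (\<lambda>i. Eq (Var i) (Var i)) [0..<n]))"
    have fv': "{..<n} \<subseteq> fv \<phi>'" by (auto simp: \<phi>'_def fv_conjs)
    have form': "is_formula (lang A) \<phi>'"
      using \<phi>(1) N'(2) by (auto simp: \<phi>'_def is_formula_conjs)
    define Y where "Y = {ys \<in> tuples M (m * n).
      sat M (\<lambda>l. if l < m * n then ys ! l else \<alpha> (v \<phi>' e l)) (\<psi> \<phi>')}"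
    have "definable M (m * n) Y"
      unfolding definable_over_def Y_def
      using tr form' langM \<alpha>(1)
      by (intro exI[of _ "\<psi> \<phi>'"] exI[of _ "\<lambda>l. \<alpha> (v \<phi>' e l)"]) (auto simp: locally_translates_def)
    moreover have "as \<in> X \<longleftrightarrow> concat (map \<tau> as) \<in> Y" if as: "as \<in> tuples N n" for as
    proof -
      have len: "length as = n" "set as \<subseteq> universe N" using as by (auto simp: tuples_def)
      let ?e = "\<lambda>i. if i < n then as ! i else e i"
      have rng: "range ?e \<subseteq> universe N" using len e by auto
      have "as \<in> X \<longleftrightarrow> sat N (\<lambda>i. if i < n then as ! i else e0 i) \<phi>"
        using as \<phi>(3) by simp
      also have "\<dots> \<longleftrightarrow> sat N ?e \<phi>" by (rule sat_cong) (auto simp: e_def)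
      also have "\<dots> \<longleftrightarrow> sat N ?e \<phi>'" by (auto simp: \<phi>'_def sat_conjs)
      also have "\<dots> \<longleftrightarrow> sat M (\<alpha> \<circ> v \<phi>' ?e) (\<psi> \<phi>')" by (rule satM[OF form' rng])
      also have "\<alpha> \<circ> v \<phi>' ?e =
          (\<lambda>l. if l < m * n then concat (map \<tau> as) ! l else \<alpha> (v \<phi>' e l))"
      proof
        fix l
        show "(\<alpha> \<circ> v \<phi>' ?e) l = (if l < m * n then concat (map \<tau> as) ! l else \<alpha> (v \<phi>' e l))"
        proof (cases "l < m * n")
          case True
          then have d: "l div m < n" by (simp add: less_mult_imp_div_less mult.commute)
          have "concat (map \<tau> as) ! l = map \<tau> as ! (l div m) ! (l mod m)"
            by (rule nth_concat_uniform(2)) (use True len in \<open>auto simp: \<tau>_def\<close>)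
          also have "\<dots> = \<alpha> (Inl (as ! (l div m)), l mod m)"
            using d len m by (simp add: \<tau>_def)
          finally show ?thesis using True d fv' by (auto simp: v_def)
        next
          case False
          then have "\<not> l div m < n" by (metis div_less_iff_less_mult m mult.commute)
          then show ?thesis using False by (simp add: v_def)
        qed
      qed
      also have "sat M \<dots> (\<psi> \<phi>') \<longleftrightarrow> concat (map \<tau> as) \<in> Y"
      proof -
        have "length xs = m" if "xs \<in> set (map \<tau> as)" for xs using that by (auto simp: \<tau>_def)
        from nth_concat_uniform(1)[of "map \<tau> as", OF this] have "length (concat (map \<tau> as)) = m * n"
          using len by simp
        then have "concat (map \<tau> as) \<in> tuples M (m * n)"
          using \<alpha>(1) by (auto simp: tuples_def \<tau>_def)
        then show ?thesis by (simp add: Y_def)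
      qed
      finally show ?thesis .
    qed
    ultimately show ?thesis by blast
  qed
  have "inj_on \<tau> (universe N)"
  proof (rule inj_onI)
    fix x y assume xy: "x \<in> universe N" "y \<in> universe N" "\<tau> x = \<tau> y"
    \<comment> \<open>Injectivity results from applying \<open>def\<close> to the equality relation
      of \<open>N\<close>.\<close>
    let ?X = "{xs \<in> tuples N 2. sat N (\<lambda>i. if i < 2 then xs ! i else x) (Eq (Var 0) (Var 1))}"
    have "definable N 2 ?X"
      unfolding definable_over_def
      by (rule exI[of _ "Eq (Var 0) (Var 1)"], rule exI[of _ "\<lambda>_. x"]) auto
    from def[OF this] obtain Y where
      Y: "\<forall>as \<in> tuples N 2. as \<in> ?X \<longleftrightarrow> concat (map \<tau> as) \<in> Y" by (elim exE conjE)
    have t: "[x, x] \<in> tuples N 2" "[x, y] \<in> tuples N 2" using xy by (auto simp: tuples_def)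
    have "concat (map \<tau> [x, y]) = concat (map \<tau> [x, x])" using xy(3) by simp
    then have "[x, y] \<in> ?X \<longleftrightarrow> [x, x] \<in> ?X"
      unfolding bspec[OF Y t(1)] bspec[OF Y t(2)] by (rule arg_cong)
    moreover have "[x, x] \<in> ?X" using t by simp
    ultimately have "[x, y] \<in> ?X" by blast
    then show "x = y" by simp
  qed
  moreover have "\<alpha> c \<in> universe M" for c using \<alpha>(1) by blast
  then have "\<tau> ` universe N \<subseteq> tuples M m" by (auto simp: \<tau>_def tuples_def)
  ultimately have "trace_defines M N" unfolding trace_defines_def using def by blast
  with M show "\<exists>M :: ('f, 'p, 'u + ('f, 'p) fm + ('g, 'q) fm) struct.
      is_model (lang B) (Th B) M \<and> trace_defines M N" by blast
qed

section \<open>Algebra of abelian groups and elimination of congruences\<close>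

section \<open>Integer multiples in abelian groups\<close>

definition zmul :: "int \<Rightarrow> 'a \<Rightarrow> 'a :: ab_group_add" where
  "zmul k x = (if 0 \<le> k then ((+) x ^^ nat k) 0 else - ((+) x ^^ nat (- k)) 0)"

lemma zmul_0_left: "zmul 0 x = 0"
  by (simp add: zmul_def)

lemma zmul_succ: "zmul (k + 1) x = zmul k x + x"
proof -
  consider "0 \<le> k" | "k = -1" | "k < -1" by linarith
  then show ?thesis
  proof cases
    case 1
    then have "nat (k + 1) = Suc (nat k)" by simp
    with 1 show ?thesis by (simp add: zmul_def add.commute)
  next
    case 2
    then show ?thesis by (simp add: zmul_def)
  next
    case 3
    then have "nat (- k) = Suc (nat (- (k + 1)))" by simp
    with 3 show ?thesis by (simp add: zmul_def)
  qed
qed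

lemma zmul_pred: "zmul (k - 1) x = zmul k x - x"
  using zmul_succ[of "k - 1" x] by (simp add: algebra_simps)

lemma zmul_left_distrib: "zmul (k + l) x = zmul k x + zmul l x"
proof (induction l rule: int_induct[where k = 0])
  case base then show ?case by (simp add: zmul_0_left)
next
  case (step1 l) then show ?case using zmul_succ[of "k + l" x] zmul_succ[of l x] by (simp add: add.assoc)
next
  case (step2 l)
  have "zmul (k + (l - 1)) x = zmul (k + l - 1) x" by (simp add: algebra_simps)
  then show ?case by (simp add: zmul_pred step2 add_diff_eq)
qed

lemma zmul_right_distrib: "zmul k (x + y) = zmul k x + zmul k y"
proof (induction k rule: int_induct[where k = 0])
  case base then show ?case by (simp add: zmul_0_left)
next
  case (step1 l) then show ?case by (simp add: zmul_succ)
next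
  case (step2 l) then show ?case by (simp add: zmul_pred)
qed

text \<open>An abelian group is a module over the integers; the laws for differences, sums and
  negative scalars come from this interpretation.\<close>

interpretation zmul: module "zmul :: int \<Rightarrow> 'a :: ab_group_add \<Rightarrow> 'a"
proof
  fix a b :: int and x y :: 'a
  show one: "zmul 1 x = x" for x :: 'a using zmul_succ[of 0 x] by (simp add: zmul_0_left)
  show "zmul a (zmul b x) = zmul (a * b) x"
  proof (induction a rule: int_induct[where k = 0])
    case base then show ?case by (simp add: zmul_0_left)
  next
    case (step1 l) then show ?case by (simp add: zmul_succ distrib_right zmul_left_distrib one)
  next
    case (step2 l)
    have "zmul ((l - 1) * b + b) x = zmul ((l - 1) * b) x + zmul b x" by (rule zmul_left_distrib)
    then show ?case using step2 by (simp add: zmul_pred algebra_simps)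
  qed
qed (fact zmul_right_distrib zmul_left_distrib)+

lemma zmul_minus_one: "zmul (- 1) x = - x"
  using zmul.scale_minus_left[of 1 x] by simp

lemma zmul_pos:
  fixes x :: "'a :: linordered_ab_group_add"
  assumes "0 < k" "0 < x" shows "0 < zmul k x"
  using assms(1)
proof (induction k rule: int_gr_induct)
  case base then show ?case using assms by (simp add: zmul_succ[of 0, simplified])
next
  case (step i) then show ?case using assms(2) by (simp add: zmul_succ add_pos_pos)
qed

lemma zmul_nonneg:
  fixes x :: "'a :: linordered_ab_group_add"
  assumes "0 \<le> k" "0 \<le> x" shows "0 \<le> zmul k x"
proof (cases "k = 0 \<or> x = 0")
  case False
  then have "0 < zmul k x" using assms by (intro zmul_pos) auto
  then show ?thesis by simp
qed auto

lemma zmul_mono_right: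
  fixes x :: "'a :: linordered_ab_group_add"
  assumes "0 \<le> k" "x \<le> y" shows "zmul k x \<le> zmul k y"
  using zmul_nonneg[of k "y - x"] assms by (simp add: zmul.scale_right_diff_distrib)

lemma zmul_mono_left:
  fixes x :: "'a :: linordered_ab_group_add"
  assumes "k \<le> l" "0 \<le> x" shows "zmul k x \<le> zmul l x"
  using zmul_nonneg[of "l - k" x] assms by (simp add: zmul.scale_left_diff_distrib)

lemma zmul_pos_iff:
  fixes x :: "'a :: linordered_ab_group_add"
  assumes "0 < k" shows "0 < zmul k x \<longleftrightarrow> 0 < x"
  using zmul_pos[OF assms, of x] zmul_mono_right[of k x 0] assms by force


section \<open>Boolean combinations\<close>

text \<open>The boolean algebra generated by \<open>S\<close>, described without syntax: a member
  does not separate points that lie in the same sets of some finite part of \<open>S\<close>.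
  Closure under an operation is then shown by naming the finitely many sets on which the result
  depends.\<close>

definition boolgen :: "'x set set \<Rightarrow> 'x set set" where
  "boolgen S = {E. \<exists>S0 \<subseteq> S. finite S0 \<and> (\<forall>x y. (\<forall>X \<in> S0. x \<in> X \<longleftrightarrow> y \<in> X) \<longrightarrow> (x \<in> E \<longleftrightarrow> y \<in> E))}"

lemma boolgenE:
  assumes "E \<in> boolgen S"
  obtains S0 where "S0 \<subseteq> S" "finite S0" "\<And>x y. (\<And>X. X \<in> S0 \<Longrightarrow> x \<in> X \<longleftrightarrow> y \<in> X) \<Longrightarrow> x \<in> E \<longleftrightarrow> y \<in> E"
proof -
  from assms obtain S0 where S0: "S0 \<subseteq> S" "finite S0"
    and det: "\<forall>x y. (\<forall>X \<in> S0. x \<in> X \<longleftrightarrow> y \<in> X) \<longrightarrow> (x \<in> E \<longleftrightarrow> y \<in> E)"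
    unfolding boolgen_def by (elim CollectE exE conjE)
  show thesis by (rule that[OF S0], rule det[rule_format])
qed

lemma boolgenI:
  assumes "S0 \<subseteq> S" "finite S0" "\<And>x y. (\<And>X. X \<in> S0 \<Longrightarrow> x \<in> X \<longleftrightarrow> y \<in> X) \<Longrightarrow> x \<in> E \<Longrightarrow> y \<in> E"
  shows "E \<in> boolgen S"
proof -
  have det: "x \<in> E \<longleftrightarrow> y \<in> E" if *: "\<forall>X \<in> S0. x \<in> X \<longleftrightarrow> y \<in> X" for x y
  proof
    show "y \<in> E" if "x \<in> E" by (rule assms(3)[OF _ that]) (use * in blast)
    show "x \<in> E" if "y \<in> E" by (rule assms(3)[OF _ that]) (use * in blast)
  qed
  show ?thesis unfolding boolgen_def
    by (intro CollectI exI[of _ S0] conjI allI impI) (fact assms(1) assms(2) | erule det)+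
qed

lemma boolgen_gen: "X \<in> S \<Longrightarrow> X \<in> boolgen S"
  by (rule boolgenI[of "{X}"]) auto

lemma boolgen_const: "{e. P} \<in> boolgen S"
  by (rule boolgenI[of "{}"]) (auto split: if_splits)

lemma boolgen_finite_determined:
  assumes "finite T" "T \<subseteq> boolgen S"
    and det: "\<And>x y. (\<And>X. X \<in> T \<Longrightarrow> x \<in> X \<longleftrightarrow> y \<in> X) \<Longrightarrow> x \<in> E \<Longrightarrow> y \<in> E"
  shows "E \<in> boolgen S"
proof -
  have "\<forall>X \<in> T. \<exists>S0. S0 \<subseteq> S \<and> finite S0 \<and> (\<forall>x y. (\<forall>Y \<in> S0. x \<in> Y \<longleftrightarrow> y \<in> Y) \<longrightarrow> (x \<in> X \<longleftrightarrow> y \<in> X))"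
    using assms(2) by (auto simp: boolgen_def subset_iff)
  from bchoice[OF this] obtain s where s: "\<forall>X \<in> T. s X \<subseteq> S \<and> finite (s X) \<and>
      (\<forall>x y. (\<forall>Y \<in> s X. x \<in> Y \<longleftrightarrow> y \<in> Y) \<longrightarrow> (x \<in> X \<longleftrightarrow> y \<in> X))" ..
  show ?thesis
  proof (rule boolgenI[of "\<Union> (s ` T)"])
    show "\<Union> (s ` T) \<subseteq> S" "finite (\<Union> (s ` T))" using s assms(1) by auto
    fix x y assume *: "\<And>X. X \<in> \<Union> (s ` T) \<Longrightarrow> x \<in> X \<longleftrightarrow> y \<in> X" and x: "x \<in> E"
    have "x \<in> X \<longleftrightarrow> y \<in> X" if "X \<in> T" for X
    proof -
      have "\<forall>Y \<in> s X. x \<in> Y \<longleftrightarrow> y \<in> Y" by (rule ballI, rule *) (use that in blast)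
      moreover have "\<forall>x y. (\<forall>Y \<in> s X. x \<in> Y \<longleftrightarrow> y \<in> Y) \<longrightarrow> (x \<in> X \<longleftrightarrow> y \<in> X)"
        using bspec[OF s that] by (elim conjE)
      ultimately show ?thesis by (elim allE impE)
    qed
    from det[OF this x] show "y \<in> E" .
  qed
qed

lemma boolgen_mono: "S \<subseteq> boolgen T \<Longrightarrow> E \<in> boolgen S \<Longrightarrow> E \<in> boolgen T"
  by (erule boolgenE, rule boolgen_finite_determined, assumption, erule (1) order_trans, metis)

lemma boolgen_not: "{e. P e} \<in> boolgen S \<Longrightarrow> {e. \<not> P e} \<in> boolgen S"
  by (rule boolgen_finite_determined[of "{{e. P e}}"]) auto

lemma boolgen_conj: "{e. P e} \<in> boolgen S \<Longrightarrow> {e. Q e} \<in> boolgen S \<Longrightarrow> {e. P e \<and> Q e} \<in> boolgen S"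
  by (rule boolgen_finite_determined[of "{{e. P e}, {e. Q e}}"]) auto

lemma boolgen_disj: "{e. P e} \<in> boolgen S \<Longrightarrow> {e. Q e} \<in> boolgen S \<Longrightarrow> {e. P e \<or> Q e} \<in> boolgen S"
  by (rule boolgen_finite_determined[of "{{e. P e}, {e. Q e}}"]) auto

lemma boolgen_ball:
  assumes "finite A" "\<And>a. a \<in> A \<Longrightarrow> {e. P a e} \<in> boolgen S"
  shows "{e. \<forall>a \<in> A. P a e} \<in> boolgen S"
  by (rule boolgen_finite_determined[of "(\<lambda>a. {e. P a e}) ` A"]) (use assms in auto)

lemma boolgen_bex:
  assumes "finite A" "\<And>a. a \<in> A \<Longrightarrow> {e. P a e} \<in> boolgen S"
  shows "{e. \<exists>a \<in> A. P a e} \<in> boolgen S"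
  by (rule boolgen_finite_determined[of "(\<lambda>a. {e. P a e}) ` A"]) (use assms in auto)

text \<open>Disjunctive normal form: \<open>E\<close> is a finite union of cells, each given by a
  membership pattern on finitely many generators, and the quantifier commutes with the
  union.\<close>

lemma boolgen_exists:
  assumes lits: "\<And>P Q. finite P \<Longrightarrow> finite Q \<Longrightarrow> P \<subseteq> S \<Longrightarrow> Q \<subseteq> S \<Longrightarrow>
      {e. \<exists>z. (\<forall>X \<in> P. u z e \<in> X) \<and> (\<forall>X \<in> Q. u z e \<notin> X)} \<in> boolgen T"
    and E: "E \<in> boolgen S"
  shows "{e. \<exists>z. u z e \<in> E} \<in> boolgen T"
proof -
  obtain S0 where S0: "S0 \<subseteq> S" "finite S0"
      "\<And>x y. (\<And>X. X \<in> S0 \<Longrightarrow> x \<in> X \<longleftrightarrow> y \<in> X) \<Longrightarrow> x \<in> E \<longleftrightarrow> y \<in> E"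
    using E by (rule boolgenE) blast
  define \<A> where "\<A> = (\<lambda>x. {X \<in> S0. x \<in> X}) ` E"
  have fin: "finite \<A>" by (rule finite_subset[of _ "Pow S0"]) (use S0(2) in \<open>auto simp: \<A>_def\<close>)
  have sub: "A \<subseteq> S0" if "A \<in> \<A>" for A using that by (auto simp: \<A>_def)
  have mem: "w \<in> E \<longleftrightarrow> (\<exists>A \<in> \<A>. (\<forall>X \<in> A. w \<in> X) \<and> (\<forall>X \<in> S0 - A. w \<notin> X))" for w
  proof
    assume "w \<in> E"
    then show "\<exists>A \<in> \<A>. (\<forall>X \<in> A. w \<in> X) \<and> (\<forall>X \<in> S0 - A. w \<notin> X)" by (auto simp: \<A>_def)
  next
    assume "\<exists>A \<in> \<A>. (\<forall>X \<in> A. w \<in> X) \<and> (\<forall>X \<in> S0 - A. w \<notin> X)"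
    then obtain x where "x \<in> E" "\<forall>X \<in> {X \<in> S0. x \<in> X}. w \<in> X" "\<forall>X \<in> S0 - {X \<in> S0. x \<in> X}. w \<notin> X"
      by (auto simp: \<A>_def)
    then show "w \<in> E" using S0(3)[of x w] by blast
  qed
  have "{e. \<exists>z. u z e \<in> E} =
      {e. \<exists>A \<in> \<A>. \<exists>z. (\<forall>X \<in> A. u z e \<in> X) \<and> (\<forall>X \<in> S0 - A. u z e \<notin> X)}"
    unfolding mem by blast
  also have "\<dots> \<in> boolgen T"
    by (intro boolgen_bex fin lits) (use sub S0 in \<open>auto intro: finite_subset\<close>)
  finally show ?thesis .
qed


section \<open>Coverings by cosets\<close>

definition subgrp :: "'a :: ab_group_add set \<Rightarrow> bool" where
  "subgrp Q \<longleftrightarrow> 0 \<in> Q \<and> (\<forall>x \<in> Q. \<forall>y \<in> Q. x - y \<in> Q)"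

lemma subgrp_0: "subgrp Q \<Longrightarrow> 0 \<in> Q" by (simp add: subgrp_def)
lemma subgrp_diff: "subgrp Q \<Longrightarrow> x \<in> Q \<Longrightarrow> y \<in> Q \<Longrightarrow> x - y \<in> Q" by (simp add: subgrp_def)
lemma subgrp_minus: "subgrp Q \<Longrightarrow> x \<in> Q \<Longrightarrow> - x \<in> Q" using subgrp_diff[of Q 0 x] subgrp_0[of Q] by simp
lemma subgrp_add: "subgrp Q \<Longrightarrow> x \<in> Q \<Longrightarrow> y \<in> Q \<Longrightarrow> x + y \<in> Q"
  using subgrp_diff[of Q x "- y"] subgrp_minus[of Q y] by simp
lemma subgrp_minus_iff: "subgrp Q \<Longrightarrow> - x \<in> Q \<longleftrightarrow> x \<in> Q" using subgrp_minus[of Q x] subgrp_minus[of Q "- x"] by auto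
lemma subgrp_diff_commute: "subgrp Q \<Longrightarrow> x - y \<in> Q \<longleftrightarrow> y - x \<in> Q" using subgrp_minus_iff[of Q "x - y"] by simp
lemma subgrp_zmul: "subgrp Q \<Longrightarrow> x \<in> Q \<Longrightarrow> zmul k x \<in> Q"
proof (induction k rule: int_induct[where k = 0])
  case base then show ?case by (simp add: subgrp_0)
next
  case (step1 l) then show ?case by (simp add: zmul_succ subgrp_add)
next
  case (step2 l) then show ?case by (simp add: zmul_pred subgrp_diff)
qed
lemma subgrp_add_cancel: "subgrp Q \<Longrightarrow> y \<in> Q \<Longrightarrow> x + y \<in> Q \<longleftrightarrow> x \<in> Q"
  using subgrp_add[of Q x y] subgrp_diff[of Q "x + y" y] by auto
lemma subgrp_Inter: "(\<And>Q. Q \<in> \<Q> \<Longrightarrow> subgrp Q) \<Longrightarrow> subgrp (\<Inter> \<Q>)"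
  by (auto simp: subgrp_def)

text \<open>For subgroups this means that \<open>P \<inter> Q\<close> has finite index in
  \<open>P\<close>; neither \<open>Q\<close> nor the representatives need lie in
  \<open>P\<close>.\<close>

definition finite_index :: "'a :: ab_group_add set \<Rightarrow> 'a set \<Rightarrow> bool" where
  "finite_index P Q \<longleftrightarrow> (\<exists>X. finite X \<and> (\<forall>y \<in> P. \<exists>x \<in> X. y - x \<in> Q))"

text \<open>Neumann's argument, by induction on the number of distinct subgroups. If the cosets of
  \<open>R\<close> miss some \<open>y0 \<in> P\<close>, then the whole coset of \<open>y0\<close>
  modulo \<open>P \<inter> R\<close> is covered by cosets of the other subgroups, and translates of
  this covering can replace the cosets of \<open>R\<close>.\<close>

lemma coset_cover_finite_index:
  assumes "finite \<S>" "subgrp P" "\<And>Q. Q \<in> \<S> \<Longrightarrow> subgrp Q" "\<And>Q. Q \<in> \<S> \<Longrightarrow> finite (X Q)"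
    and "\<And>y. y \<in> P \<Longrightarrow> \<exists>Q \<in> \<S>. \<exists>x \<in> X Q. y - x \<in> Q"
  shows "\<exists>Q \<in> \<S>. finite_index P Q"
  using assms
proof (induction \<S> arbitrary: X rule: finite_induct)
  case empty
  then show ?case using subgrp_0[of P] by auto
next
  case (insert R \<S>)
  show ?case
  proof (cases "\<forall>y \<in> P. \<exists>x \<in> X R. y - x \<in> R")
    case True
    then show ?thesis using insert.prems(3) by (auto simp: finite_index_def)
  next
    case False
    then obtain y0 where y0: "y0 \<in> P" "\<And>x. x \<in> X R \<Longrightarrow> y0 - x \<notin> R" by blast
    have sR: "subgrp R" using insert.prems(2) by simp
    \<comment> \<open>The translations must not leave \<open>P\<close>, hence a representative
      \<open>p x\<close> inside \<open>P\<close> for each coset of \<open>R\<close> that meets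
      \<open>P\<close>.\<close>
    define X0 where "X0 = {x \<in> X R. \<exists>y \<in> P. y - x \<in> R}"
    have "\<forall>x \<in> X0. \<exists>y. y \<in> P \<and> y - x \<in> R" by (auto simp: X0_def)
    from bchoice[OF this] obtain p where p: "\<forall>x \<in> X0. p x \<in> P \<and> p x - x \<in> R" ..
    define X' where "X' Q = X Q \<union> (\<lambda>(x, x'). p x + x' - y0) ` (X0 \<times> X Q)" for Q
    have "\<exists>Q \<in> \<S>. finite_index P Q"
    proof (rule insert.IH)
      show "finite (X' Q)" if "Q \<in> \<S>" for Q
        using insert.prems(3)[of Q] insert.prems(3)[of R] that by (auto simp: X'_def X0_def)
      fix y assume y: "y \<in> P"
      show "\<exists>Q \<in> \<S>. \<exists>x \<in> X' Q. y - x \<in> Q"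
      proof (cases "\<exists>x \<in> X R. y - x \<in> R")
        case False
        then show ?thesis using insert.prems(4)[OF y] by (auto simp: X'_def)
      next
        case True
        then obtain x where x: "x \<in> X R" "y - x \<in> R" by blast
        then have x0: "x \<in> X0" using y by (auto simp: X0_def)
        then have px: "p x \<in> P" "p x - x \<in> R" using p by auto
        have r: "y - p x \<in> R" using subgrp_diff[OF sR x(2) px(2)] by (simp add: algebra_simps)
        \<comment> \<open>\<open>y\<close> is moved from the coset of \<open>p x\<close> to that of
          \<open>y0\<close>, where only the other subgroups can cover it.\<close>
        let ?w = "y0 + (y - p x)"
        have "?w \<in> P" using y0(1) y px(1) insert.prems(1) by (intro subgrp_add subgrp_diff)
        moreover have "?w - x' \<notin> R" if "x' \<in> X R" for x'
        proof
          assume "?w - x' \<in> R"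
          from subgrp_diff[OF sR this r] have "y0 - x' \<in> R" by (simp add: algebra_simps)
          with y0(2)[OF that] show False by simp
        qed
        ultimately obtain Q x' where Q: "Q \<in> \<S>" "x' \<in> X Q" "?w - x' \<in> Q"
          using insert.prems(4)[of ?w] by auto
        have "y - (p x + x' - y0) = ?w - x'" by (simp add: algebra_simps)
        moreover have "p x + x' - y0 \<in> X' Q" using x0 Q(2) by (auto simp: X'_def)
        ultimately show ?thesis using Q by metis
      qed
    qed (use insert.prems in auto)
    then show ?thesis by blast
  qed
qed


section \<open>Affine functions\<close>

definition affine :: "((nat \<Rightarrow> 'a :: ab_group_add) \<Rightarrow> 'a) \<Rightarrow> bool" where
  "affine f \<longleftrightarrow> (\<exists>n N c. \<forall>e. f e = (\<Sum>i<N. zmul (n i) (e i)) + c)"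

lemma affineI: "(\<And>e. f e = (\<Sum>i<N. zmul (n i) (e i)) + c) \<Longrightarrow> affine f"
  by (auto simp: affine_def)

lemma affine_const: "affine (\<lambda>_. c)"
  by (rule affineI[of _ _ 0]) simp

lemma affine_var: "affine (\<lambda>e. e i)"
proof (rule affineI[of _ "\<lambda>j. if j = i then 1 else 0" "Suc i" 0])
  fix e :: "nat \<Rightarrow> 'a"
  have "(\<Sum>j<Suc i. zmul (if j = i then 1 else 0) (e j)) = (\<Sum>j<Suc i. if j = i then e j else 0)"
    by (intro sum.cong) auto
  then show "e i = (\<Sum>j<Suc i. zmul (if j = i then 1 else 0) (e j)) + 0" by simp
qed

lemma affine_zmul: "affine f \<Longrightarrow> affine (\<lambda>e. zmul k (f e))"
proof -
  assume "affine f"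
  then obtain n N c where f: "\<And>e. f e = (\<Sum>i<N. zmul (n i) (e i)) + c" by (auto simp: affine_def)
  show ?thesis
    by (rule affineI[of _ "\<lambda>i. k * n i" N "zmul k c"])
      (simp add: f zmul.scale_right_distrib zmul.scale_sum_right)
qed

lemma affine_add:
  assumes "affine f" "affine g" shows "affine (\<lambda>e. f e + g e)"
proof -
  obtain n N c where f: "\<And>e. f e = (\<Sum>i<N. zmul (n i) (e i)) + c" using assms(1) by (auto simp: affine_def)
  obtain n' N' c' where g: "\<And>e. g e = (\<Sum>i<N'. zmul (n' i) (e i)) + c'" using assms(2) by (auto simp: affine_def)
  let ?M = "max N N'"
  let ?n = "\<lambda>i. if i < N then n i else 0" and ?n' = "\<lambda>i. if i < N' then n' i else 0"
  have 1: "(\<Sum>i<N. zmul (n i) (e i)) = (\<Sum>i<?M. zmul (?n i) (e i))" for e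
    by (rule sum.mono_neutral_cong_left) auto
  have 2: "(\<Sum>i<N'. zmul (n' i) (e i)) = (\<Sum>i<?M. zmul (?n' i) (e i))" for e
    by (rule sum.mono_neutral_cong_left) auto
  have "f e + g e = (\<Sum>i<?M. zmul (?n i + ?n' i) (e i)) + (c + c')" for e
    unfolding f g 1 2 zmul.scale_left_distrib sum.distrib by (simp add: ac_simps)
  then show ?thesis by (rule affineI)
qed

lemma affine_minus: "affine f \<Longrightarrow> affine (\<lambda>e. - f e)"
  using affine_zmul[of f "- 1"] by (simp add: zmul_minus_one)

lemma affine_diff: "affine f \<Longrightarrow> affine g \<Longrightarrow> affine (\<lambda>e. f e - g e)"
  using affine_add[OF _ affine_minus, of f g] by simp

lemma affine_split:
  assumes "affine f"
  obtains k g where "affine g" "\<And>e z. f (e(i := z)) = zmul k z + g e"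
proof -
  from assms obtain n N c where f: "\<And>e. f e = (\<Sum>j<N. zmul (n j) (e j)) + c" by (auto simp: affine_def)
  define k where "k = (if i < N then n i else 0)"
  define g where "g e = (\<Sum>j<N. zmul ((n(i := 0)) j) (e j)) + c" for e
  have "affine g" unfolding g_def by (rule affineI) (rule refl)
  moreover have "f (e(i := z)) = zmul k z + g e" for e z
  proof (cases "i < N")
    case True
    have "(\<Sum>j<N. zmul (n j) ((e(i := z)) j)) = zmul (n i) z + (\<Sum>j \<in> {..<N} - {i}. zmul (n j) (e j))"
      using True by (subst sum.remove[of _ i]) (auto intro!: sum.cong)
    moreover have "(\<Sum>j<N. zmul ((n(i := 0)) j) (e j)) = (\<Sum>j \<in> {..<N} - {i}. zmul (n j) (e j))"
      using True by (subst sum.remove[of _ i]) (auto intro!: sum.cong)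
    ultimately show ?thesis using True by (simp add: f g_def k_def add.assoc)
  next
    case False
    then show ?thesis by (auto simp: f g_def k_def intro!: sum.cong)
  qed
  ultimately show thesis by (rule that)
qed

section \<open>Convex subgroups and congruences\<close>

text \<open>Antisymmetry is not assumed, because tuples are compared by a single component: by
  divisibility of moduli or by inclusion of subgroups, in both directions.\<close>

lemma finite_total_least:
  assumes "finite A" "A \<noteq> {}" "\<And>x y. x \<in> A \<Longrightarrow> y \<in> A \<Longrightarrow> R x y \<or> R y x"
    and "\<And>x y z. x \<in> A \<Longrightarrow> y \<in> A \<Longrightarrow> z \<in> A \<Longrightarrow> R x y \<Longrightarrow> R y z \<Longrightarrow> R x z"
  shows "\<exists>m \<in> A. \<forall>x \<in> A. R m x"
  using assms
proof (induction A rule: finite_ne_induct)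
  case (singleton x)
  then show ?case by blast
next
  case (insert a A)
  have "\<exists>m \<in> A. \<forall>x \<in> A. R m x"
    by (rule insert.IH) (use insert.prems in \<open>meson insertI2\<close>)+
  then obtain m where m: "m \<in> A" "\<forall>x \<in> A. R m x" by blast
  have aa: "R a a" using insert.prems(1)[of a a] by blast
  show ?case
  proof (cases "R m a")
    case True then show ?thesis using m by blast
  next
    case False
    then have am: "R a m" using insert.prems(1)[of a m] m(1) by blast
    have "R a x" if "x \<in> A" for x
      by (rule insert.prems(2)[of a m x]) (use am m that in auto)
    then show ?thesis using aa by blast
  qed
qed

lemma convex_subgroup_subgrp: "convex_subgroup C \<Longrightarrow> subgrp C"
  unfolding convex_subgroup_def subgrp_def by (metis add_uminus_conv_diff)

lemma convex_subgroup_between: "convex_subgroup C \<Longrightarrow> x \<in> C \<Longrightarrow> z \<in> C \<Longrightarrow> x \<le> y \<Longrightarrow> y \<le> z \<Longrightarrow> y \<in> C"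
  unfolding convex_subgroup_def by blast

lemma convex_subgroup_pos_mem:
  assumes "convex_subgroup C" "x \<notin> C"
  shows "\<exists>b. (b = x \<or> b = - x) \<and> 0 < b \<and> b \<notin> C"
proof -
  note s = convex_subgroup_subgrp[OF assms(1)]
  have "x \<noteq> 0" using subgrp_0[OF s] assms(2) by auto
  then show ?thesis
    using assms(2) subgrp_minus_iff[OF s, of x] by (cases x "0 :: 'a" rule: linorder_cases) auto
qed

text \<open>Of two positive elements, one in \<open>C - D\<close> and one in \<open>D - C\<close>,
  the smaller would be forced by convexity into the subgroup that it avoids.\<close>

lemma convex_subgroup_linear:
  assumes C: "convex_subgroup C" and D: "convex_subgroup D"
  shows "C \<subseteq> D \<or> D \<subseteq> C"
proof (rule ccontr)
  assume "\<not> (C \<subseteq> D \<or> D \<subseteq> C)"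
  then obtain x y where x: "x \<in> C" "x \<notin> D" and y: "y \<in> D" "y \<notin> C" by blast
  obtain a where a: "a = x \<or> a = - x" "0 < a" "a \<notin> D" using convex_subgroup_pos_mem[OF D x(2)] by blast
  obtain b where b: "b = y \<or> b = - y" "0 < b" "b \<notin> C" using convex_subgroup_pos_mem[OF C y(2)] by blast
  note sC = convex_subgroup_subgrp[OF C] and sD = convex_subgroup_subgrp[OF D]
  have "a \<in> C" "b \<in> D" using a b x y subgrp_minus[OF sC] subgrp_minus[OF sD] by auto
  then show False
    using a b convex_subgroup_between[OF C subgrp_0[OF sC], of a b] convex_subgroup_between[OF D subgrp_0[OF sD], of b a]
    by (cases "a \<le> b") auto
qed

text \<open>The quotient by \<open>C\<close> is torsion-free: a positive element lies below its
  positive multiples, so convexity applies.\<close>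

lemma convex_subgroup_pure:
  assumes C: "convex_subgroup C" and "zmul k x \<in> C" "k \<noteq> 0"
  shows "x \<in> C"
proof (rule ccontr)
  assume "x \<notin> C"
  then obtain b where b: "b = x \<or> b = - x" "0 < b" "b \<notin> C" using convex_subgroup_pos_mem[OF C] by blast
  note sC = convex_subgroup_subgrp[OF C]
  have "zmul k b \<in> C" using assms(2) b(1) subgrp_minus[OF sC] by auto
  then have "zmul \<bar>k\<bar> b \<in> C" using subgrp_minus[OF sC] by (cases "0 \<le> k") auto
  moreover have "b \<le> zmul \<bar>k\<bar> b" using zmul_mono_left[of 1 "\<bar>k\<bar>" b] assms(3) b(2) by simp
  ultimately show False
    using convex_subgroup_between[OF C subgrp_0[OF sC] _ less_imp_le[OF b(2)]] b(3) by blast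
qed

text \<open>The subgroup \<open>C + k H\<close>. Modulus \<open>0\<close> gives \<open>C\<close>
  itself, so that membership in \<open>C\<close> and congruences are handled together.\<close>

definition cng :: "'a :: ab_group_add set \<Rightarrow> int \<Rightarrow> 'a set" where
  "cng C k = {x. \<exists>g. x - zmul k g \<in> C}"

lemma cngI: "x - zmul k g \<in> C \<Longrightarrow> x \<in> cng C k" by (auto simp: cng_def)

lemma subgrp_cng: "subgrp C \<Longrightarrow> subgrp (cng C k)"
  unfolding subgrp_def[of "cng C k"]
proof (intro conjI ballI)
  assume C: "subgrp C"
  show "0 \<in> cng C k" by (rule cngI[of _ _ 0]) (simp add: subgrp_0[OF C])
  fix x y assume "x \<in> cng C k" "y \<in> cng C k"
  then obtain g h where "x - zmul k g \<in> C" "y - zmul k h \<in> C" by (auto simp: cng_def)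
  from subgrp_diff[OF C this] show "x - y \<in> cng C k"
    by (intro cngI[of _ _ "g - h"]) (simp add: zmul.scale_right_diff_distrib algebra_simps)
qed

lemma cng_0: "cng C 0 = C" by (auto simp: cng_def)

lemma cng_mono: "C \<subseteq> D \<Longrightarrow> l dvd k \<Longrightarrow> cng C k \<subseteq> cng D l"
proof
  fix x assume *: "C \<subseteq> D" "l dvd k" "x \<in> cng C k"
  then obtain g m where "x - zmul k g \<in> C" "k = l * m" by (auto simp: cng_def)
  then show "x \<in> cng D l" using *(1) by (intro cngI[of _ _ "zmul m g"]) auto
qed

lemma cng_base: "x \<in> C \<Longrightarrow> x \<in> cng C k" by (rule cngI[of _ _ 0]) simp

lemma cng_zmul: "subgrp C \<Longrightarrow> k dvd l \<Longrightarrow> zmul l g \<in> cng C k"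
proof -
  assume C: "subgrp C" and "k dvd l"
  then obtain m where "l = k * m" by auto
  then show ?thesis using subgrp_0[OF C] by (intro cngI[of _ _ "zmul m g"]) simp
qed

lemma cng_abs: "cng C \<bar>k\<bar> = cng C k"
proof -
  have "cng C \<bar>k\<bar> \<subseteq> cng C k" "cng C k \<subseteq> cng C \<bar>k\<bar>" by (rule cng_mono; simp)+
  then show ?thesis by blast
qed

text \<open>Cancelling \<open>m\<close> rests on the purity of \<open>C\<close>. The lemma later
  brings all occurrences of a quantified variable to a common coefficient.\<close>

lemma cng_scale:
  assumes C: "convex_subgroup C" and "m \<noteq> 0"
  shows "zmul m x \<in> cng C (m * k) \<longleftrightarrow> x \<in> cng C k"
proof
  assume "zmul m x \<in> cng C (m * k)"
  then obtain g where "zmul m x - zmul (m * k) g \<in> C" by (auto simp: cng_def)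
  then have "zmul m (x - zmul k g) \<in> C" by (simp add: zmul.scale_right_diff_distrib)
  then show "x \<in> cng C k" using convex_subgroup_pure[OF C _ assms(2)] by (auto simp: cng_def)
next
  assume "x \<in> cng C k"
  then obtain g where "x - zmul k g \<in> C" by (auto simp: cng_def)
  from subgrp_zmul[OF convex_subgroup_subgrp[OF C] this, of m]
  show "zmul m x \<in> cng C (m * k)" by (intro cngI[of _ _ g]) (simp add: zmul.scale_right_diff_distrib)
qed

lemma cng_coprime:
  assumes C: "subgrp C" and "coprime a b" "y \<in> cng C a" "y \<in> cng C b"
  shows "y \<in> cng C (a * b)"
proof -
  obtain g h where gh: "y - zmul a g \<in> C" "y - zmul b h \<in> C" using assms(3,4) by (auto simp: cng_def)
  obtain u v where uv: "u * a + v * b = 1" using assms(2) bezout_int[of a b] by auto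
  have "zmul (u * a) (y - zmul b h) + zmul (v * b) (y - zmul a g) \<in> C"
    using gh C by (intro subgrp_add subgrp_zmul)
  also have "zmul (u * a) (y - zmul b h) + zmul (v * b) (y - zmul a g) =
      zmul (u * a + v * b) y - zmul (a * b) (zmul u h + zmul v g)"
    by (simp add: zmul.scale_right_diff_distrib zmul.scale_right_distrib zmul.scale_left_distrib algebra_simps)
  finally show ?thesis by (intro cngI[of _ _ "zmul u h + zmul v g"]) (simp add: uv)
qed

lemma cng_prime_powers:
  assumes C: "subgrp C" and "k \<noteq> 0"
    and y: "\<And>p. prime p \<Longrightarrow> p dvd k \<Longrightarrow> y \<in> cng C (p ^ multiplicity p k)"
  shows "y \<in> cng C k"
proof -
  have "y \<in> cng C (\<Prod>p \<in> T. p ^ multiplicity p k)" if "finite T" "T \<subseteq> prime_factors k" for T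
    using that
  proof (induction T rule: finite_induct)
    case empty
    then show ?case using subgrp_0[OF C] by (intro cngI[of _ _ y]) simp
  next
    case (insert p T)
    have "coprime (p ^ multiplicity p k) (\<Prod>q \<in> T. q ^ multiplicity q k)"
    proof (rule prod_coprime_right)
      fix q assume q: "q \<in> T"
      then have "prime p" "prime q" "p \<noteq> q" using insert by (auto simp: prime_factors_dvd)
      then show "coprime (p ^ multiplicity p k) (q ^ multiplicity q k)"
        using primes_coprime[of p q] by simp
    qed
    moreover have "y \<in> cng C (p ^ multiplicity p k)"
      using y insert.prems by (auto simp: prime_factors_dvd)
    ultimately show ?case using insert by (simp add: cng_coprime[OF C])
  qed
  from this[of "prime_factors k"] have "y \<in> cng C (normalize k)"
    using assms(2) by (simp add: prod_prime_factors)
  then show ?thesis using cng_abs[of C k] by simp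
qed

type_synonym 'a congruence = "'a \<times> 'a set \<times> int"

definition solves :: "'a :: ab_group_add \<Rightarrow> 'a congruence set \<Rightarrow> bool" where
  "solves z J \<longleftrightarrow> (\<forall>(s, C, k) \<in> J. z - s \<in> cng C k)"

lemma solvesD: "solves z J \<Longrightarrow> (s, C, k) \<in> J \<Longrightarrow> z - s \<in> cng C k"
  unfolding solves_def by blast

text \<open>In a chain of subgroups \<open>C \<union> D\<close> is the larger of \<open>C\<close> and \<open>D\<close>.\<close>

definition compat :: "'a :: ab_group_add congruence set \<Rightarrow> bool" where
  "compat J \<longleftrightarrow> (\<forall>(s, C, k) \<in> J. \<forall>(t, D, l) \<in> J. s - t \<in> cng (C \<union> D) (gcd k l))"

lemma solves_compat:
  assumes J: "\<And>s C k. (s, C, k) \<in> J \<Longrightarrow> convex_subgroup C" and z: "solves z J"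
  shows "compat J"
proof -
  have "s - t \<in> cng (C \<union> D) (gcd k l)" if "(s, C, k) \<in> J" "(t, D, l) \<in> J" for s t C D k l
  proof -
    have CD: "C \<union> D = C \<or> C \<union> D = D" using convex_subgroup_linear[of C D] J that by blast
    then have sg: "subgrp (C \<union> D)" using J[OF that(1)] J[OF that(2)] convex_subgroup_subgrp by metis
    have "z - s \<in> cng C k" "z - t \<in> cng D l" using z that by (auto simp: solves_def)
    then have "z - s \<in> cng (C \<union> D) (gcd k l)" "z - t \<in> cng (C \<union> D) (gcd k l)"
      using cng_mono[of C "C \<union> D" "gcd k l" k] cng_mono[of D "C \<union> D" "gcd k l" l] by auto
    from subgrp_diff[OF subgrp_cng[OF sg] this(2) this(1)] show ?thesis by simp
  qed
  then show ?thesis unfolding compat_def by blast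
qed

text \<open>Take out a congruence \<open>(s, C, k)\<close> whose \<open>k\<close> divides all other
  moduli, let \<open>z\<close> solve the rest, and let \<open>D\<close> be the smallest subgroup of
  the rest. If \<open>C\<close> lies in \<open>D\<close>, then \<open>s - z\<close> is a multiple of
  \<open>k\<close> up to an element of \<open>D\<close>; adding this element to \<open>z\<close>
  repairs the missing congruence and disturbs no other, as it lies in all their subgroups. If
  \<open>D\<close> lies in \<open>C\<close>, the congruence with subgroup \<open>D\<close> together
  with \<open>compat\<close> implies the missing one.\<close>

lemma chain_congruences_solvable:
  assumes "finite J" and "\<And>s C k. (s, C, k) \<in> J \<Longrightarrow> convex_subgroup C"
    and "\<And>s C k t D l. (s, C, k) \<in> J \<Longrightarrow> (t, D, l) \<in> J \<Longrightarrow> k dvd l \<or> l dvd k"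
    and "compat J"
  shows "\<exists>z. solves z J"
  using assms
proof (induction J rule: finite_psubset_induct)
  case (psubset J)
  show ?case
  proof (cases "J = {}")
    case True then show ?thesis by (simp add: solves_def)
  next
    case False
    have "\<exists>m \<in> J. \<forall>x \<in> J. snd (snd m) dvd snd (snd x)"
      by (rule finite_total_least[OF psubset.hyps False])
        (use psubset.prems(2) dvd_trans in \<open>auto; blast\<close>)+
    then obtain s C k where n: "(s, C, k) \<in> J" and min: "\<And>t D l. (t, D, l) \<in> J \<Longrightarrow> k dvd l"
      by fastforce
    let ?J = "J - {(s, C, k)}"
    have "\<exists>z. solves z ?J"
      by (rule psubset.IH) (use n psubset.prems in \<open>auto simp: compat_def; blast\<close>)+
    then obtain z where z: "solves z ?J" ..
    note cC = psubset.prems(1)[OF n]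
    note sC = convex_subgroup_subgrp[OF cC]
    show ?thesis
    proof (cases "?J = {}")
      case True
      then have "solves s J" using subgrp_0[OF subgrp_cng[OF sC]] n by (auto simp: solves_def)
      then show ?thesis ..
    next
      case False
      have fin: "finite ?J" using psubset.hyps by simp
      have "\<exists>m \<in> ?J. \<forall>x \<in> ?J. fst (snd m) \<subseteq> fst (snd x)"
        by (rule finite_total_least[OF fin False])
          (use psubset.prems(1) convex_subgroup_linear in \<open>auto; blast\<close>)+
      then obtain m0 where m0: "m0 \<in> ?J" "\<forall>x \<in> ?J. fst (snd m0) \<subseteq> fst (snd x)" by blast
      obtain t D l where "m0 = (t, D, l)" by (cases m0)
      with m0 have m: "(t, D, l) \<in> ?J" by simp
      have Dmin: "D \<subseteq> D'" if "(t', D', l') \<in> ?J" for t' D' l'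
        using bspec[OF m0(2) that] \<open>m0 = (t, D, l)\<close> by simp
      have cD: "convex_subgroup D" using psubset.prems(1) m by blast
      note sD = convex_subgroup_subgrp[OF cD]
      have kl: "k dvd l" using min m by blast
      have "s - t \<in> cng (C \<union> D) (gcd k l)" using psubset.prems(3) n m by (auto simp: compat_def)
      then have st: "s - t \<in> cng (C \<union> D) k" using kl by (simp add: gcd_proj1_if_dvd cng_abs)
      have zt: "z - t \<in> cng D l" by (rule solvesD[OF z m])
      show ?thesis
      proof (cases "C \<subseteq> D")
        case True
        then have "s - t \<in> cng D k" using st by (simp add: Un_absorb1)
        moreover have "z - t \<in> cng D k" using zt cng_mono[of D D k l] kl by blast
        ultimately have "s - z \<in> cng D k"
          using subgrp_diff[OF subgrp_cng[OF sD], of "s - t" k "z - t"] by simp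
        then obtain g where g: "s - z - zmul k g \<in> D" by (auto simp: cng_def)
        define c where "c = s - z - zmul k g"
        have "solves (z + c) J"
          unfolding solves_def
        proof (clarify)
          fix s' C' k' assume j: "(s', C', k') \<in> J"
          show "z + c - s' \<in> cng C' k'"
          proof (cases "(s', C', k') = (s, C, k)")
            case True
            then have "z + c - s' = zmul k (- g)" "C' = C" "k' = k" by (auto simp: c_def)
            then show ?thesis using cng_zmul[OF sC, of k k "- g"] by simp
          next
            case False
            then have j': "(s', C', k') \<in> ?J" using j by blast
            have "c \<in> cng C' k'" by (rule cng_base) (use Dmin[OF j'] g in \<open>auto simp: c_def\<close>)
            moreover have "z - s' \<in> cng C' k'" by (rule solvesD[OF z j'])
            moreover have "subgrp (cng C' k')"
              using psubset.prems(1)[OF j] convex_subgroup_subgrp subgrp_cng by blast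
            ultimately have "(z - s') + c \<in> cng C' k'" by (intro subgrp_add)
            then show ?thesis by (simp add: algebra_simps)
          qed
        qed
        then show ?thesis ..
      next
        case False
        then have "D \<subseteq> C" using convex_subgroup_linear[OF cC cD] by blast
        then have "s - t \<in> cng C k" "z - t \<in> cng C k"
          using st zt cng_mono[of D C k l] kl by (auto simp: Un_absorb2)
        then have "z - s \<in> cng C k"
          using subgrp_diff[OF subgrp_cng[OF sC], of "z - t" k "s - t"] by simp
        then have "solves z (insert (s, C, k) ?J)" using z unfolding solves_def by blast
        moreover have "insert (s, C, k) ?J = J" using n by blast
        ultimately have "solves z J" by simp
        then show ?thesis ..
      qed
    qed
  qed
qed

text \<open>For \<open>k = 0\<close> the \<open>p\<close>-part is \<open>0\<close> again, so that
  conditions modulo \<open>C\<close> alone survive in the system of every prime.\<close>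

definition prime_part :: "int \<Rightarrow> int \<Rightarrow> int" where
  "prime_part p k = (if k = 0 then 0 else p ^ multiplicity p k)"

lemma prime_part_dvd: "prime_part p k dvd k"
  by (simp add: prime_part_def multiplicity_dvd)

lemma prime_part_pow: "prime_part p k = 0 \<or> (\<exists>a. prime_part p k = p ^ a)"
proof (cases "k = 0")
  case False
  then have "prime_part p k = p ^ multiplicity p k" by (simp add: prime_part_def)
  then show ?thesis by blast
qed (simp add: prime_part_def)

text \<open>Chinese remaindering over the primes: the \<open>p\<close>-parts of the moduli are
  pairwise comparable, so each system \<open>Jp p\<close> is solvable, and solutions for different
  primes are combined with Bezout weights. The conditions \<open>J0\<close> with modulus
  \<open>0\<close> are carried along separately, since the set of primes may be empty.\<close>

theorem congruences_solvable:
  assumes fin: "finite J" and J: "\<And>s C k. (s, C, k) \<in> J \<Longrightarrow> convex_subgroup C"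
    and comp: "compat J"
  shows "\<exists>z. solves z J"
proof -
  define Jp where "Jp p = (\<lambda>(s, C, k). (s, C, prime_part p k)) ` J" for p
  define J0 where "J0 = {(s, C, k) \<in> J. k = 0}"
  have solp: "\<exists>z. solves z (Jp p)" if "prime p" for p
  proof (rule chain_congruences_solvable)
    show "finite (Jp p)" using fin by (simp add: Jp_def)
    show "\<And>s C k. (s, C, k) \<in> Jp p \<Longrightarrow> convex_subgroup C" using J by (auto simp: Jp_def)
    show "k dvd l \<or> l dvd k" if "(s, C, k) \<in> Jp p" "(t, D, l) \<in> Jp p" for s C k t D l
    proof -
      have "k = 0 \<or> (\<exists>a. k = p ^ a)" "l = 0 \<or> (\<exists>a. l = p ^ a)"
        using that prime_part_pow by (auto simp: Jp_def)
      then show ?thesis by (auto intro: le_imp_power_dvd) (meson le_imp_power_dvd linorder_le_cases)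
    qed
    show "compat (Jp p)"
      unfolding compat_def
    proof (clarify)
      fix s C k t D l assume "(s, C, k) \<in> Jp p" "(t, D, l) \<in> Jp p"
      then obtain k' l' where kl: "(s, C, k') \<in> J" "(t, D, l') \<in> J" "k = prime_part p k'" "l = prime_part p l'"
        by (auto simp: Jp_def)
      then have "s - t \<in> cng (C \<union> D) (gcd k' l')" using comp by (auto simp: compat_def)
      moreover have "gcd k l dvd gcd k' l'" unfolding kl(3,4)
        by (rule gcd_greatest)
          (rule dvd_trans[OF gcd_dvd1 prime_part_dvd] dvd_trans[OF gcd_dvd2 prime_part_dvd])+
      ultimately show "s - t \<in> cng (C \<union> D) (gcd k l)" using cng_mono by blast
    qed
  qed
  \<comment> \<open>A crude common exponent: the multiplicity of a prime in \<open>k\<close> is at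
    most \<open>\<bar>k\<bar>\<close>.\<close>
  define E where "E = (\<Sum>(s, C, k) \<in> J. nat \<bar>k\<bar>)"
  have E: "prime_part p k dvd p ^ E" if "(s, C, k) \<in> J" "k \<noteq> 0" "prime p" for s C k p
  proof -
    have p2: "2 \<le> p" using that(3) prime_ge_2_int by blast
    have "int (multiplicity p k) < 2 ^ multiplicity p k" by (rule of_nat_less_two_power)
    also have "(2 :: int) ^ multiplicity p k \<le> p ^ multiplicity p k" using p2 by (intro power_mono) auto
    also have "\<dots> \<le> \<bar>k\<bar>" using that(2) multiplicity_dvd[of p k] by (intro zdvd_imp_le) auto
    finally have "multiplicity p k \<le> nat \<bar>k\<bar>" by linarith
    also have "\<dots> \<le> E" unfolding E_def using member_le_sum[OF that(1), of "\<lambda>(s, C, k). nat \<bar>k\<bar>"] fin by auto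
    finally show ?thesis using that(2) by (simp add: prime_part_def le_imp_power_dvd)
  qed
  have comb: "\<exists>z. solves z J0 \<and> (\<forall>p \<in> T. solves z (Jp p))" if "finite T" "\<And>p. p \<in> T \<Longrightarrow> prime p" for T
    using that
  proof (induction T rule: finite_induct)
    case empty
    \<comment> \<open>Any prime would do, as every \<open>Jp p\<close> contains the conditions with
      modulus \<open>0\<close>.\<close>
    obtain z where z: "solves z (Jp 2)" using solp[of 2] by auto
    have "J0 \<subseteq> Jp 2"
      by (auto simp: J0_def Jp_def prime_part_def intro!: image_eqI)
    with z have "solves z J0" unfolding solves_def by blast
    then show ?case by blast
  next
    case (insert p T)
    then obtain z where z: "solves z J0" "\<And>q. q \<in> T \<Longrightarrow> solves z (Jp q)" by auto
    obtain y where y: "solves y (Jp p)" using solp[of p] insert.prems by auto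
    define M where "M = (\<Prod>q \<in> T. q ^ E)"
    have "coprime M (p ^ E)" unfolding M_def
    proof (rule prod_coprime_left)
      fix q assume "q \<in> T"
      then have "prime p" "prime q" "p \<noteq> q" using insert by auto
      then show "coprime (q ^ E) (p ^ E)" using primes_coprime[of q p] by simp
    qed
    then obtain u v where uv: "u * M + v * p ^ E = 1" using bezout_int[of M "p ^ E"] by auto
    \<comment> \<open>The weights sum to \<open>1\<close>, so \<open>w - s\<close> is the same
      combination of \<open>y - s\<close> and \<open>z - s\<close>. The first weight vanishes modulo
      the prime powers of \<open>T\<close>, the second modulo those of \<open>p\<close>.\<close>
    define w where "w = zmul (u * M) y + zmul (v * p ^ E) z"
    have ws: "w - s = zmul (u * M) (y - s) + zmul (v * p ^ E) (z - s)" for s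
    proof -
      have "zmul (u * M) (y - s) + zmul (v * p ^ E) (z - s) = w - zmul (u * M + v * p ^ E) s"
        by (simp add: w_def zmul.scale_right_diff_distrib zmul.scale_left_distrib algebra_simps)
      then show ?thesis by (simp add: uv)
    qed
    have y0: "y - s \<in> C" "z - s \<in> C" if "(s, C, 0) \<in> J" for s C
    proof -
      have "(s, C, 0) \<in> Jp p" "(s, C, 0) \<in> J0"
        using that by (auto simp: Jp_def J0_def prime_part_def intro!: image_eqI)
      from solvesD[OF y this(1)] solvesD[OF z(1) this(2)]
      show "y - s \<in> C" "z - s \<in> C" by (simp_all add: cng_0)
    qed
    have w0: "w - s \<in> C" if "(s, C, 0) \<in> J" for s C
      unfolding ws using y0[OF that] convex_subgroup_subgrp[OF J[OF that]] by (intro subgrp_add subgrp_zmul)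
    have wJ0: "solves w J0" using w0 by (auto simp: J0_def solves_def cng_0)
    have wq: "w - s \<in> cng C (prime_part q k)" if q: "q \<in> insert p T" and j: "(s, C, k) \<in> J" for q s C k
    proof (cases "k = 0")
      case True
      then show ?thesis using w0 j by (auto simp: prime_part_def cng_0)
    next
      case False
      note sC = convex_subgroup_subgrp[OF J[OF j]]
      note sQ = subgrp_cng[OF sC, of "prime_part q k"]
      have jq: "(s, C, prime_part q k) \<in> Jp q" using j by (auto simp: Jp_def intro!: image_eqI)
      have Eq: "prime_part q k dvd q ^ E" using E[OF j False] insert.prems q by blast
      show ?thesis
      proof (cases "q = p")
        case True
        have "y - s \<in> cng C (prime_part q k)" using solvesD[OF y] jq True by blast
        moreover have "zmul (v * p ^ E) (z - s) \<in> cng C (prime_part q k)"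
          by (rule cng_zmul[OF sC]) (use Eq True in auto)
        ultimately show ?thesis unfolding ws using sQ by (meson subgrp_add subgrp_zmul)
      next
        case False
        then have qT: "q \<in> T" using q by blast
        then have "z - s \<in> cng C (prime_part q k)" by (rule solvesD[OF z(2) jq])
        moreover have "q ^ E dvd M" unfolding M_def using qT insert.hyps(1) by (intro dvd_prodI)
        then have "zmul (u * M) (y - s) \<in> cng C (prime_part q k)"
          by (intro cng_zmul[OF sC]) (use Eq in \<open>auto intro: dvd_trans\<close>)
        ultimately show ?thesis unfolding ws using sQ by (meson subgrp_add subgrp_zmul)
      qed
    qed
    have "\<forall>q \<in> insert p T. solves w (Jp q)"
      unfolding solves_def Jp_def by (clarsimp, intro conjI ballI; clarsimp; rule wq; simp)
    with wJ0 show ?case by blast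
  qed
  define T where "T = (\<Union>(s, C, k) \<in> J. if k = 0 then {} else prime_factors k)"
  have "finite T" using fin by (auto simp: T_def)
  moreover have "\<And>p. p \<in> T \<Longrightarrow> prime p" by (auto simp: T_def split: if_splits)
  ultimately obtain z where z: "solves z J0" "\<And>p. p \<in> T \<Longrightarrow> solves z (Jp p)" using comb[of T] by blast
  have "z - s \<in> cng C k" if j: "(s, C, k) \<in> J" for s C k
  proof (cases "k = 0")
    case True
    then have "(s, C, k) \<in> J0" using j by (simp add: J0_def)
    from solvesD[OF z(1) this] show ?thesis .
  next
    case False
    show ?thesis
    proof (rule cng_prime_powers[OF convex_subgroup_subgrp[OF J[OF j]] False])
      fix p :: int assume "prime p" "p dvd k"
      then have "p \<in> prime_factors k" using False by (simp add: prime_factors_dvd)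
      then have "p \<in> T" unfolding T_def by (intro UN_I[OF j]) (simp add: False)
      moreover have "(s, C, p ^ multiplicity p k) \<in> Jp p"
        using j False by (auto simp: Jp_def prime_part_def intro!: image_eqI)
      ultimately show "z - s \<in> cng C (p ^ multiplicity p k)" using solvesD[OF z(2)] by blast
    qed
  qed
  then have "solves z J" by (auto simp: solves_def)
  then show ?thesis ..
qed

section \<open>Elimination of quantified congruences\<close>

definition cng_atoms :: "'a :: linordered_ab_group_add set set \<Rightarrow> (nat \<Rightarrow> 'a) set set" where
  "cng_atoms \<C> = {{e. f e \<in> cng C k} | f C k. affine f \<and> C \<in> \<C>}"

lemma cng_atomsI: "affine f \<Longrightarrow> C \<in> \<C> \<Longrightarrow> {e. f e \<in> cng C k} \<in> cng_atoms \<C>"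
  unfolding cng_atoms_def by blast

type_synonym 'a cng_term = "((nat \<Rightarrow> 'a) \<Rightarrow> 'a) \<times> 'a set \<times> int"

definition good_cngs :: "'a :: linordered_ab_group_add set set \<Rightarrow> 'a cng_term set \<Rightarrow> bool" where
  "good_cngs \<C> P \<longleftrightarrow> finite P \<and> (\<forall>(f, C, k) \<in> P. affine f \<and> C \<in> \<C>)"

definition holds_cngs :: "'a :: linordered_ab_group_add cng_term set \<Rightarrow> 'a \<Rightarrow> (nat \<Rightarrow> 'a) \<Rightarrow> bool" where
  "holds_cngs P z e \<longleftrightarrow> (\<forall>(f, C, k) \<in> P. z - f e \<in> cng C k)"

definition fails_cngs :: "'a :: linordered_ab_group_add cng_term set \<Rightarrow> 'a \<Rightarrow> (nat \<Rightarrow> 'a) \<Rightarrow> bool" where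
  "fails_cngs N z e \<longleftrightarrow> (\<forall>(f, C, k) \<in> N. z - f e \<notin> cng C k)"

text \<open>\<open>compat\<close> is the eliminated form: it refers only to differences of the
  functions in \<open>P\<close>, which are affine again.\<close>

lemma exists_congruences:
  assumes \<C>: "\<And>C. C \<in> \<C> \<Longrightarrow> convex_subgroup C" and P: "good_cngs \<C> P" 
  shows "{e. \<exists>z. holds_cngs P z e} \<in> boolgen (cng_atoms \<C>)"
proof -
  define J where "J e = (\<lambda>(f, C, k). (f e, C, k)) ` P" for e
  have Jc: "convex_subgroup C" if "(s, C, k) \<in> J e" for s C k e
    using that P \<C> by (auto simp: J_def good_cngs_def)
  have "holds_cngs P z e \<longleftrightarrow> solves z (J e)" for z e
    by (auto simp: holds_cngs_def solves_def J_def)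
  moreover have "(\<exists>z. solves z (J e)) \<longleftrightarrow> compat (J e)" for e
    using congruences_solvable[of "J e"] solves_compat[of "J e"] Jc P
    by (auto simp: good_cngs_def J_def)
  moreover have "compat (J e) \<longleftrightarrow>
      (\<forall>p \<in> P. \<forall>q \<in> P. fst p e - fst q e \<in> cng (fst (snd p) \<union> fst (snd q)) (gcd (snd (snd p)) (snd (snd q))))" for e
    by (simp add: compat_def J_def case_prod_unfold)
  ultimately have "{e. \<exists>z. holds_cngs P z e} = {e. \<forall>p \<in> P. \<forall>q \<in> P.
      fst p e - fst q e \<in> cng (fst (snd p) \<union> fst (snd q)) (gcd (snd (snd p)) (snd (snd q)))}" by simp
  also have "\<dots> \<in> boolgen (cng_atoms \<C>)"
  proof (intro boolgen_ball boolgen_gen)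
    show "finite P" "finite P" using P by (auto simp: good_cngs_def)
    fix p q assume pq: "p \<in> P" "q \<in> P"
    obtain f C k g D l where [simp]: "p = (f, C, k)" "q = (g, D, l)" by (cases p; cases q) auto
    have *: "affine f" "affine g" "C \<in> \<C>" "D \<in> \<C>" using pq P by (auto simp: good_cngs_def)
    then have "C \<union> D \<in> \<C>" using convex_subgroup_linear[of C D] \<C> by (auto simp: Un_absorb1 Un_absorb2)
    moreover have "affine (\<lambda>e. f e - g e)" using * by (intro affine_diff)
    ultimately show "{e. fst p e - fst q e \<in> cng (fst (snd p) \<union> fst (snd q)) (gcd (snd (snd p)) (snd (snd q)))}
        \<in> cng_atoms \<C>" by (simp add: cng_atomsI)
  qed
  finally show ?thesis .
qed

text \<open>
  Relative to the coset defined by the positive conditions, a negated congruence whose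
  subgroup has finite index is a finite disjunction of congruences, with coset
  representatives as parameters; by Neumann's lemma those of infinite index can be dropped.
\<close>

lemma exists_congruences_neg:
  assumes \<C>: "\<And>C. C \<in> \<C> \<Longrightarrow> convex_subgroup C" and P: "good_cngs \<C> P" and N: "good_cngs \<C> N"
  shows "{e. \<exists>z. holds_cngs P z e \<and> fails_cngs N z e} \<in> boolgen (cng_atoms \<C>)"
  using P N
proof (induction "card N" arbitrary: P N rule: less_induct)
  case less
  \<comment> \<open>The solutions of the positive conditions form, if there are any, a coset of
    \<open>Q\<close>.\<close>
  define Q where "Q = (\<Inter>(f, C, k) \<in> P. cng C k)"
  have sub: "subgrp (cng C k)" if "(f, C, k) \<in> P \<union> N" for f C k
  proof -
    have "C \<in> \<C>" using that less.prems by (auto simp: good_cngs_def)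
    then show ?thesis by (intro subgrp_cng convex_subgroup_subgrp \<C>)
  qed
  have sQ: "subgrp Q" unfolding Q_def by (rule subgrp_Inter) (use sub in auto)
  have hQ: "z - w \<in> Q" if "holds_cngs P z e" "holds_cngs P w e" for z w e
  proof -
    have "z - w \<in> cng C k" if p: "(f, C, k) \<in> P" for f C k
    proof -
      have "z - f e \<in> cng C k" "w - f e \<in> cng C k"
        using p \<open>holds_cngs P z e\<close> \<open>holds_cngs P w e\<close> by (auto simp: holds_cngs_def)
      moreover have "subgrp (cng C k)" using sub p by blast
      ultimately show ?thesis using subgrp_diff[of "cng C k" "z - f e" "w - f e"] by simp
    qed
    then show ?thesis by (auto simp: Q_def)
  qed
  have addQ: "holds_cngs P (z + y) e" if "holds_cngs P z e" "y \<in> Q" for z y e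
    unfolding holds_cngs_def
  proof (clarify)
    fix f C k assume p: "(f, C, k) \<in> P"
    have "z - f e \<in> cng C k" "y \<in> cng C k" using p that by (auto simp: holds_cngs_def Q_def)
    moreover have "subgrp (cng C k)" using sub p by blast
    ultimately have "(z - f e) + y \<in> cng C k" by (intro subgrp_add)
    then show "z + y - f e \<in> cng C k" by (simp add: algebra_simps)
  qed
  show ?case
  proof (cases "\<exists>(f, C, k) \<in> N. finite_index Q (cng C k)")
    case True
    then obtain f C k where n: "(f, C, k) \<in> N" and "finite_index Q (cng C k)" by blast
    then obtain X where X: "finite X" "\<And>y. y \<in> Q \<Longrightarrow> \<exists>x \<in> X. y - x \<in> cng C k"
      by (auto simp: finite_index_def)
    define N' where "N' = N - {(f, C, k)}"
    have Nfin: "finite N" using less.prems(2) by (simp add: good_cngs_def)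
    have card: "card N' < card N" unfolding N'_def by (rule card_Diff1_less[OF Nfin n])
    have fC: "affine f" "C \<in> \<C>" using n less.prems(2) by (auto simp: good_cngs_def)
    have sC: "subgrp (cng C k)" using sub n by blast
    have N': "good_cngs \<C> N'" using less.prems(2) by (auto simp: good_cngs_def N'_def)
    have fails: "fails_cngs N z e \<longleftrightarrow> fails_cngs N' z e \<and> z - f e \<notin> cng C k" for z e
    proof -
      have "N = insert (f, C, k) N'" using n by (auto simp: N'_def)
      then show ?thesis by (auto simp: fails_cngs_def)
    qed
    have holds: "holds_cngs (insert (g, C, k) P) z e \<longleftrightarrow> z - g e \<in> cng C k \<and> holds_cngs P z e" for g z e
      by (auto simp: holds_cngs_def)
    have good: "good_cngs \<C> (insert (\<lambda>e. f e + x, C, k) P)" for x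
      using less.prems(1) fC affine_add[OF fC(1) affine_const] by (auto simp: good_cngs_def)
    have "{e. \<exists>z. holds_cngs P z e \<and> fails_cngs N z e} =
      {e. (\<not> (\<exists>z. holds_cngs (insert (\<lambda>e. f e + 0, C, k) P) z e) \<and> (\<exists>z. holds_cngs P z e \<and> fails_cngs N' z e)) \<or>
        (\<exists>x \<in> X - cng C k. \<exists>z. holds_cngs (insert (\<lambda>e. f e + x, C, k) P) z e \<and> fails_cngs N' z e)}"
      (is "Collect ?A = Collect ?B")
    proof (rule Collect_cong, rule iffI)
      fix e assume "?A e"
      then obtain z where z: "holds_cngs P z e" "fails_cngs N' z e" "z - f e \<notin> cng C k"
        using fails by blast
      show "?B e"
      proof (cases "\<exists>w. holds_cngs P w e \<and> w - f e \<in> cng C k")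
        case True
        then obtain w where w: "holds_cngs P w e" "w - f e \<in> cng C k" by blast
        obtain x where x: "x \<in> X" "(z - w) - x \<in> cng C k" using X(2)[OF hQ[OF z(1) w(1)]] by blast
        have "z - (f e + x) \<in> cng C k" using subgrp_add[OF sC x(2) w(2)] by (simp add: algebra_simps)
        moreover have "x \<notin> cng C k"
          using subgrp_add[OF sC calculation, of x] z(3) by auto
        ultimately show ?thesis using x(1) z holds[of "\<lambda>e. f e + x"] by blast
      next
        case False
        then show ?thesis using z holds[of "\<lambda>e. f e + 0"] by auto
      qed
    next
      fix e assume "?B e"
      then show "?A e"
      proof
        assume "\<not> (\<exists>z. holds_cngs (insert (\<lambda>e. f e + 0, C, k) P) z e) \<and> (\<exists>z. holds_cngs P z e \<and> fails_cngs N' z e)"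
        then show "?A e" using holds[of "\<lambda>e. f e + 0"] fails by auto
      next
        assume "\<exists>x \<in> X - cng C k. \<exists>z. holds_cngs (insert (\<lambda>e. f e + x, C, k) P) z e \<and> fails_cngs N' z e"
        then obtain x z where x: "x \<notin> cng C k" and z: "z - (f e + x) \<in> cng C k" "holds_cngs P z e" "fails_cngs N' z e"
          using holds[of "\<lambda>e. f e + _"] by auto
        have "z - f e \<notin> cng C k"
          using subgrp_diff[OF sC, of "z - f e" "z - (f e + x)"] x z(1) by auto
        then show "?A e" using z fails by blast
      qed
    qed
    also have "\<dots> \<in> boolgen (cng_atoms \<C>)"
      by (intro boolgen_disj boolgen_conj boolgen_not boolgen_bex exists_congruences \<C> good
          less.hyps[OF card _ N'] less.prems(1)) (use X(1) in auto)
    finally show ?thesis .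
  next
    case False
    have "{e. \<exists>z. holds_cngs P z e \<and> fails_cngs N z e} = {e. \<exists>z. holds_cngs P z e}"
    proof (rule Collect_cong, rule iffI)
      fix e assume "\<exists>z. holds_cngs P z e"
      then obtain a where a: "holds_cngs P a e" by blast
      show "\<exists>z. holds_cngs P z e \<and> fails_cngs N z e"
      proof (rule ccontr)
        assume no: "\<not> ?thesis"
        \<comment> \<open>Seen from the solution \<open>a\<close>, each negated condition excludes a
          coset; \<open>X R\<close> collects the cosets of one subgroup \<open>R\<close>, since
          several conditions may share it.\<close>
        define X where "X R = (\<lambda>(f, C, k). f e - a) ` {(f, C, k) \<in> N. cng C k = R}" for R
        have Nfin: "finite N" using less.prems(2) by (simp add: good_cngs_def)
        have "\<exists>R \<in> (\<lambda>(f, C, k). cng C k) ` N. finite_index Q R"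
        proof (rule coset_cover_finite_index[OF _ sQ])
          show "finite ((\<lambda>(f, C, k). cng C k) ` N)" using Nfin by simp
          show "subgrp R" if "R \<in> (\<lambda>(f, C, k). cng C k) ` N" for R using that sub by auto
          show "finite (X R)" for R unfolding X_def by (rule finite_imageI, rule finite_subset[OF _ Nfin]) auto
          fix y assume "y \<in> Q"
          from addQ[OF a this] no have "\<not> fails_cngs N (a + y) e" by blast
          then obtain f C k where n: "(f, C, k) \<in> N" "a + y - f e \<in> cng C k" by (auto simp: fails_cngs_def)
          then have "f e - a \<in> X (cng C k)" "y - (f e - a) \<in> cng C k"
            by (auto simp: X_def algebra_simps intro!: image_eqI)
          then show "\<exists>R \<in> (\<lambda>(f, C, k). cng C k) ` N. \<exists>x \<in> X R. y - x \<in> R"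
            using n(1) by (intro bexI[of _ "cng C k"]) (auto intro: image_eqI[of _ _ "(f, C, k)"])
        qed
        with False show False by auto
      qed
    qed blast
    then show ?thesis using exists_congruences[OF \<C> less.prems(1)] by simp
  qed
qed

section \<open>Order modulo convex subgroups and quantifier elimination\<close>

section \<open>Comparison modulo a convex subgroup\<close>

text \<open>For convex \<open>C\<close>: the class of \<open>x\<close> is positive in the ordered
  quotient by \<open>C\<close>.\<close>

definition gt :: "'a :: linordered_ab_group_add set \<Rightarrow> 'a \<Rightarrow> bool" where
  "gt C x \<longleftrightarrow> (\<forall>c \<in> C. c < x)"

lemma gt_pos: "convex_subgroup C \<Longrightarrow> gt C x \<Longrightarrow> 0 < x"
  using subgrp_0[OF convex_subgroup_subgrp[of C]] by (auto simp: gt_def)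

lemma gt_iff: "convex_subgroup C \<Longrightarrow> gt C x \<longleftrightarrow> 0 < x \<and> x \<notin> C"
  using gt_pos[of C x] convex_subgroup_between[of C 0 _ x] subgrp_0[OF convex_subgroup_subgrp[of C]]
  unfolding gt_def by (metis less_imp_le not_less order_less_irrefl)

lemma gt_mono: "gt D x \<Longrightarrow> C \<subseteq> D \<Longrightarrow> x \<le> y \<Longrightarrow> gt C y"
  unfolding gt_def by (meson less_le_trans subsetD)

lemma gt_add_mem: "convex_subgroup C \<Longrightarrow> gt C x \<Longrightarrow> c \<in> C \<Longrightarrow> gt C (x + c)"
  unfolding gt_def
proof
  fix d assume C: "convex_subgroup C" and "\<forall>c \<in> C. c < x" "c \<in> C" "d \<in> C"
  then have "d - c < x" using subgrp_diff[OF convex_subgroup_subgrp[OF C]] by blast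
  then show "d < x + c" by (simp add: algebra_simps)
qed

lemma gt_add: "convex_subgroup C \<Longrightarrow> gt C x \<Longrightarrow> gt C y \<Longrightarrow> gt C (x + y)"
  using gt_mono[of C x C "x + y"] gt_pos[of C y] by simp

lemma gt_trichotomy: "convex_subgroup C \<Longrightarrow> x \<in> C \<or> gt C x \<or> gt C (- x)"
  using gt_iff[of C x] gt_iff[of C "- x"] subgrp_minus_iff[OF convex_subgroup_subgrp, of C x]
    subgrp_0[OF convex_subgroup_subgrp, of C] by (cases x "0 :: 'a" rule: linorder_cases) auto

lemma gt_asym: "convex_subgroup C \<Longrightarrow> gt C x \<Longrightarrow> \<not> gt C (- x)"
  using gt_pos[of C x] gt_pos[of C "- x"] by auto

lemma gt_notin: "gt C x \<Longrightarrow> x \<notin> C" by (auto simp: gt_def)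

lemma not_gt_add: "convex_subgroup C \<Longrightarrow> \<not> gt C x \<Longrightarrow> \<not> gt C y \<Longrightarrow> \<not> gt C (x + y)"
proof
  assume C: "convex_subgroup C" "\<not> gt C x" "\<not> gt C y" "gt C (x + y)"
  obtain c d where "c \<in> C" "x \<le> c" "d \<in> C" "y \<le> d" using C by (auto simp: gt_def not_less)
  then have "c + d \<in> C" "x + y \<le> c + d"
    using subgrp_add[OF convex_subgroup_subgrp[OF C(1)]] by (auto intro: add_mono)
  with C(4) show False by (auto simp: gt_def)
qed

lemma ex_gt: "convex_subgroup C \<Longrightarrow> convex_subgroup D \<Longrightarrow> C \<subset> D \<Longrightarrow> \<exists>b \<in> D. gt C b"
proof -
  assume C: "convex_subgroup C" and D: "convex_subgroup D" and "C \<subset> D"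
  then obtain x where "x \<in> D" "x \<notin> C" by blast
  then obtain b where "b = x \<or> b = - x" "0 < b" "b \<notin> C" using convex_subgroup_pos_mem[OF C] by blast
  then show ?thesis
    using gt_iff[OF C] subgrp_minus[OF convex_subgroup_subgrp[OF D]] \<open>x \<in> D\<close> by blast
qed

text \<open>Upper bounds on \<open>z\<close> are expressed as lower bounds on \<open>- z\<close>.\<close>

definition low :: "bool \<Rightarrow> 'a :: linordered_ab_group_add set \<Rightarrow> 'a \<Rightarrow> 'a \<Rightarrow> bool" where
  "low b C t z \<longleftrightarrow> (if b then gt C (z - t) else \<not> gt C (t - z))"

text \<open>The whole coset of \<open>u\<close> modulo \<open>D\<close> satisfies the bound
  (\<open>low_coset_iff\<close>), expressed by one comparison modulo the larger of the two
  subgroups. If \<open>D\<close> is strictly larger, even a weak bound must hold strictly modulo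
  \<open>D\<close>, because the coset contains elements arbitrarily far down in
  \<open>D\<close>.\<close>

definition low_coset :: "bool \<Rightarrow> 'a :: linordered_ab_group_add set \<Rightarrow> 'a \<Rightarrow> 'a set \<Rightarrow> 'a \<Rightarrow> bool" where
  "low_coset b C t D u \<longleftrightarrow>
    (if b then gt (C \<union> D) (u - t) else if D \<subseteq> C then \<not> gt C (t - u) else gt D (u - t))"

lemma low_up: "low b C t z \<Longrightarrow> z \<le> z' \<Longrightarrow> low b C t z'"
  unfolding low_def using gt_mono[of C "z - t" C "z' - t"] gt_mono[of C "t - z'" C "t - z"] by auto

lemma low_gt: "convex_subgroup C \<Longrightarrow> gt C (z - t) \<Longrightarrow> low b C t z"
  unfolding low_def using gt_asym[of C "z - t"] by auto

lemma low_ge: "convex_subgroup D \<Longrightarrow> convex_subgroup C \<Longrightarrow> low b C t z \<Longrightarrow> C \<subseteq> D \<Longrightarrow> \<not> gt D (t - z)"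
  unfolding low_def using gt_asym[of C "z - t"] gt_mono[of D "t - z" C "t - z"] by (auto split: if_splits)

lemma low_coset_iff:
  assumes C: "convex_subgroup C" and D: "convex_subgroup D"
  shows "low_coset b C t D u \<longleftrightarrow> (\<forall>z. z - u \<in> D \<longrightarrow> low b C t z)"
proof -
  note sC = convex_subgroup_subgrp[OF C] and sD = convex_subgroup_subgrp[OF D]
  have CD: "C \<union> D = C \<and> D \<subseteq> C \<or> C \<union> D = D \<and> C \<subset> D" using convex_subgroup_linear[OF C D] by auto
  have cCD: "convex_subgroup (C \<union> D)" using CD C D by auto
  show ?thesis
  proof
    assume lc: "low_coset b C t D u"
    show "\<forall>z. z - u \<in> D \<longrightarrow> low b C t z"
    proof (intro allI impI)
      fix z assume z: "z - u \<in> D"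
      show "low b C t z"
      proof (cases "b \<or> \<not> D \<subseteq> C")
        case True
        then have "gt (C \<union> D) (u - t)" using lc CD by (auto simp: low_coset_def split: if_splits)
        then have "gt (C \<union> D) ((u - t) + (z - u))" using z by (intro gt_add_mem[OF cCD]) auto
        then have "gt C (z - t)" by (elim gt_mono) auto
        then show ?thesis by (rule low_gt[OF C])
      next
        case False
        then have "\<not> gt C (t - u)" "z - u \<in> C" using lc z by (auto simp: low_coset_def)
        then have "\<not> gt C (t - z)" using gt_add_mem[OF C, of "t - z" "z - u"] by auto
        then show ?thesis using False by (simp add: low_def)
      qed
    qed
  next
    assume all: "\<forall>z. z - u \<in> D \<longrightarrow> low b C t z"
    have u: "low b C t u" using all subgrp_0[OF sD] by auto
    show "low_coset b C t D u"
    proof (cases "D \<subseteq> C")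
      case True
      then show ?thesis using u by (auto simp: low_coset_def low_def Un_absorb2)
    next
      case False
      then have sub: "C \<subset> D" "C \<union> D = D" using CD by auto
      have "gt D (u - t)"
      proof (rule ccontr)
        assume "\<not> gt D (u - t)"
        then obtain d where d: "d \<in> D" "u - t \<le> d" by (auto simp: gt_def not_less)
        obtain b0 where b0: "b0 \<in> D" "gt C b0" using ex_gt[OF C D sub(1)] by blast
        \<comment> \<open>Moving down inside the coset by \<open>d + b0\<close> passes
          \<open>t\<close> by more than \<open>C\<close>.\<close>
        let ?z = "u - (d + b0)"
        have "?z - u \<in> D" using subgrp_minus[OF sD subgrp_add[OF sD d(1) b0(1)]] by simp
        then have "low b C t ?z" using all by blast
        moreover have "b0 \<le> t - ?z" using d(2) by (simp add: algebra_simps)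
        then have "gt C (t - ?z)" using gt_mono[OF b0(2)] by blast
        ultimately show False using low_ge[OF C C] by blast
      qed
      then show ?thesis using sub by (auto simp: low_coset_def)
    qed
  qed
qed

text \<open>A bound that cuts through a coset of \<open>D\<close> has its threshold \<open>t\<close>
  in that coset, by convexity. Hence \<open>t\<close> can represent the coset in place of the
  unknown \<open>z\<close>.\<close>

lemma low_coset_fails:
  assumes C: "convex_subgroup C" and D: "convex_subgroup D"
    and "low b C t z" "\<not> low_coset b C t D z"
  shows "t - z \<in> D \<and> C \<subset> D"
proof -
  note sC = convex_subgroup_subgrp[OF C] and sD = convex_subgroup_subgrp[OF D]
  obtain y where y: "y - z \<in> D" "\<not> low b C t y" using assms low_coset_iff[OF C D] by blast
  have nD: "\<not> D \<subseteq> C"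
  proof
    assume "D \<subseteq> C"
    then have "y - z \<in> C" "z - y \<in> C" using y(1) subgrp_diff_commute[OF sC, of y z] by auto
    then show False
      using assms(3) y(2) gt_add_mem[OF C, of "z - t" "y - z"] gt_add_mem[OF C, of "t - y" "y - z"]
      by (auto simp: low_def split: if_splits)
  qed
  then have CD: "C \<subset> D" using convex_subgroup_linear[OF C D] by auto
  obtain c where c: "c \<in> C" "t - z \<le> c"
    using low_ge[OF C C assms(3)] by (auto simp: gt_def not_less)
  have "\<exists>c \<in> C. y - t \<le> c"
  proof (cases b)
    case True then show ?thesis using y(2) by (auto simp: low_def gt_def not_less)
  next
    case False
    then have "0 < t - y" using y(2) gt_pos[OF C, of "t - y"] by (simp add: low_def)
    then show ?thesis using subgrp_0[OF sC] by (auto intro!: bexI[of _ 0] simp: algebra_simps)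
  qed
  then obtain c' where c': "c' \<in> C" "y - t \<le> c'" by blast
  have "(y - z) - c' \<in> D" using subgrp_diff[OF sD y(1)] c'(1) CD by blast
  moreover have "(y - z) - c' \<le> t - z" using c'(2) by (simp add: algebra_simps)
  ultimately have "t - z \<in> D" using convex_subgroup_between[OF D _ _ _ c(2)] c(1) CD by blast
  with CD show ?thesis by blast
qed

text \<open>\<open>w\<close> is raised by a multiple of \<open>K\<close> taken from
  \<open>D\<close>: far enough to pass \<open>t\<close> by more than \<open>C\<close>, yet inside
  the coset, and harmless for conditions with period \<open>K\<close>.\<close>

lemma low_lift:
  assumes C: "convex_subgroup C" and D: "convex_subgroup D" and "C \<subset> D" "w - t \<in> D" "0 < (K::int)"
  shows "\<exists>g. low b C t (w + zmul K g) \<and> w + zmul K g - t \<in> D"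
proof -
  note sD = convex_subgroup_subgrp[OF D]
  obtain b0 where b0: "b0 \<in> D" "gt C b0" using ex_gt[OF C D assms(3)] by blast
  \<comment> \<open>\<open>m\<close> is the absolute value of \<open>w - t\<close>.\<close>
  define m where "m = max (w - t) (t - w)"
  have "w - t \<le> m" and mt: "t - w \<le> m" by (simp_all add: m_def)
  moreover have "0 \<le> w - t \<or> 0 \<le> t - w" using linear[of t w] by simp
  ultimately have "0 \<le> m" by (meson order_trans)
  moreover have "m \<in> D"
    using assms(4) subgrp_diff_commute[OF sD, of w t] by (auto simp: m_def max_def)
  ultimately have m: "m \<in> D" "0 \<le> m" "t - w \<le> m" using mt by simp_all
  have "0 \<le> m + b0" using m(2) gt_pos[OF C b0(2)] by simp
  then have "m + b0 \<le> zmul K (m + b0)" using zmul_mono_left[of 1 K "m + b0"] assms(5) by simp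
  have "b0 = (m + b0) + (- m)" by simp
  also have "\<dots> \<le> zmul K (m + b0) + (w - t)"
    using \<open>m + b0 \<le> zmul K (m + b0)\<close> m(3) by (intro add_mono) (simp_all add: algebra_simps)
  finally have "b0 \<le> w + zmul K (m + b0) - t" by (simp add: algebra_simps)
  then have "gt C (w + zmul K (m + b0) - t)" using gt_mono[OF b0(2)] by blast
  moreover have "(w - t) + zmul K (m + b0) \<in> D"
    using assms(4) m(1) b0(1) sD by (intro subgrp_add subgrp_zmul)
  then have "w + zmul K (m + b0) - t \<in> D" by (simp add: algebra_simps)
  ultimately show ?thesis using low_gt[OF C] by blast
qed

text \<open>A representative of the least positive class of the quotient by \<open>C\<close> if
  there is one. The default \<open>0\<close> for dense or trivial quotients lets the same formulas
  serve in all cases.\<close>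

definition least_pos :: "'a :: linordered_ab_group_add set \<Rightarrow> 'a" where
  "least_pos C = (if \<exists>x. gt C x \<and> (\<forall>y. gt C y \<longrightarrow> \<not> gt C (x - y))
    then SOME x. gt C x \<and> (\<forall>y. gt C y \<longrightarrow> \<not> gt C (x - y)) else 0)"

lemma least_pos_cases:
  obtains (discrete) "gt C (least_pos C)" "\<And>y. gt C y \<Longrightarrow> \<not> gt C (least_pos C - y)"
  | (dense) "least_pos C = 0" "\<And>x. gt C x \<Longrightarrow> \<exists>y. gt C y \<and> gt C (x - y)"
proof (cases "\<exists>x. gt C x \<and> (\<forall>y. gt C y \<longrightarrow> \<not> gt C (x - y))")
  case True
  from someI_ex[OF this] have "gt C (least_pos C)" "\<And>y. gt C y \<Longrightarrow> \<not> gt C (least_pos C - y)"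
    using True by (auto simp: least_pos_def)
  then show ?thesis by (rule discrete)
next
  case False
  then show ?thesis by (intro dense) (auto simp: least_pos_def)
qed

lemma dense_divide:
  assumes C: "convex_subgroup C" and dense: "\<And>x. gt C x \<Longrightarrow> \<exists>y. gt C y \<and> gt C (x - y)" and x: "gt C x"
  shows "\<exists>b. gt C b \<and> gt C (x - zmul (int n) b)"
proof (induction n)
  case 0
  then show ?case using x by auto
next
  case (Suc n)
  then obtain b where b: "gt C b" "gt C (x - zmul (int n) b)" by blast
  obtain y where y: "gt C y" "gt C (x - zmul (int n) b - y)" using dense[OF b(2)] by blast
  define d where "d = min b y"
  have d: "gt C d" "d \<le> b" "d \<le> y" using b(1) y(1) by (auto simp: d_def min_def)
  have "zmul (int n) d + d \<le> zmul (int n) b + y"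
    using zmul_mono_right[of "int n" d b] d by (intro add_mono) auto
  then have "x - zmul (int n) b - y \<le> x - zmul (int (Suc n)) d"
    using zmul_succ[of "int n" d] by (simp add: algebra_simps)
  then show ?case using gt_mono[OF y(2)] d(1) by blast
qed

text \<open>In the discrete case the least positive element serves as \<open>b\<close>; in the dense
  case the interval can be divided.\<close>

lemma least_pos_room:
  assumes C: "convex_subgroup C" and "gt C (x - zmul (int n) (least_pos C))"
  shows "\<exists>b. gt C b \<and> gt C (x - zmul (int n) b)"
  using assms(2) dense_divide[OF C] by (cases rule: least_pos_cases[of C]) auto

text \<open>In the discrete case the classes between \<open>0\<close> and \<open>n\<close> steps are
  the multiples of the least positive one. In the dense case \<open>least_pos C\<close> is
  \<open>0\<close>, the hypotheses put \<open>y\<close> into \<open>C\<close>, and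
  \<open>l = 0\<close> serves.\<close>

lemma least_pos_enumerate:
  assumes C: "convex_subgroup C" and "\<not> gt C (- y)" "\<not> gt C (y - zmul (int n) (least_pos C))"
  shows "\<exists>l \<le> n. y - zmul (int l) (least_pos C) \<in> C"
proof (cases rule: least_pos_cases[of C])
  case dense
  then show ?thesis using assms gt_trichotomy[OF C, of y] by auto
next
  case discrete
  show ?thesis using assms(3)
  proof (induction n)
    case 0
    then show ?case using assms(2) gt_trichotomy[OF C, of y] by auto
  next
    case (Suc n)
    let ?p = "least_pos C"
    show ?case
    proof (cases "gt C (y - zmul (int n) ?p)")
      case True
      let ?w = "y - zmul (int n) ?p"
      have "\<not> gt C (?p - ?w)" by (rule discrete(2)[OF True])
      moreover have "?w - ?p = y - zmul (int (Suc n)) ?p"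
        using zmul_succ[of "int n" ?p] by (simp add: algebra_simps)
      ultimately have "y - zmul (int (Suc n)) ?p \<in> C"
        using gt_trichotomy[OF C, of "?w - ?p"] Suc.prems by (metis minus_diff_eq)
      then show ?thesis by blast
    next
      case False
      then show ?thesis using Suc.IH le_SucI by blast
    qed
  qed
qed


section \<open>Quantifier elimination for regular chains\<close>

definition next_in :: "'a set set \<Rightarrow> 'a set \<Rightarrow> 'a set \<Rightarrow> bool" where
  "next_in \<C> C C' \<longleftrightarrow> C \<in> \<C> \<and> C' \<in> \<C> \<and> C \<subset> C' \<and> (\<forall>D \<in> \<C>. C \<subset> D \<longrightarrow> C' \<subseteq> D)"

text \<open>\<open>regular\<close> is regularity of the successive quotients in the form in which it
  is applied: modulo \<open>n\<close>, every element of \<open>C'\<close> has a representative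
  between \<open>- n b\<close> and \<open>n b\<close>, however small the positive \<open>b\<close>
  is, as long as it lies outside \<open>C\<close>.\<close>

locale regular_chain =
  fixes \<C> :: "'a :: linordered_ab_group_add set set"
  assumes finite_chain: "finite \<C>" and convex: "\<And>C. C \<in> \<C> \<Longrightarrow> convex_subgroup C"
    and bot_mem: "{0} \<in> \<C>" and top_mem: "UNIV \<in> \<C>"
    and regular: "\<And>C C' a b n. next_in \<C> C C' \<Longrightarrow> a \<in> C' \<Longrightarrow> 0 < b \<Longrightarrow> b \<notin> C \<Longrightarrow> 0 < n \<Longrightarrow>
      \<exists>g. - zmul n b \<le> a - zmul n g \<and> a - zmul n g \<le> zmul n b"
begin

lemma next_exists:
  assumes "C \<in> \<C>" "C \<noteq> UNIV"
  shows "\<exists>C'. next_in \<C> C C'"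
proof -
  have "\<exists>m \<in> {D \<in> \<C>. C \<subset> D}. \<forall>x \<in> {D \<in> \<C>. C \<subset> D}. m \<subseteq> x"
  proof (rule finite_total_least)
    show "finite {D \<in> \<C>. C \<subset> D}" using finite_chain by simp
    show "{D \<in> \<C>. C \<subset> D} \<noteq> {}" using top_mem assms by auto
    show "x \<subseteq> y \<or> y \<subseteq> x" if "x \<in> {D \<in> \<C>. C \<subset> D}" "y \<in> {D \<in> \<C>. C \<subset> D}" for x y
      using convex_subgroup_linear[OF convex convex, of x y] that by blast
  qed (rule subset_trans)
  then obtain m where "m \<in> \<C>" "C \<subset> m" "\<forall>x \<in> \<C>. C \<subset> x \<longrightarrow> m \<subseteq> x" by blast
  then show ?thesis using assms(1) unfolding next_in_def by blast
qed

text \<open>Regularity yields a representative within \<open>K b\<close> of a prescribed point.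
  Aiming at \<open>t + (K + 1) b\<close> keeps it at distance at least \<open>b\<close> from both
  ends of an interval of length \<open>(2 K + 2) b\<close>; this is the origin of the
  constant.\<close>

lemma interval_representatives:
  assumes n: "next_in \<C> C C'" and K: "0 < K" and "w - t \<in> C'" "t' - t \<in> C'"
    and gap: "gt C (t' - t - zmul (int (nat (2 * K + 2))) (least_pos C))"
  shows "\<exists>g. gt C (w - zmul K g - t) \<and> gt C (t' - (w - zmul K g))"
proof -
  have C: "convex_subgroup C" "convex_subgroup C'" using n convex by (auto simp: next_in_def)
  note sC' = convex_subgroup_subgrp[OF C(2)]
  obtain b where b: "gt C b" "gt C (t' - t - zmul (2 * K + 2) b)"
    using least_pos_room[OF C(1) gap] K by auto
  have b0: "0 < b" using gt_pos[OF C(1) b(1)] .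
  have "b \<le> zmul (2 * K + 2) b" using zmul_mono_left[of 1 "2 * K + 2" b] b0 K by simp
  moreover have "zmul (2 * K + 2) b \<le> t' - t" using gt_pos[OF C(1) b(2)] by simp
  ultimately have "b \<in> C'"
    using convex_subgroup_between[OF C(2) subgrp_0[OF sC'] assms(4), of b] b0 by simp
  then have "(w - t) - zmul (K + 1) b \<in> C'" by (rule subgrp_diff[OF sC' assms(3) subgrp_zmul[OF sC']])
  from regular[OF n this b0 gt_notin[OF b(1)] K] obtain g where
    g: "- zmul K b \<le> (w - t) - zmul (K + 1) b - zmul K g" "(w - t) - zmul (K + 1) b - zmul K g \<le> zmul K b"
    by blast
  have "zmul (K + 1) b = zmul K b + b" by (rule zmul_succ)
  moreover have "zmul (2 * K + 2) b = zmul K b + zmul K b + b + b"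
  proof -
    have "2 * K + 2 = (K + 1) + (K + 1)" by simp
    then show ?thesis by (simp only: zmul_left_distrib) (simp add: algebra_simps)
  qed
  ultimately have "b \<le> w - zmul K g - t" "(t' - t - zmul (2 * K + 2) b) + b \<le> t' - (w - zmul K g)"
    using g by (simp_all add: algebra_simps)
  then show ?thesis using gt_mono[OF b(1)] gt_mono[OF gt_add[OF C(1) b(2) b(1)]] by blast
qed

text \<open>On the right, elements of \<open>S\<close> are constrained only by cosets of members of
  the chain, which are congruences with modulus \<open>0\<close>. Given \<open>z\<close>, take the
  largest \<open>C\<close> for which its coset stays within both bounds. At the successor
  \<open>C'\<close> the coset is cut by the lower bound, by the upper bound, or by both. After one
  cut the threshold replaces \<open>z\<close>, with \<open>low_lift\<close> as the converse. After
  two cuts the interval is either long modulo \<open>C\<close>, where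
  \<open>interval_representatives\<close> applies, or it meets only finitely many cosets of
  \<open>C\<close>, which are enumerated from \<open>t\<close>.\<close>

lemma interval_meets_iff:
  assumes K: "0 < K" and S: "\<And>z g. z \<in> S \<Longrightarrow> z + zmul K g \<in> S"
    and Ci: "Ci \<in> \<C>" and Cj: "Cj \<in> \<C>"
  shows "(\<exists>z \<in> S. low b Ci t z \<and> low b' Cj (- t') (- z)) \<longleftrightarrow>
    (\<exists>C \<in> \<C>. \<exists>l \<le> nat (2 * K + 2). low_coset b Ci t C (t + zmul (int l) (least_pos C)) \<and>
        low_coset b' Cj (- t') C (- (t + zmul (int l) (least_pos C))) \<and>
        (\<exists>z \<in> S. z - (t + zmul (int l) (least_pos C)) \<in> C)) \<or>
    (\<exists>C \<in> \<C>. Ci \<subset> C \<and> low_coset b' Cj (- t') C (- t) \<and> (\<exists>z \<in> S. z - t \<in> C)) \<or>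
    (\<exists>C \<in> \<C>. Cj \<subset> C \<and> low_coset b Ci t C t' \<and> (\<exists>z \<in> S. z - t' \<in> C)) \<or>
    (\<exists>(C, C') \<in> {(C, C'). next_in \<C> C C'}. Ci \<subseteq> C \<and> Cj \<subseteq> C \<and> t' - t \<in> C' \<and>
        gt C (t' - t - zmul (int (nat (2 * K + 2))) (least_pos C)) \<and> (\<exists>z \<in> S. z - t \<in> C'))"
    (is "?L \<longleftrightarrow> ?A \<or> ?B \<or> ?D \<or> ?E")
proof
  assume ?L
  then obtain z where z: "z \<in> S" "low b Ci t z" "low b' Cj (- t') (- z)" by blast
  define \<D> where "\<D> = {C \<in> \<C>. low_coset b Ci t C z \<and> low_coset b' Cj (- t') C (- z)}"
  have "low_coset c D s {0} y" if "D \<in> \<C>" "low c D s y" for c D s y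
    using that(2) by (subst low_coset_iff[OF convex[OF that(1)] convex[OF bot_mem]]) simp
  then have bot: "{0} \<in> \<D>" using bot_mem z Ci Cj by (simp add: \<D>_def)
  have "\<exists>m \<in> \<D>. \<forall>x \<in> \<D>. x \<subseteq> m"
  proof (rule finite_total_least)
    show "finite \<D>" using finite_chain by (simp add: \<D>_def)
    show "\<D> \<noteq> {}" using bot by blast
    show "y \<subseteq> x \<or> x \<subseteq> y" if "x \<in> \<D>" "y \<in> \<D>" for x y
      using convex_subgroup_linear[OF convex convex, of x y] that by (auto simp: \<D>_def)
  qed blast
  then obtain C where C: "C \<in> \<D>" and max: "\<And>D. D \<in> \<D> \<Longrightarrow> D \<subseteq> C" by blast
  have CC: "C \<in> \<C>" using C by (simp add: \<D>_def)
  note cC = convex[OF CC]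
  have shift: "low_coset c D s E y \<longleftrightarrow> low_coset c D s E x" if "D \<in> \<C>" "E \<in> \<C>" "x - y \<in> E" for c D s E x y
  proof -
    have "v - y \<in> E \<longleftrightarrow> v - x \<in> E" for v
    proof -
      have sE: "subgrp E" using convex_subgroup_subgrp[OF convex[OF that(2)]] .
      have "v - y = (v - x) + (x - y)" by simp
      then show ?thesis using subgrp_add_cancel[OF sE that(3), of "v - x"] by simp
    qed
    then show ?thesis using low_coset_iff[OF convex[OF that(1)] convex[OF that(2)]] by simp
  qed
  show "?A \<or> ?B \<or> ?D \<or> ?E"
  proof (cases "C = UNIV")
    case True
    \<comment> \<open>All elements satisfy both bounds; \<open>t\<close> itself, with
      \<open>l = 0\<close>, represents the only coset.\<close>
    then have "low_coset b Ci t UNIV t" "low_coset b' Cj (- t') UNIV (- t)"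
      using C shift[OF Ci top_mem, of z t] shift[OF Cj top_mem, of "- z" "- t"] by (auto simp: \<D>_def)
    then have ?A using top_mem z(1) by (intro bexI[of _ UNIV] exI[of _ 0]) auto
    then show ?thesis by blast
  next
    case False
    obtain C' where n: "next_in \<C> C C'" using next_exists[OF CC False] by blast
    then have C': "C' \<in> \<C>" "C \<subset> C'" and least: "\<And>D. D \<in> \<C> \<Longrightarrow> C \<subset> D \<Longrightarrow> C' \<subseteq> D"
      by (auto simp: next_in_def)
    note sC' = convex_subgroup_subgrp[OF convex[OF C'(1)]]
    have le: "D \<subseteq> C" if "D \<in> \<C>" "D \<subset> C'" for D
      using least[OF that(1)] that(2) convex_subgroup_linear[OF cC convex[OF that(1)]] by auto
    have notD: "\<not> (low_coset b Ci t C' z \<and> low_coset b' Cj (- t') C' (- z))"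
      using max[of C'] C' by (auto simp: \<D>_def)
    have f1: "t - z \<in> C' \<and> Ci \<subset> C'" if "\<not> low_coset b Ci t C' z"
      by (rule low_coset_fails[OF convex[OF Ci] convex[OF C'(1)] z(2) that])
    have f2: "t' - z \<in> C' \<and> Cj \<subset> C'" if "\<not> low_coset b' Cj (- t') C' (- z)"
    proof -
      from low_coset_fails[OF convex[OF Cj] convex[OF C'(1)] z(3) that]
      have "- (t' - z) \<in> C'" "Cj \<subset> C'" by auto
      then show ?thesis using subgrp_minus_iff[OF sC'] by blast
    qed
    consider (a) "\<not> low_coset b Ci t C' z" "low_coset b' Cj (- t') C' (- z)"
      | (b) "low_coset b Ci t C' z" "\<not> low_coset b' Cj (- t') C' (- z)"
      | (c) "\<not> low_coset b Ci t C' z" "\<not> low_coset b' Cj (- t') C' (- z)"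
      using notD by blast
    then show ?thesis
    proof cases
      case a
      have tz: "t - z \<in> C'" "Ci \<subset> C'" using f1[OF a(1)] by auto
      then have "low_coset b' Cj (- t') C' (- t)" "z - t \<in> C'"
        using a(2) shift[OF Cj C'(1), of "- z" "- t"] subgrp_diff_commute[OF sC', of t z] by auto
      then have ?B using C'(1) tz z(1) by blast
      then show ?thesis by blast
    next
      case b
      have tz: "t' - z \<in> C'" "Cj \<subset> C'" using f2[OF b(2)] by auto
      then have zt: "z - t' \<in> C'" using subgrp_diff_commute[OF sC', of t' z] by blast
      then have "low_coset b Ci t C' t'" using b(1) shift[OF Ci C'(1), of z t'] by auto
      then have ?D using C'(1) tz zt z(1) by blast
      then show ?thesis by blast
    next
      case c
      have t: "t - z \<in> C'" "Ci \<subseteq> C" "t' - z \<in> C'" "Cj \<subseteq> C" using f1[OF c(1)] f2[OF c(2)] le Ci Cj by auto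
      have zt: "z - t \<in> C'" using t(1) subgrp_diff_commute[OF sC', of t z] by blast
      have tt: "t' - t \<in> C'" using subgrp_diff[OF sC' t(3) t(1)] by simp
      let ?n = "nat (2 * K + 2)" and ?p = "least_pos C"
      show ?thesis
      proof (cases "gt C (t' - t - zmul (int ?n) ?p)")
        case True
        then have ?E using n t tt zt z(1) by blast
        then show ?thesis by blast
      next
        case False
        \<comment> \<open>The interval is short modulo \<open>C\<close> and contains
          \<open>z\<close> up to \<open>C\<close>, so that \<open>z\<close> is one of finitely many
          steps above \<open>t\<close>.\<close>
        have g1: "\<not> gt C (- (z - t))" using low_ge[OF cC convex[OF Ci] z(2) t(2)] by simp
        have "\<not> gt C (z - t')" using low_ge[OF cC convex[OF Cj] z(3) t(4)] by simp
        from not_gt_add[OF cC this False] have "\<not> gt C (z - t - zmul (int ?n) ?p)"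
          by (simp add: algebra_simps)
        from least_pos_enumerate[OF cC g1 this] obtain l where
          l: "l \<le> ?n" "z - t - zmul (int l) ?p \<in> C" by blast
        let ?u = "t + zmul (int l) ?p"
        have zu: "z - ?u \<in> C" using l(2) by (simp add: algebra_simps)
        have "- z - (- ?u) = ?u - z" by (simp add: algebra_simps)
        then have uz: "- z - (- ?u) \<in> C"
          using zu subgrp_diff_commute[OF convex_subgroup_subgrp[OF cC], of z ?u] by metis
        have "low_coset b Ci t C ?u" "low_coset b' Cj (- t') C (- ?u)"
          using C shift[OF Ci CC zu] shift[OF Cj CC uz] by (auto simp: \<D>_def)
        then have ?A using CC l(1) zu z(1) by blast
        then show ?thesis by blast
      qed
    qed
  qed
next
  have lc: "low c D s z" if "low_coset c D s C u" "z - u \<in> C" "D \<in> \<C>" "C \<in> \<C>" for c D s C u z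
    using that low_coset_iff[OF convex convex] by blast
  have neg: "- z - (- u) \<in> C" if "z - u \<in> C" "C \<in> \<C>" for z u C
    using that subgrp_diff_commute[OF convex_subgroup_subgrp[OF convex], of C z u] by simp
  assume "?A \<or> ?B \<or> ?D \<or> ?E"
  then consider (A) ?A | (B) ?B | (D) ?D | (E) ?E by blast
  then show ?L
  proof cases
    case A
    then show ?thesis using lc[OF _ _ Ci] lc[OF _ neg Cj] by blast
  next
    case B
    then obtain C w where C: "C \<in> \<C>" "Ci \<subset> C" "low_coset b' Cj (- t') C (- t)" "w \<in> S" "w - t \<in> C" by blast
    from low_lift[OF convex[OF Ci] convex[OF C(1)] C(2,5) K] obtain g where
      "low b Ci t (w + zmul K g)" "w + zmul K g - t \<in> C" by blast
    then show ?thesis using S[OF C(4)] lc[OF C(3) neg[OF _ C(1)] Cj C(1)] by blast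
  next
    case D
    then obtain C w where C: "C \<in> \<C>" "Cj \<subset> C" "low_coset b Ci t C t'" "w \<in> S" "w - t' \<in> C" by blast
    from low_lift[OF convex[OF Cj] convex[OF C(1)] C(2) neg[OF C(5,1)] K] obtain g where
      g: "low b' Cj (- t') (- w + zmul K g)" "- w + zmul K g - - t' \<in> C" by blast
    let ?z = "w + zmul K (- g)"
    have "- ?z = - w + zmul K g" by simp
    moreover have "?z - t' \<in> C" using neg[OF g(2) C(1)] by (simp add: algebra_simps)
    ultimately show ?thesis using S[OF C(4)] lc[OF C(3) _ Ci C(1)] g(1) by metis
  next
    case E
    then obtain C C' w where C: "next_in \<C> C C'" "Ci \<subseteq> C" "Cj \<subseteq> C" "t' - t \<in> C'"
      "gt C (t' - t - zmul (int (nat (2 * K + 2))) (least_pos C))" "w \<in> S" "w - t \<in> C'" by blast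
    from interval_representatives[OF C(1) K C(7,4,5)] obtain g where
      g: "gt C (w - zmul K g - t)" "gt C (t' - (w - zmul K g))" by blast
    have "gt Ci (w - zmul K g - t)" "gt Cj (t' - (w - zmul K g))"
      using gt_mono[OF g(1) C(2)] gt_mono[OF g(2) C(3)] by blast+
    then have "low b Ci t (w - zmul K g)" "low b' Cj (- t') (- (w - zmul K g))"
      using low_gt[OF convex[OF Ci]] low_gt[OF convex[OF Cj], of "- (w - zmul K g)" "- t'"] by (auto simp: algebra_simps)
    then show ?thesis using S[OF C(6), of "- g"] by auto
  qed
qed

end

lemma boolgen_UNIV: "UNIV \<in> boolgen S"
  using boolgen_const[of True S] by simp

lemma gt_zmul:
  assumes C: "convex_subgroup C" and "0 < m"
  shows "gt C (zmul m x) \<longleftrightarrow> gt C x"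
  using gt_iff[OF C] zmul_pos_iff[OF assms(2)] convex_subgroup_pure[OF C, of m x] assms(2)
    subgrp_zmul[OF convex_subgroup_subgrp[OF C]] by auto

text \<open>Upward closed sets of a linear order form a chain, so finitely many lower bounds amount
  to one of them. The pairwise form does not mention which one, as the sharpest bound varies with
  the assignment.\<close>

lemma nested_bounds:
  fixes \<A> \<B> :: "'a :: linorder set set"
  assumes "finite \<A>" "\<A> \<noteq> {}" "finite \<B>" "\<B> \<noteq> {}"
    and up: "\<And>A x y. A \<in> \<A> \<Longrightarrow> x \<in> A \<Longrightarrow> x \<le> y \<Longrightarrow> y \<in> A"
    and down: "\<And>B x y. B \<in> \<B> \<Longrightarrow> y \<in> B \<Longrightarrow> x \<le> y \<Longrightarrow> x \<in> B"
  shows "(\<exists>z \<in> S. (\<forall>A \<in> \<A>. z \<in> A) \<and> (\<forall>B \<in> \<B>. z \<in> B)) \<longleftrightarrow> (\<forall>A \<in> \<A>. \<forall>B \<in> \<B>. \<exists>z \<in> S. z \<in> A \<and> z \<in> B)"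
proof
  assume R: "\<forall>A \<in> \<A>. \<forall>B \<in> \<B>. \<exists>z \<in> S. z \<in> A \<and> z \<in> B"
  have "\<exists>m \<in> \<A>. \<forall>x \<in> \<A>. m \<subseteq> x"
  proof (rule finite_total_least[OF assms(1,2)])
    show "x \<subseteq> y \<or> y \<subseteq> x" if "x \<in> \<A>" "y \<in> \<A>" for x y
      using up[OF that(1)] up[OF that(2)] by (meson linear subsetI)
  qed (rule subset_trans)
  moreover have "\<exists>m \<in> \<B>. \<forall>x \<in> \<B>. m \<subseteq> x"
  proof (rule finite_total_least[OF assms(3,4)])
    show "x \<subseteq> y \<or> y \<subseteq> x" if "x \<in> \<B>" "y \<in> \<B>" for x y
      using down[OF that(1)] down[OF that(2)] by (meson linear subsetI)
  qed (rule subset_trans)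
  ultimately obtain A B where A: "A \<in> \<A>" "\<forall>x \<in> \<A>. A \<subseteq> x" and B: "B \<in> \<B>" "\<forall>x \<in> \<B>. B \<subseteq> x" by blast
  from bspec[OF bspec[OF R A(1)] B(1)] obtain z where "z \<in> S" "z \<in> A" "z \<in> B" by blast
  with A(2) B(2) show "\<exists>z \<in> S. (\<forall>A \<in> \<A>. z \<in> A) \<and> (\<forall>B \<in> \<B>. z \<in> B)" by (meson subsetD)
next
  assume "\<exists>z \<in> S. (\<forall>A \<in> \<A>. z \<in> A) \<and> (\<forall>B \<in> \<B>. z \<in> B)"
  then show "\<forall>A \<in> \<A>. \<forall>B \<in> \<B>. \<exists>z \<in> S. z \<in> A \<and> z \<in> B" by meson
qed

type_synonym 'a bound = "bool \<times> 'a set \<times> ((nat \<Rightarrow> 'a) \<Rightarrow> 'a)"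

definition holds_low :: "'a :: linordered_ab_group_add bound set \<Rightarrow> 'a \<Rightarrow> (nat \<Rightarrow> 'a) \<Rightarrow> bool" where
  "holds_low B z e \<longleftrightarrow> (\<forall>(b, C, f) \<in> B. low b C (f e) z)"

context regular_chain
begin

text \<open>Modulus \<open>0\<close> is left out: membership in \<open>C\<close> is a combination of
  sign conditions, and positive moduli give all congruences a common positive period.\<close>

definition atoms :: "(nat \<Rightarrow> 'a) set set" where
  "atoms = {{e. gt C (f e)} | C f. C \<in> \<C> \<and> affine f} \<union>
    {{e. f e \<in> cng C k} | C f k. C \<in> \<C> \<and> affine f \<and> 0 < k}"

lemma gt_boolgen: "affine f \<Longrightarrow> C \<in> \<C> \<Longrightarrow> {e. gt C (f e)} \<in> boolgen atoms"
  by (rule boolgen_gen) (unfold atoms_def, blast)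

lemma cng_boolgen:
  assumes "affine f" "C \<in> \<C>" shows "{e. f e \<in> cng C k} \<in> boolgen atoms"
proof (cases "k = 0")
  case True
  have "f e \<in> C \<longleftrightarrow> \<not> gt C (f e) \<and> \<not> gt C (- f e)" for e
    using gt_trichotomy[OF convex[OF assms(2)], of "f e"] gt_notin[of C "f e"] gt_notin[of C "- f e"]
      subgrp_minus_iff[OF convex_subgroup_subgrp[OF convex[OF assms(2)]], of "f e"] by auto
  then have "{e. f e \<in> cng C k} = {e. \<not> gt C (f e) \<and> \<not> gt C (- f e)}" by (simp add: True cng_0)
  also have "\<dots> \<in> boolgen atoms"
    by (intro boolgen_conj boolgen_not gt_boolgen affine_minus assms)
  finally show ?thesis .
next
  case False
  then have "{e. f e \<in> cng C \<bar>k\<bar>} \<in> atoms" using assms unfolding atoms_def by fastforce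
  then show ?thesis by (simp add: cng_abs boolgen_gen)
qed

lemma mem_boolgen: "affine f \<Longrightarrow> C \<in> \<C> \<Longrightarrow> {e. f e \<in> C} \<in> boolgen atoms"
  using cng_boolgen[of f C 0] by (simp add: cng_0)

lemma cng_atoms_boolgen: "cng_atoms \<C> \<subseteq> boolgen atoms"
  using cng_boolgen by (auto simp: cng_atoms_def)

lemma low_coset_boolgen:
  assumes "affine f" "affine g" "C \<in> \<C>" "D \<in> \<C>"
  shows "{e. low_coset b C (f e) D (g e)} \<in> boolgen atoms"
proof -
  have "C \<union> D \<in> \<C>" using convex_subgroup_linear[OF convex convex, of C D] assms(3,4) by (auto simp: Un_absorb1 Un_absorb2)
  then show ?thesis
    using assms unfolding low_coset_def
    by (cases b; cases "D \<subseteq> C") (auto intro!: gt_boolgen boolgen_not affine_diff)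
qed

definition good_bounds :: "'a bound set \<Rightarrow> bool" where
  "good_bounds B \<longleftrightarrow> finite B \<and> (\<forall>(b, C, f) \<in> B. C \<in> \<C> \<and> affine f)"

text \<open>The variable \<open>z\<close> to be eliminated occurs with coefficient \<open>1\<close>
  or \<open>- 1\<close> only, and \<open>E\<close> takes the conditions without \<open>z\<close>.
  Atoms reach this shape after rescaling.\<close>

definition normal_form :: "('a \<Rightarrow> (nat \<Rightarrow> 'a) \<Rightarrow> bool) \<Rightarrow> bool" where
  "normal_form R \<longleftrightarrow> (\<exists>L U P N E. good_bounds L \<and> good_bounds U \<and> good_cngs \<C> P \<and> good_cngs \<C> N \<and>
    (\<forall>(f, C, k) \<in> P \<union> N. 0 < k) \<and> {e. E e} \<in> boolgen atoms \<and>
    (\<forall>z e. R z e \<longleftrightarrow> holds_low L z e \<and> holds_low U (- z) e \<and> holds_cngs P z e \<and> fails_cngs N z e \<and> E e))"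

lemma normal_formI:
  assumes "good_bounds L" "good_bounds U" "good_cngs \<C> P" "good_cngs \<C> N"
    "\<forall>(f, C, k) \<in> P \<union> N. 0 < k" "{e. E e} \<in> boolgen atoms"
    "\<And>z e. R z e \<longleftrightarrow> holds_low L z e \<and> holds_low U (- z) e \<and> holds_cngs P z e \<and> fails_cngs N z e \<and> E e"
  shows "normal_form R"
  unfolding normal_form_def
  by (intro exI[of _ L] exI[of _ U] exI[of _ P] exI[of _ N] exI[of _ E] conjI allI assms)

lemma normal_form_side: "{e. E e} \<in> boolgen atoms \<Longrightarrow> normal_form (\<lambda>z e. E e)"
  by (rule normal_formI[of "{}" "{}" "{}" "{}" E])
    (auto simp: good_bounds_def good_cngs_def holds_low_def holds_cngs_def fails_cngs_def)

lemma normal_form_low: "affine f \<Longrightarrow> C \<in> \<C> \<Longrightarrow> normal_form (\<lambda>z e. low b C (f e) z)"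
  by (rule normal_formI[of "{(b, C, f)}" "{}" "{}" "{}" "\<lambda>_. True"])
    (auto simp: good_bounds_def good_cngs_def holds_low_def holds_cngs_def fails_cngs_def boolgen_UNIV)

lemma normal_form_up: "affine f \<Longrightarrow> C \<in> \<C> \<Longrightarrow> normal_form (\<lambda>z e. low b C (f e) (- z))"
  by (rule normal_formI[of "{}" "{(b, C, f)}" "{}" "{}" "\<lambda>_. True"])
    (auto simp: good_bounds_def good_cngs_def holds_low_def holds_cngs_def fails_cngs_def boolgen_UNIV)

lemma normal_form_cng: "affine f \<Longrightarrow> C \<in> \<C> \<Longrightarrow> 0 < k \<Longrightarrow> normal_form (\<lambda>z e. z - f e \<in> cng C k)"
  by (rule normal_formI[of "{}" "{}" "{(f, C, k)}" "{}" "\<lambda>_. True"])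
    (auto simp: good_bounds_def good_cngs_def holds_low_def holds_cngs_def fails_cngs_def boolgen_UNIV)

lemma normal_form_not_cng: "affine f \<Longrightarrow> C \<in> \<C> \<Longrightarrow> 0 < k \<Longrightarrow> normal_form (\<lambda>z e. z - f e \<notin> cng C k)"
  by (rule normal_formI[of "{}" "{}" "{}" "{(f, C, k)}" "\<lambda>_. True"])
    (auto simp: good_bounds_def good_cngs_def holds_low_def holds_cngs_def fails_cngs_def boolgen_UNIV)

lemma normal_form_conj:
  assumes "normal_form R" "normal_form R'"
  shows "normal_form (\<lambda>z e. R z e \<and> R' z e)"
proof -
  obtain L U P N E where 1: "good_bounds L" "good_bounds U" "good_cngs \<C> P" "good_cngs \<C> N"
    "\<forall>(f, C, k) \<in> P \<union> N. 0 < k" "{e. E e} \<in> boolgen atoms"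
    and R: "\<And>z e. R z e \<longleftrightarrow> holds_low L z e \<and> holds_low U (- z) e \<and> holds_cngs P z e \<and> fails_cngs N z e \<and> E e"
    using assms(1) unfolding normal_form_def by metis
  obtain L' U' P' N' E' where 2: "good_bounds L'" "good_bounds U'" "good_cngs \<C> P'" "good_cngs \<C> N'"
    "\<forall>(f, C, k) \<in> P' \<union> N'. 0 < k" "{e. E' e} \<in> boolgen atoms"
    and R': "\<And>z e. R' z e \<longleftrightarrow> holds_low L' z e \<and> holds_low U' (- z) e \<and> holds_cngs P' z e \<and> fails_cngs N' z e \<and> E' e"
    using assms(2) unfolding normal_form_def by metis
  show ?thesis
  proof (rule normal_formI)
    show "good_bounds (L \<union> L')" "good_bounds (U \<union> U')" "good_cngs \<C> (P \<union> P')" "good_cngs \<C> (N \<union> N')"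
      using 1 2 unfolding good_bounds_def good_cngs_def by blast+
    show "\<forall>(f, C, k) \<in> (P \<union> P') \<union> (N \<union> N'). 0 < k" using 1(5) 2(5) by blast
    show "{e. E e \<and> E' e} \<in> boolgen atoms" using 1(6) 2(6) by (rule boolgen_conj)
    show "R z e \<and> R' z e \<longleftrightarrow> holds_low (L \<union> L') z e \<and> holds_low (U \<union> U') (- z) e \<and>
        holds_cngs (P \<union> P') z e \<and> fails_cngs (N \<union> N') z e \<and> (E e \<and> E' e)" for z e
      unfolding R R' holds_low_def holds_cngs_def fails_cngs_def by blast
  qed
qed

lemma normal_form_ball:
  assumes "finite A" "\<And>a. a \<in> A \<Longrightarrow> normal_form (R a)"
  shows "normal_form (\<lambda>z e. \<forall>a \<in> A. R a z e)"
  using assms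
proof (induction A rule: finite_induct)
  case empty
  then show ?case using normal_form_side[of "\<lambda>_. True"] by (simp add: boolgen_UNIV)
next
  case (insert a A)
  have "normal_form (\<lambda>z e. R a z e \<and> (\<forall>a \<in> A. R a z e))"
    by (rule normal_form_conj) (use insert in auto)
  then show ?case by simp
qed

text \<open>Three reductions: many bounds to a single pair (\<open>nested_bounds\<close>), an
  interval to cosets (\<open>interval_meets_iff\<close>), and cosets to congruences, where
  \<open>exists_congruences_neg\<close> finishes.\<close>

lemma normal_form_exists:
  assumes "normal_form R"
  shows "{e. \<exists>z. R z e} \<in> boolgen atoms"
proof -
  obtain L0 U0 P N E where 1: "good_bounds L0" "good_bounds U0" "good_cngs \<C> P" "good_cngs \<C> N"
    "\<forall>(f, C, k) \<in> P \<union> N. 0 < k" "{e. E e} \<in> boolgen atoms"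
    and R: "\<And>z e. R z e \<longleftrightarrow> holds_low L0 z e \<and> holds_low U0 (- z) e \<and> holds_cngs P z e \<and> fails_cngs N z e \<and> E e"
    using assms unfolding normal_form_def by metis
  \<comment> \<open>The trivial bounds modulo \<open>UNIV\<close> make both families nonempty, as
    \<open>nested_bounds\<close> requires.\<close>
  define L where "L = insert (False, UNIV, \<lambda>_. 0) L0"
  define U where "U = insert (False, UNIV, \<lambda>_. 0) U0"
  have gb: "good_bounds L" "good_bounds U"
    using 1(1,2) top_mem affine_const by (auto simp: good_bounds_def L_def U_def)
  have triv: "low False UNIV t z" for t z :: 'a by (auto simp: low_def gt_def)
  have LU: "holds_low L0 z e \<longleftrightarrow> holds_low L z e" "holds_low U0 z e \<longleftrightarrow> holds_low U z e" for z e
    using triv by (auto simp: L_def U_def holds_low_def)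
  define S where "S e = {z. holds_cngs P z e \<and> fails_cngs N z e}" for e
  \<comment> \<open>The product of the moduli is a common period of all congruences.\<close>
  define K where "K = (\<Prod>(f, C, k) \<in> P \<union> N. k)"
  have fin: "finite (P \<union> N)" using 1(3,4) by (simp add: good_cngs_def)
  have k0: "0 < k" if "(f, C, k) \<in> P \<union> N" for f C k using 1(5) that by blast
  have K0: "0 < K" unfolding K_def by (rule prod_pos) (use k0 in auto)
  have dvdK: "k dvd K" if "(f, C, k) \<in> P \<union> N" for f C k
    unfolding K_def using dvd_prodI[OF fin that, of "\<lambda>(f, C, k). k"] by simp
  have per: "z + zmul K g \<in> S e" if "z \<in> S e" for z g e
  proof -
    have *: "(z + zmul K g) - f e \<in> cng C k \<longleftrightarrow> z - f e \<in> cng C k" if "(f, C, k) \<in> P \<union> N" for f C k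
    proof -
      have "C \<in> \<C>" using that 1(3,4) by (auto simp: good_cngs_def)
      note sC = convex_subgroup_subgrp[OF convex[OF this]]
      have "(z + zmul K g) - f e = (z - f e) + zmul K g" by simp
      then show ?thesis
        using subgrp_add_cancel[OF subgrp_cng[OF sC] cng_zmul[OF sC dvdK[OF that]]] by metis
    qed
    show ?thesis using that * unfolding S_def holds_cngs_def fails_cngs_def by blast
  qed
  \<comment> \<open>Membership in a coset of \<open>C\<close> is a congruence with modulus
    \<open>0\<close> and joins the positive conditions.\<close>
  have sec: "{e. \<exists>z \<in> S e. z - u e \<in> C} \<in> boolgen atoms" if "affine u" "C \<in> \<C>" for u C
  proof -
    have "{e. \<exists>z \<in> S e. z - u e \<in> C} = {e. \<exists>z. holds_cngs (insert (u, C, 0) P) z e \<and> fails_cngs N z e}"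
      by (auto simp: S_def holds_cngs_def cng_0)
    also have "\<dots> \<in> boolgen (cng_atoms \<C>)"
      by (rule exists_congruences_neg[OF convex]) (use that 1(3,4) in \<open>auto simp: good_cngs_def\<close>)
    finally show ?thesis by (rule boolgen_mono[OF cng_atoms_boolgen])
  qed
  have fin_next: "finite {(C, C'). next_in \<C> C C'}"
    by (rule finite_subset[of _ "\<C> \<times> \<C>"]) (use finite_chain in \<open>auto simp: next_in_def\<close>)
  have pair: "{e. \<exists>z \<in> S e. low b Ci (f e) z \<and> low b' Cj (g e) (- z)} \<in> boolgen atoms"
    if "affine f" "affine g" "Ci \<in> \<C>" "Cj \<in> \<C>" for b b' Ci Cj f g
  proof -
    have iff: "(\<exists>z \<in> S e. low b Ci (f e) z \<and> low b' Cj (g e) (- z)) \<longleftrightarrow>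
      (\<exists>C \<in> \<C>. \<exists>l \<in> {..nat (2 * K + 2)}. low_coset b Ci (f e) C (f e + zmul (int l) (least_pos C)) \<and>
        low_coset b' Cj (g e) C (- (f e + zmul (int l) (least_pos C))) \<and>
        (\<exists>z \<in> S e. z - (f e + zmul (int l) (least_pos C)) \<in> C)) \<or>
      (\<exists>C \<in> \<C>. Ci \<subset> C \<and> low_coset b' Cj (g e) C (- f e) \<and> (\<exists>z \<in> S e. z - f e \<in> C)) \<or>
      (\<exists>C \<in> \<C>. Cj \<subset> C \<and> low_coset b Ci (f e) C (- g e) \<and> (\<exists>z \<in> S e. z - - g e \<in> C)) \<or>
      (\<exists>p \<in> {(C, C'). next_in \<C> C C'}. Ci \<subseteq> fst p \<and> Cj \<subseteq> fst p \<and> - g e - f e \<in> snd p \<and>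
        gt (fst p) (- g e - f e - zmul (int (nat (2 * K + 2))) (least_pos (fst p))) \<and>
        (\<exists>z \<in> S e. z - f e \<in> snd p))" for e
      using interval_meets_iff[OF K0 per that(3,4), of e b "f e" b' "- g e"]
      unfolding minus_minus case_prod_unfold Bex_def atMost_iff .
    have n: "fst p \<in> \<C>" "snd p \<in> \<C>" if "p \<in> {(C, C'). next_in \<C> C C'}" for p
      using that by (auto simp: next_in_def)
    show ?thesis
      unfolding iff
      by (intro boolgen_disj boolgen_bex boolgen_conj boolgen_const low_coset_boolgen sec gt_boolgen mem_boolgen
          affine_add affine_diff affine_minus affine_const finite_chain finite_atMost fin_next that n)
  qed
  have fL: "finite L" "finite U" using gb by (auto simp: good_bounds_def)
  have nested: "(\<exists>z \<in> S e. holds_low L z e \<and> holds_low U (- z) e) \<longleftrightarrow>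
    (\<forall>l \<in> L. \<forall>u \<in> U. \<exists>z \<in> S e. low (fst l) (fst (snd l)) (snd (snd l) e) z \<and>
        low (fst u) (fst (snd u)) (snd (snd u) e) (- z))" for e
  proof -
    let ?A = "(\<lambda>l. {z. low (fst l) (fst (snd l)) (snd (snd l) e) z}) ` L"
    let ?B = "(\<lambda>u. {z. low (fst u) (fst (snd u)) (snd (snd u) e) (- z)}) ` U"
    have "(\<exists>z \<in> S e. (\<forall>A \<in> ?A. z \<in> A) \<and> (\<forall>B \<in> ?B. z \<in> B)) \<longleftrightarrow>
        (\<forall>A \<in> ?A. \<forall>B \<in> ?B. \<exists>z \<in> S e. z \<in> A \<and> z \<in> B)"
    proof (rule nested_bounds)
      show "finite ?A" "finite ?B" using fL by auto
      show "?A \<noteq> {}" "?B \<noteq> {}" by (auto simp: L_def U_def)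
      show "y \<in> A" if "A \<in> ?A" "x \<in> A" "x \<le> y" for A x y
        using that(1,2) low_up[OF _ that(3)] by auto
      show "x \<in> A" if "A \<in> ?B" "y \<in> A" "x \<le> y" for A x y
      proof -
        have "- y \<le> - x" using that(3) by simp
        then show ?thesis using that(1,2) low_up[OF _ \<open>- y \<le> - x\<close>] by auto
      qed
    qed
    then show ?thesis by (simp add: holds_low_def case_prod_unfold)
  qed
  have "(\<exists>z. R z e) \<longleftrightarrow> (\<exists>z \<in> S e. holds_low L z e \<and> holds_low U (- z) e) \<and> E e" for e
    unfolding R LU S_def by blast
  then have "{e. \<exists>z. R z e} = {e. (\<forall>l \<in> L. \<forall>u \<in> U. \<exists>z \<in> S e. low (fst l) (fst (snd l)) (snd (snd l) e) z \<and>
        low (fst u) (fst (snd u)) (snd (snd u) e) (- z)) \<and> E e}"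
    unfolding nested by simp
  also have "\<dots> \<in> boolgen atoms"
    using gb by (intro boolgen_conj boolgen_ball fL pair 1(6)) (auto simp: good_bounds_def)
  finally show ?thesis .
qed

text \<open>The atom is multiplied so that the coefficient of \<open>z\<close> becomes
  \<open>l\<close>; then only \<open>l z\<close> occurs. Signs survive a positive factor, and
  congruences are scaled together with their modulus. The complement is treated alongside, since
  \<open>normal_form\<close> is not closed under negation.\<close>

lemma atom_normal_form:
  assumes "X \<in> atoms"
  shows "\<exists>l0 > 0. \<forall>l > 0. l0 dvd l \<longrightarrow> (\<exists>R R'. normal_form R \<and> normal_form R' \<and>
    (\<forall>z e. (e(i := z) \<in> X \<longleftrightarrow> R (zmul l z) e) \<and> (e(i := z) \<notin> X \<longleftrightarrow> R' (zmul l z) e)))"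
proof -
  obtain C f where Cf: "C \<in> \<C>" "affine f"
    and X: "X = {e. gt C (f e)} \<or> (\<exists>k > 0. X = {e. f e \<in> cng C k})"
    using assms unfolding atoms_def by (elim UnE CollectE exE conjE) metis+
  note cC = convex[OF Cf(1)]
  note sC = convex_subgroup_subgrp[OF cC]
  obtain n g where g: "affine g" "\<And>e z. f (e(i := z)) = zmul n z + g e"
    by (rule affine_split[OF Cf(2), of i]) (rule that)
  show ?thesis
  proof (cases "n = 0")
    case True
    then have g': "f (e(i := z)) = g e" for e z using g(2) by simp
    define E where "E e \<longleftrightarrow> e(i := 0) \<in> X" for e
    have X': "e(i := z) \<in> X \<longleftrightarrow> E e" for e z using X g' by (auto simp: E_def)
    have "{e. E e} \<in> boolgen atoms"
      using X g' gt_boolgen[OF g(1) Cf(1)] cng_boolgen[OF g(1) Cf(1)] by (auto simp: E_def)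
    then have "normal_form (\<lambda>z e. E e)" "normal_form (\<lambda>z e. \<not> E e)"
      using normal_form_side boolgen_not by blast+
    then show ?thesis using X' by (intro exI[of _ 1]) auto
  next
    case False
    have "\<exists>R R'. normal_form R \<and> normal_form R' \<and>
      (\<forall>z e. (e(i := z) \<in> X \<longleftrightarrow> R (zmul l z) e) \<and> (e(i := z) \<notin> X \<longleftrightarrow> R' (zmul l z) e))"
      if l: "0 < l" "n dvd l" for l
    proof -
      obtain m where m: "l = n * m" using l(2) by auto
      have scale: "zmul m (f (e(i := z))) = zmul l z + zmul m (g e)" for e z
        by (simp add: g(2) zmul.scale_right_distrib m mult.commute)
      have m0: "m \<noteq> 0" using l(1) m by auto
      have aff: "affine (\<lambda>e. zmul m (g e))" "affine (\<lambda>e. - zmul m (g e))"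
        using g(1) by (auto intro: affine_zmul affine_minus)
      from X show ?thesis
      proof
        assume X: "X = {e. gt C (f e)}"
        show ?thesis
        proof (cases "0 < m")
          case True
          have "e(i := z) \<in> X \<longleftrightarrow> gt C (zmul l z + zmul m (g e))" for e z
            using gt_zmul[OF cC True, of "f (e(i := z))"] by (simp add: X scale)
          then show ?thesis
            using normal_form_low[OF aff(2) Cf(1), of True] normal_form_up[OF aff(1) Cf(1), of False]
            by (intro exI[of _ "\<lambda>w e. low True C (- zmul m (g e)) w"] exI[of _ "\<lambda>w e. low False C (zmul m (g e)) (- w)"])
              (auto simp: low_def algebra_simps)
        next
          case False
          have "e(i := z) \<in> X \<longleftrightarrow> gt C (- (zmul l z + zmul m (g e)))" for e z
            using gt_zmul[OF cC, of "- m" "f (e(i := z))"] False m0 by (simp add: X scale)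
          then show ?thesis
            using normal_form_up[OF aff(1) Cf(1), of True] normal_form_low[OF aff(2) Cf(1), of False]
            by (intro exI[of _ "\<lambda>w e. low True C (zmul m (g e)) (- w)"] exI[of _ "\<lambda>w e. low False C (- zmul m (g e)) w"])
              (auto simp: low_def algebra_simps minus_diff_commute)
        qed
      next
        assume "\<exists>k > 0. X = {e. f e \<in> cng C k}"
        then obtain k where k: "0 < k" "X = {e. f e \<in> cng C k}" by blast
        have "e(i := z) \<in> X \<longleftrightarrow> zmul l z - - zmul m (g e) \<in> cng C \<bar>m * k\<bar>" for e z
          using cng_scale[OF cC m0, of "f (e(i := z))" k] by (simp only: k(2) cng_abs scale) simp
        moreover have "0 < \<bar>m * k\<bar>" using m0 k(1) by simp
        ultimately show ?thesis
          using normal_form_cng[OF aff(2) Cf(1)] normal_form_not_cng[OF aff(2) Cf(1)]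
          by (intro exI[of _ "\<lambda>w e. w - - zmul m (g e) \<in> cng C \<bar>m * k\<bar>"]
              exI[of _ "\<lambda>w e. w - - zmul m (g e) \<notin> cng C \<bar>m * k\<bar>"]) simp
      qed
    qed
    then show ?thesis using False by (intro exI[of _ "\<bar>n\<bar>"]) auto
  qed
qed

lemma atoms_exists:
  assumes "E \<in> boolgen atoms"
  shows "{e. \<exists>z. e(i := z) \<in> E} \<in> boolgen atoms"
proof (rule boolgen_exists[OF _ assms])
  fix P Q assume PQ: "finite P" "finite Q" "P \<subseteq> atoms" "Q \<subseteq> atoms"
  have "\<forall>X \<in> P \<union> Q. \<exists>l0 > 0. \<forall>l > 0. l0 dvd l \<longrightarrow> (\<exists>R R'. normal_form R \<and> normal_form R' \<and>
    (\<forall>z e. (e(i := z) \<in> X \<longleftrightarrow> R (zmul l z) e) \<and> (e(i := z) \<notin> X \<longleftrightarrow> R' (zmul l z) e)))"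
    using atom_normal_form PQ(3,4) by blast
  from bchoice[OF this] obtain l0 where l0: "\<forall>X \<in> P \<union> Q. 0 < l0 X \<and>
    (\<forall>l > 0. l0 X dvd l \<longrightarrow> (\<exists>R R'. normal_form R \<and> normal_form R' \<and>
    (\<forall>z e. (e(i := z) \<in> X \<longleftrightarrow> R (zmul l z) e) \<and> (e(i := z) \<notin> X \<longleftrightarrow> R' (zmul l z) e))))" ..
  define l where "l = prod l0 (P \<union> Q)"
  have lpos: "0 < l" unfolding l_def by (rule prod_pos) (use l0 in blast)
  have "\<forall>X \<in> P \<union> Q. \<exists>p. normal_form (fst p) \<and> normal_form (snd p) \<and>
    (\<forall>z e. (e(i := z) \<in> X \<longleftrightarrow> fst p (zmul l z) e) \<and> (e(i := z) \<notin> X \<longleftrightarrow> snd p (zmul l z) e))"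
  proof
    fix X assume X: "X \<in> P \<union> Q"
    have "l0 X dvd l" unfolding l_def using X PQ(1,2) by (intro dvd_prodI) auto
    with bspec[OF l0 X] lpos obtain R R' where "normal_form R" "normal_form R'"
      "\<forall>z e. (e(i := z) \<in> X \<longleftrightarrow> R (zmul l z) e) \<and> (e(i := z) \<notin> X \<longleftrightarrow> R' (zmul l z) e)" by blast
    then show "\<exists>p. normal_form (fst p) \<and> normal_form (snd p) \<and>
      (\<forall>z e. (e(i := z) \<in> X \<longleftrightarrow> fst p (zmul l z) e) \<and> (e(i := z) \<notin> X \<longleftrightarrow> snd p (zmul l z) e))"
      by (intro exI[of _ "(R, R')"]) (unfold fst_conv snd_conv, iprover)
  qed
  from bchoice[OF this] obtain p where p: "\<forall>X \<in> P \<union> Q. normal_form (fst (p X)) \<and> normal_form (snd (p X)) \<and>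
    (\<forall>z e. (e(i := z) \<in> X \<longleftrightarrow> fst (p X) (zmul l z) e) \<and> (e(i := z) \<notin> X \<longleftrightarrow> snd (p X) (zmul l z) e))" ..
  define R where "R X = fst (p X)" for X
  define R' where "R' X = snd (p X)" for X
  have RR: "normal_form (R X)" "normal_form (R' X)"
    "e(i := z) \<in> X \<longleftrightarrow> R X (zmul l z) e" "e(i := z) \<notin> X \<longleftrightarrow> R' X (zmul l z) e"
    if "X \<in> P \<union> Q" for X z e
    using bspec[OF p that] unfolding R_def R'_def by blast+
  \<comment> \<open>As in Presburger arithmetic, substituting \<open>w\<close> for
    \<open>l z\<close> costs the congruence \<open>w \<in> cng {0} l\<close>.\<close>
  have "{e. \<exists>z. (\<forall>X \<in> P. e(i := z) \<in> X) \<and> (\<forall>X \<in> Q. e(i := z) \<notin> X)} =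
    {e. \<exists>w. w - 0 \<in> cng {0} l \<and> (\<forall>X \<in> P. R X w e) \<and> (\<forall>X \<in> Q. R' X w e)}"
    using RR(3,4) by (auto simp: cng_def)
  also have "\<dots> \<in> boolgen atoms"
    by (intro normal_form_exists normal_form_conj normal_form_ball normal_form_cng[OF affine_const bot_mem lpos] PQ RR) auto
  finally show "{e. \<exists>z. (\<forall>X \<in> P. e(i := z) \<in> X) \<and> (\<forall>X \<in> Q. e(i := z) \<notin> X)} \<in> boolgen atoms" .
qed

lemma affine_tm_val:
  "is_term (lang (ordered_group_struct :: (_, _, 'a) struct)) t \<Longrightarrow>
    affine (\<lambda>e. tm_val (ordered_group_struct :: (_, _, 'a) struct) e t)"
proof (induction t)
  case (Var i)
  then show ?case by (simp add: affine_var)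
next
  case (Fn f ts)
  then have "length ts = 2" by (simp add: ordered_group_struct_def)
  then obtain s t where "ts = [s, t]" by (auto simp: numeral_2_eq_2 length_Suc_conv)
  then show ?case using Fn by (auto simp: ordered_group_struct_def intro!: affine_add)
qed

theorem sat_boolgen:
  "is_formula (lang (ordered_group_struct :: (_, _, 'a) struct)) \<phi> \<Longrightarrow>
    {e. sat (ordered_group_struct :: (_, _, 'a) struct) e \<phi>} \<in> boolgen atoms"
proof (induction \<phi>)
  case (Eq s t)
  let ?M = "ordered_group_struct :: (_, _, 'a) struct"
  have "{e. tm_val ?M e s - tm_val ?M e t \<in> {0}} \<in> boolgen atoms"
    using Eq by (intro mem_boolgen affine_diff affine_tm_val bot_mem) auto
  then show ?case by simp
next
  case (Rel p ts)
  let ?M = "ordered_group_struct :: (_, _, 'a) struct"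
  have "length ts = 2" using Rel by (simp add: ordered_group_struct_def)
  then obtain s t where ts: "ts = [s, t]" by (auto simp: numeral_2_eq_2 length_Suc_conv)
  have "{e. gt {0} (tm_val ?M e t - tm_val ?M e s)} \<in> boolgen atoms"
    using Rel ts by (intro gt_boolgen affine_diff affine_tm_val bot_mem) auto
  moreover have "sat ?M e (Rel p ts) \<longleftrightarrow> tm_val ?M e s < tm_val ?M e t" for e
    by (auto simp: ts) (auto simp: ordered_group_struct_def)
  ultimately show ?case by (simp add: gt_def)
next
  case (Neg \<phi>)
  then show ?case by (simp add: boolgen_not)
next
  case (Conj \<phi> \<psi>)
  then show ?case by (simp add: boolgen_conj)
next
  case (Ex i \<phi>)
  let ?M = "ordered_group_struct :: (_, _, 'a) struct"
  have "{e. \<exists>z. e(i := z) \<in> {e. sat ?M e \<phi>}} \<in> boolgen atoms"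
    using Ex by (intro atoms_exists) auto
  moreover have "universe ?M = UNIV" by (simp add: ordered_group_struct_def)
  ultimately show ?case by simp
qed

end

section \<open>Local coordinates: additive maps with prescribed signs and congruences\<close>

section \<open>Coordinates modulo a convex subgroup\<close>

definition span_mod :: "'a :: ab_group_add set \<Rightarrow> nat set \<Rightarrow> (nat \<Rightarrow> 'a) \<Rightarrow> 'a set" where
  "span_mod C J b = {x. \<exists>n. x - (\<Sum>j\<in>J. zmul (n j) (b j)) \<in> C}"

definition indep_mod :: "'a :: ab_group_add set \<Rightarrow> nat set \<Rightarrow> (nat \<Rightarrow> 'a) \<Rightarrow> bool" where
  "indep_mod C J b \<longleftrightarrow> (\<forall>n. (\<Sum>j\<in>J. zmul (n j) (b j)) \<in> C \<longrightarrow> (\<forall>j\<in>J. n j = 0))"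

lemma subgrp_sum: "subgrp C \<Longrightarrow> (\<And>j. j \<in> J \<Longrightarrow> f j \<in> C) \<Longrightarrow> sum f J \<in> C"
  by (induction J rule: infinite_finite_induct) (auto simp: subgrp_0 subgrp_add)

lemma subgrp_span_mod:
  assumes "subgrp C" shows "subgrp (span_mod C J b)"
  unfolding subgrp_def[of "span_mod C J b"]
proof (intro conjI ballI)
  show "0 \<in> span_mod C J b"
    unfolding span_mod_def using subgrp_0[OF assms] by (auto intro: exI[of _ "\<lambda>_. 0"])
  fix x y assume "x \<in> span_mod C J b" "y \<in> span_mod C J b"
  then obtain n m where "x - (\<Sum>j\<in>J. zmul (n j) (b j)) \<in> C" "y - (\<Sum>j\<in>J. zmul (m j) (b j)) \<in> C"
    by (auto simp: span_mod_def)
  from subgrp_diff[OF assms this] have "(x - y) - (\<Sum>j\<in>J. zmul (n j - m j) (b j)) \<in> C"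
    by (simp add: zmul.scale_left_diff_distrib sum_subtractf algebra_simps)
  then show "x - y \<in> span_mod C J b" unfolding span_mod_def by (auto intro: exI[of _ "\<lambda>j. n j - m j"])
qed

lemma span_mod_base: "subgrp C \<Longrightarrow> finite J \<Longrightarrow> j \<in> J \<Longrightarrow> b j \<in> span_mod C J b"
proof -
  assume C: "subgrp C" and J: "finite J" "j \<in> J"
  have "(\<Sum>i\<in>J. zmul (if i = j then 1 else 0) (b i)) = (\<Sum>i\<in>J. if i = j then b i else 0)"
    by (intro sum.cong) auto
  also have "\<dots> = b j" using J by simp
  finally show ?thesis using subgrp_0[OF C]
    unfolding span_mod_def by (auto intro!: exI[of _ "\<lambda>i. if i = j then 1 else 0"])
qed

lemma span_mod_C: "x \<in> C \<Longrightarrow> x \<in> span_mod C J b"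
  unfolding span_mod_def by (auto intro!: exI[of _ "\<lambda>_. 0"])

lemma span_mod_trans:
  assumes C: "subgrp C" and b: "\<And>j. j \<in> J \<Longrightarrow> b j \<in> span_mod C J' b'" and x: "x \<in> span_mod C J b"
  shows "x \<in> span_mod C J' b'"
proof -
  note s = subgrp_span_mod[OF C, of J' b']
  obtain n where "x - (\<Sum>j\<in>J. zmul (n j) (b j)) \<in> C" using x by (auto simp: span_mod_def)
  then have "x - (\<Sum>j\<in>J. zmul (n j) (b j)) \<in> span_mod C J' b'" by (rule span_mod_C)
  moreover have "(\<Sum>j\<in>J. zmul (n j) (b j)) \<in> span_mod C J' b'"
    by (intro subgrp_sum[OF s] subgrp_zmul[OF s] b)
  ultimately show ?thesis using subgrp_add[OF s] by fastforce
qed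

text \<open>Euclid's algorithm on the coefficients of a relation.\<close>

lemma relation_drops_generator:
  assumes C: "convex_subgroup C" and J: "finite J"
  shows "(\<Sum>j\<in>J. zmul (n j) (b j)) \<in> C \<Longrightarrow> \<exists>j\<in>J. n j \<noteq> 0 \<Longrightarrow>
    \<exists>i\<in>J. \<exists>b'. \<forall>j\<in>J. b j \<in> span_mod C (J - {i}) b'"
proof (induction "nat (\<Sum>j\<in>J. \<bar>n j\<bar>)" arbitrary: n b rule: less_induct)
  case less
  note sC = convex_subgroup_subgrp[OF C]
  obtain i0 where i0: "i0 \<in> J" "n i0 \<noteq> 0" using less.prems(2) by blast
  show ?case
  proof (cases "\<exists>j\<in>J. j \<noteq> i0 \<and> n j \<noteq> 0")
    case False
    then have "(\<Sum>j\<in>J. zmul (n j) (b j)) = zmul (n i0) (b i0)"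
      using i0(1) J by (subst sum.remove[of _ i0]) (auto intro!: sum.neutral)
    then have "b i0 \<in> C" using less.prems(1) convex_subgroup_pure[OF C _ i0(2)] by simp
    then have "b j \<in> span_mod C (J - {i0}) b" if "j \<in> J" for j
      using that J by (cases "j = i0") (auto intro: span_mod_C span_mod_base[OF sC])
    then show ?thesis using i0(1) by blast
  next
    case True
    then obtain i1 where "i1 \<in> J" "i1 \<noteq> i0" "n i1 \<noteq> 0" by blast
    then obtain i j where ij: "i \<in> J" "j \<in> J" "i \<noteq> j" "n i \<noteq> 0" "n j \<noteq> 0" "\<bar>n j\<bar> \<le> \<bar>n i\<bar>"
      using i0 by (metis linear)
    \<comment> \<open>With this sign \<open>n i - s * n j\<close> is smaller than \<open>n i\<close>
      in absolute value, and adding \<open>s\<close> times \<open>b i\<close> to \<open>b j\<close>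
      preserves the value of the relation.\<close>
    define s where "s = sgn (n i) * sgn (n j)"
    define n' where "n' = n(i := n i - s * n j)"
    define b' where "b' = b(j := b j + zmul s (b i))"
    have "\<bar>n i - s * n j\<bar> < \<bar>n i\<bar>" using ij by (auto simp: s_def sgn_if abs_if split: if_splits)
    then have "\<bar>n' k\<bar> \<le> \<bar>n k\<bar>" "\<bar>n' i\<bar> < \<bar>n i\<bar>" for k by (auto simp: n'_def)
    then have "(\<Sum>j\<in>J. \<bar>n' j\<bar>) < (\<Sum>j\<in>J. \<bar>n j\<bar>)"
      using ij(1) by (intro sum_strict_mono_ex1 J) auto
    moreover have "0 \<le> (\<Sum>j\<in>J. \<bar>n' j\<bar>)" by (intro sum_nonneg) auto
    ultimately have dec: "nat (\<Sum>j\<in>J. \<bar>n' j\<bar>) < nat (\<Sum>j\<in>J. \<bar>n j\<bar>)" by linarith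
    have split: "(\<Sum>k\<in>J. zmul (m k) (c k)) =
        zmul (m i) (c i) + (zmul (m j) (c j) + (\<Sum>k\<in>J - {i} - {j}. zmul (m k) (c k)))" for m and c :: "nat \<Rightarrow> 'a"
      using ij J sum.remove[of J i "\<lambda>k. zmul (m k) (c k)"] sum.remove[of "J - {i}" j "\<lambda>k. zmul (m k) (c k)"] by simp
    have "(\<Sum>k\<in>J - {i} - {j}. zmul (n' k) (b' k)) = (\<Sum>k\<in>J - {i} - {j}. zmul (n k) (b k))"
      by (rule sum.cong) (auto simp: n'_def b'_def)
    then have "(\<Sum>k\<in>J. zmul (n' k) (b' k)) = (\<Sum>k\<in>J. zmul (n k) (b k))"
      unfolding split using ij(3)
      by (simp add: n'_def b'_def zmul.scale_left_diff_distrib zmul.scale_right_distrib mult.commute algebra_simps)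
    moreover have "\<exists>k\<in>J. n' k \<noteq> 0" using ij by (intro bexI[of _ j]) (auto simp: n'_def)
    ultimately obtain k b'' where k: "k \<in> J" "\<forall>l\<in>J. b' l \<in> span_mod C (J - {k}) b''"
      using less.hyps[OF dec] less.prems(1) by metis
    note sp = subgrp_span_mod[OF sC, of "J - {k}" b'']
    have "b l \<in> span_mod C (J - {k}) b''" if "l \<in> J" for l
    proof (cases "l = j")
      case True
      have "b' i \<in> span_mod C (J - {k}) b''" "b' j \<in> span_mod C (J - {k}) b''" using k(2) ij by auto
      from subgrp_diff[OF sp this(2) subgrp_zmul[OF sp this(1), of s]] show ?thesis
        using ij(3) True by (simp add: b'_def)
    next
      case False
      then show ?thesis using k(2) that by (auto simp: b'_def)
    qed
    then show ?thesis using k(1) by blast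
  qed
qed

text \<open>The image of a finitely generated subgroup in the quotient by \<open>C\<close> is
  finitely generated and torsion-free, hence free: a generator is dropped as long as there is a
  relation.\<close>

lemma ex_basis_mod:
  fixes J :: "nat set"
  assumes C: "convex_subgroup C" and "finite J"
  shows "\<exists>J' b'. finite J' \<and> indep_mod C J' b' \<and> (\<forall>j\<in>J. b j \<in> span_mod C J' b')"
  using assms(2)
proof (induction "card J" arbitrary: J b rule: less_induct)
  case less
  note sC = convex_subgroup_subgrp[OF C]
  show ?case
  proof (cases "indep_mod C J b")
    case True
    then show ?thesis using less.prems span_mod_base[OF sC] by blast
  next
    case False
    then obtain n where "(\<Sum>j\<in>J. zmul (n j) (b j)) \<in> C" "\<exists>j\<in>J. n j \<noteq> 0" by (auto simp: indep_mod_def)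
    from relation_drops_generator[OF C less.prems this] obtain i b1 where
      i: "i \<in> J" "\<forall>j\<in>J. b j \<in> span_mod C (J - {i}) b1" by blast
    have "card (J - {i}) < card J" by (rule card_Diff1_less[OF less.prems i(1)])
    from less.hyps[OF this, of b1] obtain J' b' where "finite J'" "indep_mod C J' b'"
      "\<forall>j\<in>J - {i}. b1 j \<in> span_mod C J' b'" using less.prems by auto
    moreover from this(3) i(2) have "\<forall>j\<in>J. b j \<in> span_mod C J' b'"
      using span_mod_trans[OF sC, of "J - {i}" b1 J' b'] by simp
    ultimately show ?thesis by blast
  qed
qed

lemma ex_between_finite:
  assumes "finite L" "finite U" "\<And>l u. l \<in> L \<Longrightarrow> u \<in> U \<Longrightarrow> l < (u :: rat)"
  shows "\<exists>q. (\<forall>l\<in>L. l < q) \<and> (\<forall>u\<in>U. q < u)"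
proof (cases "L = {}"; cases "U = {}")
  assume "L = {}" "U \<noteq> {}"
  then show ?thesis using assms(2) by (intro exI[of _ "Min U - 1"]) (auto intro: less_le_trans[of _ "Min U"])
next
  assume "L \<noteq> {}" "U = {}"
  then show ?thesis using assms(1) by (intro exI[of _ "Max L + 1"]) (auto intro: le_less_trans[of _ "Max L"])
next
  assume ne: "L \<noteq> {}" "U \<noteq> {}"
  then have "Max L < Min U" using assms by simp
  then obtain q where "Max L < q" "q < Min U" using dense by blast
  then show ?thesis using assms(1,2) ne by (intro exI[of _ q]) auto
qed auto

text \<open>By Fourier-Motzkin elimination.\<close>

lemma ex_rational_solution:
  assumes C: "convex_subgroup C" and "finite J" "finite V"
    and "\<And>v. v \<in> V \<Longrightarrow> gt C (\<Sum>j\<in>J. zmul (v j) (b j))"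
  shows "\<exists>X :: nat \<Rightarrow> rat. \<forall>v\<in>V. 0 < (\<Sum>j\<in>J. of_int (v j) * X j)"
  using assms(2-)
proof (induction J arbitrary: V rule: finite_induct)
  case empty
  then have "V = {}" using gt_pos[OF C, of 0] by fastforce
  then show ?case by simp
next
  case (insert i J)
  \<comment> \<open>For \<open>v i > 0 > w i\<close> this is a positive combination of
    \<open>v\<close> and \<open>w\<close> in which coordinate \<open>i\<close> cancels.\<close>
  define comb where "comb = (\<lambda>(v :: nat \<Rightarrow> int, w) j. - w i * v j + v i * w j)"
  define V' where "V' = {v\<in>V. v i = 0} \<union> comb ` ({v\<in>V. 0 < v i} \<times> {v\<in>V. v i < 0})"
  have sums: "(\<Sum>j\<in>insert i J. zmul (v j) (b j)) = zmul (v i) (b i) + (\<Sum>j\<in>J. zmul (v j) (b j))" for v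
    using insert.hyps by simp
  have "\<exists>X :: nat \<Rightarrow> rat. \<forall>v\<in>V'. 0 < (\<Sum>j\<in>J. of_int (v j) * X j)"
  proof (rule insert.IH)
    show "finite V'" using insert.prems(1) by (simp add: V'_def)
    fix u assume "u \<in> V'"
    then consider (z) "u \<in> V" "u i = 0"
      | (c) v w where "v \<in> V" "w \<in> V" "0 < v i" "w i < 0" "u = comb (v, w)" by (auto simp: V'_def)
    then show "gt C (\<Sum>j\<in>J. zmul (u j) (b j))"
    proof cases
      case z
      then show ?thesis using insert.prems(2)[OF z(1)] by (simp add: sums)
    next
      case c
      let ?v = "\<Sum>j\<in>insert i J. zmul (v j) (b j)" and ?w = "\<Sum>j\<in>insert i J. zmul (w j) (b j)"
      have "gt C (zmul (- w i) ?v + zmul (v i) ?w)"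
        using insert.prems(2) c by (intro gt_add[OF C]) (simp_all add: gt_zmul[OF C] del: zmul.scale_minus_left)
      also have "zmul (- w i) ?v + zmul (v i) ?w = (\<Sum>j\<in>J. zmul (u j) (b j))"
        unfolding sums c(5) comb_def
        by (simp add: zmul.scale_left_distrib zmul.scale_right_distrib zmul.scale_left_diff_distrib
            sum.distrib sum_subtractf sum_negf zmul.scale_sum_right mult.commute)
      finally show ?thesis .
    qed
  qed
  then obtain X :: "nat \<Rightarrow> rat" where X: "\<And>v. v \<in> V' \<Longrightarrow> 0 < (\<Sum>j\<in>J. of_int (v j) * X j)" by blast
  define A where "A v = (\<Sum>j\<in>J. of_int (v j) * X j)" for v :: "nat \<Rightarrow> int"
  \<comment> \<open>Each inequality with \<open>v i \<noteq> 0\<close> bounds the value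
    \<open>q\<close> of coordinate \<open>i\<close>; the combined inequalities say that every lower
    bound is below every upper bound.\<close>
  let ?L = "(\<lambda>v. - A v / of_int (v i)) ` {v\<in>V. 0 < v i}"
  let ?U = "(\<lambda>v. A v / - of_int (v i)) ` {v\<in>V. v i < 0}"
  have "\<exists>q. (\<forall>l\<in>?L. l < q) \<and> (\<forall>u\<in>?U. q < u)"
  proof (rule ex_between_finite)
    show "finite ?L" "finite ?U" using insert.prems(1) by auto
    fix l u assume "l \<in> ?L" "u \<in> ?U"
    then obtain v w where vw: "v \<in> V" "0 < v i" "l = - A v / of_int (v i)"
      "w \<in> V" "w i < 0" "u = A w / - of_int (w i)" by auto
    have "0 < (\<Sum>j\<in>J. of_int (comb (v, w) j) * X j)" by (rule X) (use vw in \<open>auto simp: V'_def\<close>)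
    also have "\<dots> = - of_int (w i) * A v + of_int (v i) * A w"
      by (simp add: comb_def A_def sum_distrib_left sum.distrib sum_subtractf sum_negf algebra_simps)
    finally have "0 < - of_int (w i) * A v + of_int (v i) * A w" .
    moreover have "(0::rat) < of_int (v i)" "of_int (w i) < (0::rat)" using vw by simp_all
    ultimately show "l < u" unfolding vw by (simp add: field_simps)
  qed
  then obtain q where q0: "\<forall>l\<in>?L. l < q" "\<forall>u\<in>?U. q < u" by (elim exE conjE)
  have q: "v \<in> V \<Longrightarrow> 0 < v i \<Longrightarrow> - A v / of_int (v i) < q"
    "v \<in> V \<Longrightarrow> v i < 0 \<Longrightarrow> q < A v / - of_int (v i)" for v
    using q0 by auto
  have "0 < (\<Sum>j\<in>insert i J. of_int (v j) * (X(i := q)) j)" if v: "v \<in> V" for v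
  proof -
    have "(\<Sum>j\<in>J. of_int (v j) * (X(i := q)) j) = A v"
      unfolding A_def using insert.hyps(2) by (intro sum.cong) auto
    then have *: "(\<Sum>j\<in>insert i J. of_int (v j) * (X(i := q)) j) = of_int (v i) * q + A v"
      using insert.hyps by simp
    consider "v i = 0" | "0 < v i" | "v i < 0" by linarith
    then show ?thesis
    proof cases
      case 1
      then have "v \<in> V'" using v by (simp add: V'_def)
      then show ?thesis unfolding * using X[of v] 1 by (simp add: A_def)
    next
      case 2
      then have "(0::rat) < of_int (v i)" by simp
      then show ?thesis unfolding * using q(1)[OF v 2] by (simp add: field_simps)
    next
      case 3
      then have "of_int (v i) < (0::rat)" by simp
      then show ?thesis unfolding * using q(2)[OF v 3] by (simp add: field_simps)
    qed
  qed
  then show ?case by blast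
qed

text \<open>Denominators are cleared because the target is an arbitrary ordered group, in which only
  the integer multiples of one positive element are available.\<close>

lemma ex_integral_solution:
  assumes "convex_subgroup C" "finite J" "finite V"
    and "\<And>v. v \<in> V \<Longrightarrow> gt C (\<Sum>j\<in>J. zmul (v j) (b j))"
  shows "\<exists>X :: nat \<Rightarrow> int. \<forall>v\<in>V. 0 < (\<Sum>j\<in>J. v j * X j)"
proof -
  obtain X :: "nat \<Rightarrow> rat" where X: "\<And>v. v \<in> V \<Longrightarrow> 0 < (\<Sum>j\<in>J. of_int (v j) * X j)"
    using ex_rational_solution[OF assms] by blast
  define d where "d = (\<Prod>j\<in>J. snd (quotient_of (X j)))"
  have d: "0 < d" unfolding d_def by (rule prod_pos) (simp add: quotient_of_denom_pos')
  have "\<exists>z :: int. of_int d * X j = of_int z" if "j \<in> J" for j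
  proof -
    obtain p q where pq: "quotient_of (X j) = (p, q)" by (cases "quotient_of (X j)")
    then have "X j = of_int p / of_int q" "0 < q"
      using quotient_of_div quotient_of_denom_pos by auto
    moreover have "q dvd d" unfolding d_def using that assms(2) pq dvd_prodI[of J j "\<lambda>j. snd (quotient_of (X j))"] by simp
    then obtain m where "d = q * m" by auto
    ultimately have "of_int d * X j = of_int (m * p)" by simp
    then show ?thesis by blast
  qed
  then obtain Z :: "nat \<Rightarrow> int" where Z: "\<And>j. j \<in> J \<Longrightarrow> of_int d * X j = of_int (Z j)" by metis
  have "0 < (\<Sum>j\<in>J. v j * Z j)" if "v \<in> V" for v
  proof -
    have "of_int (\<Sum>j\<in>J. v j * Z j) = (\<Sum>j\<in>J. of_int (v j) * (of_int d * X j))"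
      using Z by (auto intro!: sum.cong)
    also have "\<dots> = of_int d * (\<Sum>j\<in>J. of_int (v j) * X j)"
      by (simp add: sum_distrib_left mult.left_commute)
    also have "\<dots> > 0" using X[OF that] d by simp
    finally show ?thesis unfolding of_int_0_less_iff .
  qed
  then show ?thesis by blast
qed

definition additive_on :: "'a :: ab_group_add set \<Rightarrow> ('a \<Rightarrow> 'b :: ab_group_add) \<Rightarrow> bool" where
  "additive_on F h \<longleftrightarrow> (\<forall>x\<in>F. \<forall>y\<in>F. h (x + y) = h x + h y)"

lemma additive_on_0: "additive_on F h \<Longrightarrow> subgrp F \<Longrightarrow> h 0 = 0"
  using subgrp_0[of F] unfolding additive_on_def by (metis add_cancel_right_right)

lemma additive_on_minus: "additive_on F h \<Longrightarrow> subgrp F \<Longrightarrow> x \<in> F \<Longrightarrow> h (- x) = - h x"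
  using subgrp_minus[of F x] additive_on_0[of F h] unfolding additive_on_def
  by (metis add.right_inverse add_eq_0_iff)

lemma additive_on_zmul: "additive_on F h \<Longrightarrow> subgrp F \<Longrightarrow> x \<in> F \<Longrightarrow> h (zmul k x) = zmul k (h x)"
proof (induction k rule: int_induct[where k = 0])
  case base
  then show ?case by (simp add: additive_on_0)
next
  case (step1 i)
  then show ?case using subgrp_zmul[of F x i] by (simp add: zmul_succ additive_on_def)
next
  case (step2 i)
  have "h (zmul i x + (- x)) = h (zmul i x) + h (- x)"
    using step2.prems subgrp_zmul[of F x i] subgrp_minus[of F x] unfolding additive_on_def by blast
  then show ?case using step2 by (simp add: zmul_pred additive_on_minus)
qed

lemma additive_on_sum:
  assumes "additive_on F h" "subgrp F"
  shows "finite I \<Longrightarrow> (\<And>i. i \<in> I \<Longrightarrow> f i \<in> F) \<Longrightarrow> h (sum f I) = (\<Sum>i\<in>I. h (f i))"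
proof (induction I rule: finite_induct)
  case empty
  then show ?case using additive_on_0[OF assms] by simp
next
  case (insert i I)
  then have "h (f i + sum f I) = h (f i) + h (sum f I)"
    using subgrp_sum[OF assms(2), of I f] assms(1) unfolding additive_on_def by blast
  then show ?case using insert by simp
qed

text \<open>
  The maps \<open>\<sigma>\<close> and \<open>\<rho>\<close> trace congruences modulo \<open>C\<close> in the pure group and the order modulo
  \<open>C\<close> in another ordered group.
\<close>

theorem ex_local_coordinates:
  fixes C :: "'a :: linordered_ab_group_add set" and h0 :: "'b :: linordered_ab_group_add"
  assumes C: "convex_subgroup C" and T: "finite T" and K: "finite K" and h0: "0 < h0"
  shows "\<exists>F (\<sigma> :: 'a \<Rightarrow> 'a) (\<rho> :: 'a \<Rightarrow> 'b). subgrp F \<and> T \<subseteq> F \<and> additive_on F \<sigma> \<and> additive_on F \<rho> \<and>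
    (\<forall>t\<in>T. gt C t \<longleftrightarrow> 0 < \<rho> t) \<and> (\<forall>t\<in>T. \<forall>k\<in>K. t \<in> cng C k \<longleftrightarrow> \<sigma> t \<in> cng {0} k)"
proof -
  note sC = convex_subgroup_subgrp[OF C]
  define G where "G t k = (SOME g. t - zmul k g \<in> C)" for t k
  have G: "t - zmul k (G t k) \<in> C" if "t \<in> cng C k" for t k
    unfolding G_def by (rule someI_ex) (use that in \<open>simp add: cng_def\<close>)
  \<comment> \<open>The witnesses \<open>G t k\<close> of the valid congruences are included, so
    that they lie in \<open>F\<close>, where \<sigma> is additive.\<close>
  define T' where "T' = T \<union> (\<lambda>(t, k). G t k) ` (T \<times> K)"
  have "finite T'" using T K by (simp add: T'_def)
  then obtain b0 n0 where b0: "T' = b0 ` {i. i < (n0 :: nat)}" using finite_conv_nat_seg_image[of T'] by blast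
  obtain J b where J: "finite J" "indep_mod C J b" "\<forall>j\<in>{i. i < n0}. b0 j \<in> span_mod C J b"
    using ex_basis_mod[OF C, of "{i. i < n0}" b0] by auto
  define F where "F = span_mod C J b"
  have sF: "subgrp F" unfolding F_def by (rule subgrp_span_mod[OF sC])
  have T'F: "T' \<subseteq> F" using b0 J(3) by (auto simp: F_def)
  define coord where "coord x = (SOME n. x - (\<Sum>j\<in>J. zmul (n j) (b j)) \<in> C)" for x
  have coord: "x - (\<Sum>j\<in>J. zmul (coord x j) (b j)) \<in> C" if "x \<in> F" for x
  proof -
    have "\<exists>n. x - (\<Sum>j\<in>J. zmul (n j) (b j)) \<in> C" using that by (simp add: F_def span_mod_def)
    from someI_ex[OF this] show ?thesis unfolding coord_def .
  qed
  have unique: "n j = coord x j" if "x \<in> F" "x - (\<Sum>j\<in>J. zmul (n j) (b j)) \<in> C" "j \<in> J" for x n j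
  proof -
    have "(\<Sum>j\<in>J. zmul (n j - coord x j) (b j)) =
        (x - (\<Sum>j\<in>J. zmul (coord x j) (b j))) - (x - (\<Sum>j\<in>J. zmul (n j) (b j)))"
      by (simp add: zmul.scale_left_diff_distrib sum_subtractf)
    also have "\<dots> \<in> C" by (rule subgrp_diff[OF sC coord[OF that(1)] that(2)])
    finally have "\<forall>j\<in>J. n j - coord x j = 0"
      by (rule J(2)[unfolded indep_mod_def, THEN spec, THEN mp])
    then show ?thesis using that(3) by simp
  qed
  have coord_add: "coord (x + y) j = coord x j + coord y j" if "x \<in> F" "y \<in> F" "j \<in> J" for x y j
  proof (rule unique[symmetric, OF _ _ that(3)])
    show "x + y \<in> F" using sF that by (simp add: subgrp_add)
    have "x + y - (\<Sum>j\<in>J. zmul (coord x j + coord y j) (b j)) =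
        (x - (\<Sum>j\<in>J. zmul (coord x j) (b j))) + (y - (\<Sum>j\<in>J. zmul (coord y j) (b j)))"
      by (simp add: zmul.scale_left_distrib sum.distrib)
    also have "\<dots> \<in> C" by (rule subgrp_add[OF sC coord[OF that(1)] coord[OF that(2)]])
    finally show "x + y - (\<Sum>j\<in>J. zmul (coord x j + coord y j) (b j)) \<in> C" .
  qed
  have coord_C: "coord c j = 0" if "c \<in> C" "j \<in> J" for c j
    using unique[of c "\<lambda>_. 0" j] that by (simp add: F_def span_mod_C)
  \<comment> \<open>The splitting: \<sigma> projects \<open>F\<close> onto the span of the basis and
    kills \<open>C\<close>, so \<open>x - \<sigma> x\<close> lies in \<open>C\<close>.\<close>
  define \<sigma> where "\<sigma> x = (\<Sum>j\<in>J. zmul (coord x j) (b j))" for x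
  have \<sigma>: "additive_on F \<sigma>"
    unfolding additive_on_def \<sigma>_def
    by (auto simp: coord_add zmul.scale_left_distrib sum.distrib intro!: sum.cong)
  \<comment> \<open>Elements of \<open>T\<close> inside \<open>C\<close> contribute no inequality,
    since their coordinates vanish.\<close>
  define V where "V = {coord t | t. t \<in> T \<and> gt C t} \<union> {\<lambda>j. - coord t j | t. t \<in> T \<and> gt C (- t)}"
  have TF: "T \<subseteq> F" using T'F by (auto simp: T'_def)
  have "\<exists>X :: nat \<Rightarrow> int. \<forall>v\<in>V. 0 < (\<Sum>j\<in>J. v j * X j)"
  proof (rule ex_integral_solution[OF C J(1)])
    have "V \<subseteq> coord ` T \<union> (\<lambda>t j. - coord t j) ` T" by (auto simp: V_def)
    then show "finite V" using T finite_subset by blast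
    fix v assume "v \<in> V"
    then obtain t where "t \<in> T" "gt C t \<and> v = coord t \<or> gt C (- t) \<and> v = (\<lambda>j. - coord t j)" by (auto simp: V_def)
    moreover then have c: "t - (\<Sum>j\<in>J. zmul (coord t j) (b j)) \<in> C" using coord TF by blast
    moreover have "gt C (t + (- (t - (\<Sum>j\<in>J. zmul (coord t j) (b j)))))" if "gt C t"
      by (rule gt_add_mem[OF C that subgrp_minus[OF sC c]])
    moreover have "gt C (- t + (t - (\<Sum>j\<in>J. zmul (coord t j) (b j))))" if "gt C (- t)"
      by (rule gt_add_mem[OF C that c])
    ultimately show "gt C (\<Sum>j\<in>J. zmul (v j) (b j))" by (auto simp: sum_negf)
  qed
  then obtain X :: "nat \<Rightarrow> int" where X: "\<And>v. v \<in> V \<Longrightarrow> 0 < (\<Sum>j\<in>J. v j * X j)" by blast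
  define \<rho> where "\<rho> x = zmul (\<Sum>j\<in>J. coord x j * X j) h0" for x
  have \<rho>: "additive_on F \<rho>"
    unfolding additive_on_def \<rho>_def
    by (auto simp: coord_add distrib_right sum.distrib simp flip: zmul.scale_left_distrib intro!: arg_cong[of _ _ "\<lambda>k. zmul k h0"])
  have "gt C t \<longleftrightarrow> 0 < \<rho> t" if t: "t \<in> T" for t
  proof -
    consider (pos) "gt C t" | (mem) "t \<in> C" | (neg) "gt C (- t)" using gt_trichotomy[OF C] by blast
    then show ?thesis
    proof cases
      case pos
      then have "coord t \<in> V" using t by (auto simp: V_def)
      then show ?thesis using X[of "coord t"] pos h0 by (simp add: \<rho>_def zmul_pos)
    next
      case mem
      then show ?thesis using gt_notin[of C t] coord_C by (auto simp: \<rho>_def)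
    next
      case neg
      then have "(\<lambda>j. - coord t j) \<in> V" using t by (auto simp: V_def)
      from X[OF this] have "0 < zmul (- (\<Sum>j\<in>J. coord t j * X j)) h0" using h0 by (intro zmul_pos) (auto simp: sum_negf)
      then show ?thesis using gt_asym[OF C, of "- t"] neg by (auto simp: \<rho>_def)
    qed
  qed
  moreover have "t \<in> cng C k \<longleftrightarrow> \<sigma> t \<in> cng {0} k" if t: "t \<in> T" "k \<in> K" for t k
  proof
    assume tk: "t \<in> cng C k"
    have g: "G t k \<in> F" using t T'F by (auto simp: T'_def)
    have c: "t - zmul k (G t k) \<in> C" by (rule G[OF tk])
    then have "t - zmul k (G t k) \<in> F" by (simp add: F_def span_mod_C)
    then have "\<sigma> ((t - zmul k (G t k)) + zmul k (G t k)) = \<sigma> (t - zmul k (G t k)) + zmul k (\<sigma> (G t k))"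
      using \<sigma> subgrp_zmul[OF sF g] additive_on_zmul[OF \<sigma> sF g] unfolding additive_on_def by metis
    moreover have "\<sigma> (t - zmul k (G t k)) = 0" using coord_C[OF c] by (simp add: \<sigma>_def)
    ultimately show "\<sigma> t \<in> cng {0} k" by (intro cngI[of _ _ "\<sigma> (G t k)"]) simp
  next
    assume "\<sigma> t \<in> cng {0} k"
    then obtain g where "\<sigma> t = zmul k g" by (auto simp: cng_def)
    moreover have "t - \<sigma> t \<in> C" using coord t TF by (auto simp: \<sigma>_def)
    ultimately show "t \<in> cng C k" by (intro cngI[of _ _ g]) simp
  qed
  ultimately show ?thesis using sF TF \<sigma> \<rho> by blast
qed

section \<open>The two translations\<close>

section \<open>Formulas for linear conditions\<close>

definition disjs :: "('f, 'p) fm list \<Rightarrow> ('f, 'p) fm" where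
  "disjs \<phi>s = Neg (conjs (map Neg \<phi>s))"

lemma sat_disjs: "sat M e (disjs \<phi>s) \<longleftrightarrow> (\<exists>\<phi>\<in>set \<phi>s. sat M e \<phi>)"
  by (auto simp: disjs_def sat_conjs)

lemma is_formula_disjs: "is_formula L (disjs \<phi>s) \<longleftrightarrow> (\<forall>\<phi>\<in>set \<phi>s. is_formula L \<phi>)"
  by (auto simp: disjs_def is_formula_conjs)

text \<open>\<open>S0\<close> is exposed before the formulas \<open>lf\<close>, because these
  involve constants that can be chosen only when all generators concerned are known.\<close>

lemma boolgen_formula:
  assumes E: "E \<in> boolgen S" 
  shows "\<exists>S0. finite S0 \<and> S0 \<subseteq> S \<and>
    (\<forall>lf. (\<forall>X\<in>S0. is_formula L (lf X)) \<longrightarrow> (\<exists>\<psi>. is_formula L \<psi> \<and>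
      (\<forall>e M v. (\<forall>X\<in>S0. e \<in> X \<longleftrightarrow> sat M v (lf X)) \<longrightarrow> (e \<in> E \<longleftrightarrow> sat M v \<psi>))))"
proof -
  obtain S0 where S0: "S0 \<subseteq> S" "finite S0"
    and det: "\<forall>x y. (\<forall>X\<in>S0. x \<in> X \<longleftrightarrow> y \<in> X) \<longrightarrow> (x \<in> E \<longleftrightarrow> y \<in> E)"
    using E unfolding boolgen_def by (elim CollectE exE conjE)
  show ?thesis
  proof (intro exI[of _ S0] conjI S0 allI impI)
    fix lf assume lf: "\<forall>X\<in>S0. is_formula L (lf X)"
    define \<A> where "\<A> = (\<lambda>x. {X\<in>S0. x \<in> X}) ` E"
    have "finite \<A>" by (rule finite_subset[of _ "Pow S0"]) (use S0(2) in \<open>auto simp: \<A>_def\<close>)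
    then obtain As where As: "set As = \<A>" using finite_list by blast
    obtain Xs where Xs: "set Xs = S0" using finite_list[OF S0(2)] by blast
    define \<psi> where "\<psi> = disjs (map (\<lambda>A. conjs (map (\<lambda>X. if X \<in> A then lf X else Neg (lf X)) Xs)) As)"
    have "is_formula L \<psi>" using lf by (auto simp: \<psi>_def is_formula_disjs is_formula_conjs Xs)
    moreover have "e \<in> E \<longleftrightarrow> sat M v \<psi>" if lits: "\<forall>X\<in>S0. e \<in> X \<longleftrightarrow> sat M v (lf X)" for e M v
    proof -
      have pat: "(\<forall>X\<in>S0. sat M v (if X \<in> A then lf X else Neg (lf X))) \<longleftrightarrow> (\<forall>X\<in>S0. e \<in> X \<longleftrightarrow> X \<in> A)" for A
        using lits by auto
      have "sat M v \<psi> \<longleftrightarrow> (\<exists>A\<in>\<A>. \<forall>X\<in>S0. e \<in> X \<longleftrightarrow> X \<in> A)"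
        by (simp only: \<psi>_def sat_disjs sat_conjs set_map As Xs ball_simps bex_simps pat)
      also have "\<dots> \<longleftrightarrow> (\<exists>x\<in>E. \<forall>X\<in>S0. e \<in> X \<longleftrightarrow> x \<in> X)" by (auto simp: \<A>_def)
      also have "\<dots> \<longleftrightarrow> e \<in> E"
      proof
        assume "\<exists>x\<in>E. \<forall>X\<in>S0. e \<in> X \<longleftrightarrow> x \<in> X"
        then obtain x where x: "x \<in> E" "\<forall>X\<in>S0. e \<in> X \<longleftrightarrow> x \<in> X" by (rule bexE)
        have "e \<in> E \<longleftrightarrow> x \<in> E" by (rule det[THEN spec, THEN spec, THEN mp, OF x(2)])
        with x(1) show "e \<in> E" by (rule iffD2[rotated])
      next
        assume "e \<in> E"
        then show "\<exists>x\<in>E. \<forall>X\<in>S0. e \<in> X \<longleftrightarrow> x \<in> X" by (rule bexI[rotated]) (rule ballI, rule refl)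
      qed
      finally show ?thesis by (rule sym)
    qed
    ultimately show "\<exists>\<psi>. is_formula L \<psi> \<and>
        (\<forall>e M v. (\<forall>X\<in>S0. e \<in> X \<longleftrightarrow> sat M v (lf X)) \<longrightarrow> (e \<in> E \<longleftrightarrow> sat M v \<psi>))"
      by (intro exI[of _ \<psi>] conjI allI impI)
  qed
qed

text \<open>Each \<open>f\<close> gets a variable of its own beyond \<open>V\<close>, which holds
  its constant term and whose coefficient is raised by \<open>1\<close>. The result is a pure
  integer combination, with which additive maps commute.\<close>

lemma constants_as_variables:
  fixes \<F> :: "((nat \<Rightarrow> 'a :: ab_group_add) \<Rightarrow> 'a) set"
  assumes "finite \<F>" "finite V" "\<And>f. f \<in> \<F> \<Longrightarrow> affine f"
  shows "\<exists>cst. \<forall>f\<in>\<F>. \<exists>n N. \<forall>e. f (\<lambda>i. if i \<in> V then e i else cst i) =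
    (\<Sum>i<N. zmul (n i) (if i \<in> V then e i else cst i))"
proof -
  obtain M where M: "\<And>v. v \<in> V \<Longrightarrow> v < (M :: nat)" using assms(2) by (meson finite_nat_set_iff_bounded)
  obtain g :: "((nat \<Rightarrow> 'a) \<Rightarrow> 'a) \<Rightarrow> nat" where g: "inj_on g \<F>"
    using finite_imp_inj_to_nat_seg[OF assms(1)] by blast
  define ix where "ix f = g f + M" for f
  have ix: "inj_on ix \<F>" using g by (auto simp: ix_def inj_on_def)
  have "\<forall>f\<in>\<F>. \<exists>c. \<exists>n N. \<forall>e. f e = (\<Sum>i<N. zmul (n i) (e i)) + c" using assms(3) unfolding affine_def by blast
  from bchoice[OF this] obtain c where c: "\<forall>f\<in>\<F>. \<exists>n N. \<forall>e. f e = (\<Sum>i<N. zmul (n i) (e i)) + c f" ..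
  define cst where "cst i = c (inv_into \<F> ix i)" for i
  have "\<exists>n N. \<forall>e. f (\<lambda>i. if i \<in> V then e i else cst i) = (\<Sum>i<N. zmul (n i) (if i \<in> V then e i else cst i))"
    if f: "f \<in> \<F>" for f
  proof -
    obtain n N where nN: "\<And>e. f e = (\<Sum>i<N. zmul (n i) (e i)) + c f" using c f by blast
    have cf: "cst (ix f) = c f" by (simp add: cst_def inv_into_f_f[OF ix f])
    have cV: "ix f \<notin> V" using M[of "ix f"] by (auto simp: ix_def)
    define N' where "N' = max N (Suc (ix f))"
    define n' where "n' i = (if i < N then n i else 0) + (if i = ix f then 1 else 0)" for i
    have "(\<Sum>i<N'. zmul (n' i) (d i)) = (\<Sum>i<N. zmul (n i) (d i)) + d (ix f)" for d
    proof -
      have "(\<Sum>i<N'. zmul (n' i) (d i)) = (\<Sum>i<N'. zmul (if i < N then n i else 0) (d i)) +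
          (\<Sum>i<N'. zmul (if i = ix f then 1 else 0) (d i))"
        by (simp add: n'_def zmul.scale_left_distrib sum.distrib)
      also have "(\<Sum>i<N'. zmul (if i < N then n i else 0) (d i)) = (\<Sum>i<N. zmul (n i) (d i))"
        by (rule sum.mono_neutral_cong_right) (auto simp: N'_def)
      also have "(\<Sum>i<N'. zmul (if i = ix f then 1 else 0) (d i)) = (\<Sum>i<N'. if i = ix f then d i else 0)"
        by (rule sum.cong) auto
      also have "\<dots> = d (ix f)" by (simp add: N'_def less_max_iff_disj)
      finally show ?thesis .
    qed
    from this[of "\<lambda>i. if i \<in> V then _ i else cst i"] show ?thesis
      using cf cV by (intro exI[of _ n'] exI[of _ N'] allI) (simp add: nN)
  qed
  then show ?thesis by blast
qed

definition plus_struct :: "(group_fun, 'p, 'a :: ab_group_add) struct \<Rightarrow> bool" where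
  "plus_struct M \<longleftrightarrow> Funs (lang M) = {(Plus, 2)} \<and> universe M = UNIV \<and> (\<forall>f xs. fun_int M f xs = xs ! 0 + xs ! 1)"

lemma plus_struct_group: "plus_struct group_struct" "plus_struct ordered_group_struct"
  by (simp_all add: plus_struct_def group_struct_def ordered_group_struct_def)

definition sum_tm :: "nat \<Rightarrow> nat list \<Rightarrow> group_fun tm" where
  "sum_tm w is = foldr (\<lambda>i t. Fn Plus [Var i, t]) is (Var w)"

lemma is_term_sum_tm: "Funs L = {(Plus, 2)} \<Longrightarrow> is_term L (sum_tm w is)"
  by (induction "is") (auto simp: sum_tm_def)

lemma fv_sum_tm: "fv_tm (sum_tm w is) = insert w (set is)"
  by (induction "is") (auto simp: sum_tm_def)

lemma tm_val_sum_tm: "plus_struct M \<Longrightarrow> tm_val M e (sum_tm w is) = sum_list (map e is) + e w"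
  by (induction "is") (auto simp: sum_tm_def plus_struct_def add.assoc)

definition copies :: "(nat \<Rightarrow> nat) \<Rightarrow> nat \<Rightarrow> nat list" where
  "copies a N = concat (map (\<lambda>i. replicate (a i) i) [0..<N])"

lemma set_copies: "set (copies a N) \<subseteq> {..<N}"
  by (auto simp: copies_def)

lemma sum_list_copies:
  fixes e :: "nat \<Rightarrow> 'a :: ab_group_add"
  shows "sum_list (map e (copies a N)) = (\<Sum>i<N. zmul (int (a i)) (e i))"
proof (induction N)
  case (Suc N)
  have "sum_list (map e (replicate k i)) = zmul (int k) (e i)" for k i
  proof (induction k)
    case (Suc k)
    have "zmul (int (Suc k)) (e i) = zmul (int k) (e i) + e i" using zmul_succ by (metis of_nat_Suc add.commute)
    then show ?case using Suc by (simp add: add.commute)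
  qed simp
  then show ?case using Suc by (simp add: copies_def)
qed (simp add: copies_def)

text \<open>
  The language has neither zero nor minus: \<open>\<Sum> n\<^sub>i x\<^sub>i > 0\<close> is written with the negative
  summands on the other side and an auxiliary summand \<open>x\<^sub>N\<close>, so that no sum is empty.
\<close>

definition lin_gt :: "(nat \<Rightarrow> int) \<Rightarrow> nat \<Rightarrow> (group_fun, order_rel) fm" where
  "lin_gt n N = Ex N (Rel Less [sum_tm N (copies (\<lambda>i. nat (- n i)) N), sum_tm N (copies (\<lambda>i. nat (n i)) N)])"

definition lin_eq :: "(nat \<Rightarrow> int) \<Rightarrow> nat \<Rightarrow> (group_fun, 'p) fm" where
  "lin_eq n N = Ex N (Eq (sum_tm N (copies (\<lambda>i. nat (- n i)) N)) (sum_tm N (copies (\<lambda>i. nat (n i)) N)))"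

text \<open>Variable \<open>N\<close> holds the quotient, with coefficient \<open>- k\<close>; the
  auxiliary summand of \<open>lin_eq\<close> moves to \<open>Suc N\<close>.\<close>

definition lin_cng :: "int \<Rightarrow> (nat \<Rightarrow> int) \<Rightarrow> nat \<Rightarrow> (group_fun, 'p) fm" where
  "lin_cng k n N = Ex N (lin_eq (n(N := - k)) (Suc N))"

lemma lin_split:
  fixes e :: "nat \<Rightarrow> 'a :: ab_group_add"
  shows "(\<Sum>i<N. zmul (n i) (e i)) = (\<Sum>i<N. zmul (int (nat (n i))) (e i)) - (\<Sum>i<N. zmul (int (nat (- n i))) (e i))"
proof -
  have "zmul (n i) x = zmul (int (nat (n i))) x - zmul (int (nat (- n i))) x" for i and x :: 'a
  proof -
    have "n i = int (nat (n i)) - int (nat (- n i))" by simp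
    then show ?thesis using zmul.scale_left_diff_distrib by metis
  qed
  then show ?thesis by (simp add: sum_subtractf)
qed

lemma sat_lin_gt:
  fixes e :: "nat \<Rightarrow> 'a :: linordered_ab_group_add"
  shows "sat ordered_group_struct e (lin_gt n N) \<longleftrightarrow> 0 < (\<Sum>i<N. zmul (n i) (e i))"
proof -
  let ?M = "ordered_group_struct :: (_, _, 'a) struct"
  have *: "(\<Sum>i<N. zmul (a i) ((e(N := w)) i)) = (\<Sum>i<N. zmul (a i) (e i))" for a w
    by (rule sum.cong) auto
  have "sat ?M (e(N := w)) (Rel Less [s, t]) \<longleftrightarrow> tm_val ?M (e(N := w)) s < tm_val ?M (e(N := w)) t" for w s t
    by simp (simp add: ordered_group_struct_def)
  then show ?thesis
    unfolding lin_gt_def lin_split[of n e N]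
    by (simp del: sat.simps(2) fun_upd_apply add: tm_val_sum_tm[OF plus_struct_group(2)] sum_list_copies *)
      (simp add: ordered_group_struct_def)
qed

lemma sat_lin_eq:
  assumes "plus_struct M"
  shows "sat M e (lin_eq n N) \<longleftrightarrow> (\<Sum>i<N. zmul (n i) (e i)) = 0"
proof -
  have *: "(\<Sum>i<N. zmul (a i) ((e(N := w)) i)) = (\<Sum>i<N. zmul (a i) (e i))" for a w
    by (rule sum.cong) auto
  show ?thesis
    unfolding lin_eq_def lin_split[of n e N]
    using assms by (auto simp del: fun_upd_apply simp: tm_val_sum_tm[OF assms] sum_list_copies * plus_struct_def)
qed

lemma sat_lin_cng:
  assumes M: "plus_struct M"
  shows "sat M e (lin_cng k n N) \<longleftrightarrow> (\<Sum>i<N. zmul (n i) (e i)) \<in> cng {0} k"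
proof -
  have "(\<Sum>i<Suc N. zmul ((n(N := - k)) i) ((e(N := g)) i)) = (\<Sum>i<N. zmul (n i) (e i)) - zmul k g" for g
  proof -
    have "(\<Sum>i<N. zmul ((n(N := - k)) i) ((e(N := g)) i)) = (\<Sum>i<N. zmul (n i) (e i))" by (rule sum.cong) auto
    then show ?thesis by simp
  qed
  moreover have "universe M = UNIV" using M by (simp add: plus_struct_def)
  ultimately show ?thesis
    unfolding lin_cng_def sat.simps sat_lin_eq[OF M] by (simp add: cng_def)
qed

lemma is_formula_lin: "Funs L = {(Plus, 2)} \<Longrightarrow> is_formula L (lin_eq n N)"
    "Funs L = {(Plus, 2)} \<Longrightarrow> is_formula L (lin_cng k n N)"
    "Funs L = {(Plus, 2)} \<Longrightarrow> (Less, 2) \<in> Rels L \<Longrightarrow> is_formula L (lin_gt n N)"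
  by (simp_all add: lin_eq_def lin_cng_def lin_gt_def is_term_sum_tm numeral_2_eq_2)

lemma fv_lin: "fv (lin_eq n N) \<subseteq> {..<N}" "fv (lin_cng k n N) \<subseteq> {..<N}" "fv (lin_gt n N) \<subseteq> {..<N}"
proof -
  show 1: "fv (lin_eq n N) \<subseteq> {..<N}" for n N
    using set_copies[of _ N] by (auto simp: lin_eq_def fv_sum_tm)
  show "fv (lin_cng k n N) \<subseteq> {..<N}" using 1[of "n(N := - k)" "Suc N"] by (auto simp: lin_cng_def)
  show "fv (lin_gt n N) \<subseteq> {..<N}" using set_copies[of _ N] by (auto simp: lin_gt_def fv_sum_tm)
qed

lemma zero_definable_formula:
  assumes "is_formula (lang M) \<phi>" "fv \<phi> \<subseteq> {..<N}"
  shows "zero_definable M N {xs \<in> tuples M N. sat M (\<lambda>i. if i < N then xs ! i else d i) \<phi>}"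
  unfolding definable_over_def using assms by (intro exI[of _ \<phi>] exI[of _ d]) auto

text \<open>\<open>good I \<kappa>\<close> is to mean that the coding is correct on the test data
  \<open>I\<close>. An instance asks for the finitely many data \<open>info e\<close>, so one coding
  that is good for a finite union serves a finite set of instances.\<close>

lemma locally_translatesI:
  fixes A :: "('g, 'q, 'a) struct" and B :: "('f, 'p, 'b) struct"
    and good :: "'i set \<Rightarrow> ('a \<Rightarrow> nat \<Rightarrow> 'b) \<Rightarrow> bool"
  assumes mono: "\<And>I J \<kappa>. good J \<kappa> \<Longrightarrow> I \<subseteq> J \<Longrightarrow> good I \<kappa>"
    and ex: "\<And>I. finite I \<Longrightarrow> \<exists>\<kappa>. good I \<kappa> \<and> (\<forall>a j. \<kappa> a j \<in> universe B)"
    and tr: "\<And>\<phi>. is_formula (lang A) \<phi> \<Longrightarrow> \<exists>\<psi> cst info. is_formula (lang B) \<psi> \<and> (\<forall>e. finite (info e)) \<and>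
      (\<forall>e \<kappa>. good (info e) \<kappa> \<longrightarrow> (sat A e \<phi> \<longleftrightarrow>
          sat B (block_env m \<kappa> (\<lambda>i. if i \<in> fv \<phi> then e i else cst i)) \<psi>))"
  shows "\<exists>\<psi> cst. locally_translates B A m \<psi> cst"
proof -
  have "\<forall>\<phi>\<in>Collect (is_formula (lang A)). \<exists>p. is_formula (lang B) (fst p) \<and> (\<forall>e. finite (snd (snd p) e)) \<and>
      (\<forall>e \<kappa>. good (snd (snd p) e) \<kappa> \<longrightarrow> (sat A e \<phi> \<longleftrightarrow>
          sat B (block_env m \<kappa> (\<lambda>i. if i \<in> fv \<phi> then e i else fst (snd p) i)) (fst p)))"
  proof
    fix \<phi> assume "\<phi> \<in> Collect (is_formula (lang A))"
    then obtain \<psi> cst info where "is_formula (lang B) \<psi> \<and> (\<forall>e. finite (info e)) \<and>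
      (\<forall>e \<kappa>. good (info e) \<kappa> \<longrightarrow> (sat A e \<phi> \<longleftrightarrow>
          sat B (block_env m \<kappa> (\<lambda>i. if i \<in> fv \<phi> then e i else cst i)) \<psi>))"
      using tr by blast
    then show "\<exists>p. is_formula (lang B) (fst p) \<and> (\<forall>e. finite (snd (snd p) e)) \<and>
      (\<forall>e \<kappa>. good (snd (snd p) e) \<kappa> \<longrightarrow> (sat A e \<phi> \<longleftrightarrow>
          sat B (block_env m \<kappa> (\<lambda>i. if i \<in> fv \<phi> then e i else fst (snd p) i)) (fst p)))"
      by (intro exI[of _ "(\<psi>, cst, info)"]) (unfold fst_conv snd_conv)
  qed
  from bchoice[OF this] obtain p where p: "\<forall>\<phi>\<in>Collect (is_formula (lang A)).
      is_formula (lang B) (fst (p \<phi>)) \<and> (\<forall>e. finite (snd (snd (p \<phi>)) e)) \<and>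
      (\<forall>e \<kappa>. good (snd (snd (p \<phi>)) e) \<kappa> \<longrightarrow> (sat A e \<phi> \<longleftrightarrow>
          sat B (block_env m \<kappa> (\<lambda>i. if i \<in> fv \<phi> then e i else fst (snd (p \<phi>)) i)) (fst (p \<phi>))))" ..
  have "locally_translates B A m (\<lambda>\<phi>. fst (p \<phi>)) (\<lambda>\<phi>. fst (snd (p \<phi>)))"
    unfolding locally_translates_def
  proof (intro conjI allI impI)
    fix \<phi> assume "is_formula (lang A) \<phi>"
    then show "is_formula (lang B) (fst (p \<phi>))" using bspec[OF p] by blast
  next
    fix S :: "(('g, 'q) fm \<times> (nat \<Rightarrow> 'a)) set"
    assume S: "finite S" "\<forall>(\<phi>, e)\<in>S. is_formula (lang A) \<phi> \<and> range e \<subseteq> universe A"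
    define I where "I = (\<Union>(\<phi>, e)\<in>S. snd (snd (p \<phi>)) e)"
    have "finite (snd (snd (p \<phi>)) e)" if "(\<phi>, e) \<in> S" for \<phi> e
      using bspec[OF p, of \<phi>] bspec[OF S(2) that] by blast
    then have "finite I" using S(1) by (auto simp: I_def)
    then obtain \<kappa> where \<kappa>: "good I \<kappa>" "\<forall>a j. \<kappa> a j \<in> universe B" using ex by blast
    have "sat A e \<phi> \<longleftrightarrow> sat B (block_env m \<kappa> (\<lambda>i. if i \<in> fv \<phi> then e i else fst (snd (p \<phi>)) i)) (fst (p \<phi>))"
      if "(\<phi>, e) \<in> S" for \<phi> e
    proof -
      have "snd (snd (p \<phi>)) e \<subseteq> I" using that by (auto simp: I_def)
      then have "good (snd (snd (p \<phi>)) e) \<kappa>" by (rule mono[OF \<kappa>(1)])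
      moreover have "\<phi> \<in> Collect (is_formula (lang A))" using bspec[OF S(2) that] by simp
      ultimately show ?thesis using bspec[OF p] by blast
    qed
    then have "\<forall>(\<phi>, e)\<in>S. sat A e \<phi> \<longleftrightarrow>
        sat B (block_env m \<kappa> (\<lambda>i. if i \<in> fv \<phi> then e i else fst (snd (p \<phi>)) i)) (fst (p \<phi>))"
      by (simp add: case_prod_unfold)
    with \<kappa>(2) show "\<exists>\<kappa>. (\<forall>a j. \<kappa> a j \<in> universe B) \<and> (\<forall>(\<phi>, e)\<in>S. sat A e \<phi> \<longleftrightarrow>
        sat B (block_env m \<kappa> (\<lambda>i. if i \<in> fv \<phi> then e i else fst (snd (p \<phi>)) i)) (fst (p \<phi>)))"
      by (intro exI[of _ \<kappa>] conjI)
  qed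
  then show ?thesis by (intro exI)
qed

text \<open>After quantifier elimination only generators have to be translated. The constants are
  chosen jointly for all generators of a formula, because they share one assignment.\<close>

lemma locally_translates_boolgen:
  fixes A :: "('g, 'q, 'a) struct" and B :: "('f, 'p, 'b) struct"
    and good :: "'i set \<Rightarrow> ('a \<Rightarrow> nat \<Rightarrow> 'b) \<Rightarrow> bool"
  assumes mono: "\<And>I J \<kappa>. good J \<kappa> \<Longrightarrow> I \<subseteq> J \<Longrightarrow> good I \<kappa>"
    and ex: "\<And>I. finite I \<Longrightarrow> \<exists>\<kappa>. good I \<kappa> \<and> (\<forall>a j. \<kappa> a j \<in> universe B)"
    and qe: "\<And>\<phi>. is_formula (lang A) \<phi> \<Longrightarrow> {e. sat A e \<phi>} \<in> boolgen S"
    and tr: "\<And>S0 V. finite S0 \<Longrightarrow> S0 \<subseteq> S \<Longrightarrow> finite V \<Longrightarrow> \<exists>cst. \<forall>X\<in>S0. \<exists>lf info.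
      is_formula (lang B) lf \<and> (\<forall>e. finite (info e)) \<and> (\<forall>e \<kappa>. good (info e) \<kappa> \<longrightarrow>
        ((\<lambda>i. if i \<in> V then e i else cst i) \<in> X \<longleftrightarrow>
          sat B (block_env m \<kappa> (\<lambda>i. if i \<in> V then e i else cst i)) lf))"
  shows "\<exists>\<psi> cst. locally_translates B A m \<psi> cst"
proof (rule locally_translatesI[of good, OF mono ex])
  fix \<phi> assume \<phi>: "is_formula (lang A) \<phi>"
  from boolgen_formula[OF qe[OF \<phi>], of "lang B"] obtain S0 where S0: "finite S0" "S0 \<subseteq> S"
    and comb: "\<forall>lf. (\<forall>X\<in>S0. is_formula (lang B) (lf X)) \<longrightarrow> (\<exists>\<psi>. is_formula (lang B) \<psi> \<and>
      (\<forall>e (M :: ('f, 'p, 'b) struct) v. (\<forall>X\<in>S0. e \<in> X \<longleftrightarrow> sat M v (lf X)) \<longrightarrow> (e \<in> {e. sat A e \<phi>} \<longleftrightarrow> sat M v \<psi>)))"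
    by (elim exE conjE)
  obtain cst where cst: "\<forall>X\<in>S0. \<exists>lf info.
      is_formula (lang B) lf \<and> (\<forall>e. finite (info e)) \<and> (\<forall>e \<kappa>. good (info e) \<kappa> \<longrightarrow>
        ((\<lambda>i. if i \<in> fv \<phi> then e i else cst i) \<in> X \<longleftrightarrow>
          sat B (block_env m \<kappa> (\<lambda>i. if i \<in> fv \<phi> then e i else cst i)) lf))"
    using tr[OF S0 finite_fv[of \<phi>]] by (rule exE)
  from bchoice[OF cst] obtain lf where lf: "\<forall>X\<in>S0. \<exists>info.
      is_formula (lang B) (lf X) \<and> (\<forall>e. finite (info e)) \<and> (\<forall>e \<kappa>. good (info e) \<kappa> \<longrightarrow>
        ((\<lambda>i. if i \<in> fv \<phi> then e i else cst i) \<in> X \<longleftrightarrow>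
          sat B (block_env m \<kappa> (\<lambda>i. if i \<in> fv \<phi> then e i else cst i)) (lf X)))" ..
  from bchoice[OF lf] obtain info where info: "\<forall>X\<in>S0.
      is_formula (lang B) (lf X) \<and> (\<forall>e. finite (info X e)) \<and> (\<forall>e \<kappa>. good (info X e) \<kappa> \<longrightarrow>
        ((\<lambda>i. if i \<in> fv \<phi> then e i else cst i) \<in> X \<longleftrightarrow>
          sat B (block_env m \<kappa> (\<lambda>i. if i \<in> fv \<phi> then e i else cst i)) (lf X)))" ..
  obtain \<psi> where \<psi>: "is_formula (lang B) \<psi>"
      "\<forall>e (M :: ('f, 'p, 'b) struct) v. (\<forall>X\<in>S0. e \<in> X \<longleftrightarrow> sat M v (lf X)) \<longrightarrow> (e \<in> {e. sat A e \<phi>} \<longleftrightarrow> sat M v \<psi>)"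
    using mp[OF spec[OF comb, of lf]] info by blast
  define inf where "inf e = (\<Union>X\<in>S0. info X e)" for e
  have "finite (inf e)" for e using S0(1) info by (simp add: inf_def)
  moreover have "sat A e \<phi> \<longleftrightarrow> sat B (block_env m \<kappa> (\<lambda>i. if i \<in> fv \<phi> then e i else cst i)) \<psi>"
    if g: "good (inf e) \<kappa>" for e \<kappa>
  proof -
    let ?e = "\<lambda>i. if i \<in> fv \<phi> then e i else cst i"
    have "sat A e \<phi> \<longleftrightarrow> ?e \<in> {e. sat A e \<phi>}" unfolding mem_Collect_eq by (rule sat_cong) simp
    also have "\<dots> \<longleftrightarrow> sat B (block_env m \<kappa> ?e) \<psi>"
    proof (rule \<psi>(2)[THEN spec, THEN spec, THEN spec, THEN mp], rule ballI)
      fix X assume X: "X \<in> S0"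
      have "good (info X e) \<kappa>" by (rule mono[OF g]) (use X in \<open>auto simp: inf_def\<close>)
      then show "?e \<in> X \<longleftrightarrow> sat B (block_env m \<kappa> ?e) (lf X)" using bspec[OF info X] by blast
    qed
    finally show ?thesis .
  qed
  ultimately show "\<exists>\<psi> cst info. is_formula (lang B) \<psi> \<and> (\<forall>e. finite (info e)) \<and>
      (\<forall>e \<kappa>. good (info e) \<kappa> \<longrightarrow> (sat A e \<phi> \<longleftrightarrow>
          sat B (block_env m \<kappa> (\<lambda>i. if i \<in> fv \<phi> then e i else cst i)) \<psi>))"
    using \<psi>(1) by (intro exI[of _ \<psi>] exI[of _ cst] exI[of _ inf]) blast
qed

lemma additive_on_lin:
  fixes N :: nat
  assumes "additive_on F h" "subgrp F" "\<And>i. i < N \<Longrightarrow> d i \<in> F"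
  shows "h (\<Sum>i<N. zmul (n i) (d i)) = (\<Sum>i<N. zmul (n i) (h (d i)))"
proof -
  have "h (\<Sum>i<N. zmul (n i) (d i)) = (\<Sum>i<N. h (zmul (n i) (d i)))"
    by (rule additive_on_sum[OF assms(1,2)]) (use assms subgrp_zmul in auto)
  also have "\<dots> = (\<Sum>i<N. zmul (n i) (h (d i)))"
    by (rule sum.cong) (use additive_on_zmul[OF assms(1,2)] assms(3) in auto)
  finally show ?thesis .
qed


section \<open>From the ordered group to the disjoint union\<close>

abbreviation group_reals ::
    "(unit, ('h :: linordered_ab_group_add, real) du_sym, 'h + real) struct" where
  "group_reals \<equiv> disjoint_union (group_struct :: (_, _, 'h) struct) (ordered_group_struct :: (_, _, real) struct)"

lemma disjoint_union_simps:
  "universe (disjoint_union M N) = universe M <+> universe N"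
  "Funs (lang (disjoint_union M N)) = {}"
  "(Rel_Left X, n) \<in> Rels (lang (disjoint_union M N)) \<longleftrightarrow> zero_definable M n X"
  "(Rel_Right Y, n) \<in> Rels (lang (disjoint_union M N)) \<longleftrightarrow> zero_definable N n Y"
  "(In_Left, n) \<in> Rels (lang (disjoint_union M N)) \<longleftrightarrow> n = 1"
  "(In_Right, n) \<in> Rels (lang (disjoint_union M N)) \<longleftrightarrow> n = 1"
  by (auto simp: disjoint_union_def)

lemma group_universe:
  "universe (group_struct :: (_, _, 'a :: ab_group_add) struct) = UNIV"
  "universe (ordered_group_struct :: (_, _, 'b :: linordered_ab_group_add) struct) = UNIV"
  by (simp_all add: group_struct_def ordered_group_struct_def)

lemma group_lang:
  "Funs (lang group_struct) = {(Plus, 2)}" "Funs (lang ordered_group_struct) = {(Plus, 2)}"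
  "Rels (lang group_struct) = {}" "Rels (lang ordered_group_struct) = {(Less, 2)}"
  by (simp_all add: group_struct_def ordered_group_struct_def)

text \<open>The disjoint union has a symbol for every zero-definable relation of a component, so a
  whole formula over one component becomes a single atomic formula.\<close>

definition rel_fm :: "('a, 'b) du_sym \<Rightarrow> (nat \<Rightarrow> nat) \<Rightarrow> nat \<Rightarrow> (unit, ('a, 'b) du_sym) fm" where
  "rel_fm p h n = Rel p (map (\<lambda>i. Var (h i)) [0..<n])"

lemma sat_rel_fm_left:
  assumes "\<And>i. i < n \<Longrightarrow> v (h i) = Inl (y i)"
  shows "sat (disjoint_union M N) v (rel_fm (Rel_Left X) h n) \<longleftrightarrow> map y [0..<n] \<in> X"
proof -
  have "map (tm_val (disjoint_union M N) v) (map (\<lambda>i. Var (h i)) [0..<n]) = map Inl (map y [0..<n])"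
    using assms by simp
  then show ?thesis unfolding rel_fm_def sat.simps
    by (simp add: disjoint_union_def inj_image_mem_iff[OF inj_mapI[OF inj_Inl]] del: map_map)
qed

lemma sat_rel_fm_right:
  assumes "\<And>i. i < n \<Longrightarrow> v (h i) = Inr (y i)"
  shows "sat (disjoint_union M N) v (rel_fm (Rel_Right X) h n) \<longleftrightarrow> map y [0..<n] \<in> X"
proof -
  have "map (tm_val (disjoint_union M N) v) (map (\<lambda>i. Var (h i)) [0..<n]) = map Inr (map y [0..<n])"
    using assms by simp
  then show ?thesis unfolding rel_fm_def sat.simps
    by (simp add: disjoint_union_def inj_image_mem_iff[OF inj_mapI[OF inj_Inr]] del: map_map)
qed

lemma is_formula_rel_fm: "(p, n) \<in> Rels L \<Longrightarrow> is_formula L (rel_fm p h n)"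
  by (auto simp: rel_fm_def list_all_iff)

definition solutions :: "('f, 'p, 'a :: zero) struct \<Rightarrow> nat \<Rightarrow> ('f, 'p) fm \<Rightarrow> 'a list set" where
  "solutions M N \<phi> = {xs \<in> tuples M N. sat M (\<lambda>i. if i < N then xs ! i else 0) \<phi>}"

lemma mem_solutions:
  assumes "fv \<phi> \<subseteq> {..<N}" "universe M = UNIV"
  shows "map y [0..<N] \<in> solutions M N \<phi> \<longleftrightarrow> sat M y \<phi>"
proof -
  have "sat M (\<lambda>i. if i < N then map y [0..<N] ! i else 0) \<phi> \<longleftrightarrow> sat M y \<phi>"
    by (rule sat_cong) (use assms(1) in auto)
  then show ?thesis using assms(2) by (simp add: solutions_def tuples_def)
qed

context regular_chain
begin

text \<open>A sign condition modulo the \<open>j\<close>-th subgroup of the list is read off the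
  reals in coordinate \<open>2 * j + 1\<close>, a congruence off the group in coordinate
  \<open>2 * j\<close>.\<close>

theorem translates_ordered_group:
  "\<exists>m \<psi> cst. 0 < m \<and> locally_translates (group_reals :: (_, _, 'a + real) struct)
    (ordered_group_struct :: (_, _, 'a) struct) m \<psi> cst"
proof -
  let ?A = "ordered_group_struct :: (_, _, 'a) struct"
  let ?B = "group_reals :: (_, _, 'a + real) struct"
  obtain Cs where Cs: "set Cs = \<C>" using finite_list[OF finite_chain] by blast
  define r where "r = length Cs"
  have r0: "0 < r" using Cs bot_mem by (cases Cs) (auto simp: r_def)
  \<comment> \<open>Two kinds of test data: \<open>Inl t\<close> for an element whose sign and
    congruences matter, \<open>Inr k\<close> for a modulus.\<close>
  define traces where "traces I C \<sigma> \<rho> \<longleftrightarrow> (\<exists>F. subgrp F \<and> {t. Inl t \<in> I} \<subseteq> F \<and> additive_on F \<sigma> \<and> additive_on F \<rho> \<and>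
    (\<forall>t\<in>{t. Inl t \<in> I}. gt C t \<longleftrightarrow> 0 < \<rho> t) \<and>
    (\<forall>t\<in>{t. Inl t \<in> I}. \<forall>k\<in>{k. Inr k \<in> I}. t \<in> cng C k \<longleftrightarrow> \<sigma> t \<in> cng {0} k))"
    for I :: "('a + int) set" and C and \<sigma> :: "'a \<Rightarrow> 'a" and \<rho> :: "'a \<Rightarrow> real"
  define good where "good I \<kappa> \<longleftrightarrow> (\<forall>j<r. \<exists>\<sigma> \<rho>. traces I (Cs ! j) \<sigma> \<rho> \<and>
    (\<forall>a. \<kappa> a (2 * j) = Inl (\<sigma> a) \<and> \<kappa> a (2 * j + 1) = Inr (\<rho> a)))"
    for I :: "('a + int) set" and \<kappa> :: "'a \<Rightarrow> nat \<Rightarrow> 'a + real"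
  have "\<exists>\<psi> cst. locally_translates ?B ?A (2 * r) \<psi> cst"
  proof (rule locally_translates_boolgen[of good ?B ?A atoms])
    fix I J \<kappa> assume g: "good J \<kappa>" and IJ: "I \<subseteq> J"
    have "traces I C \<sigma> \<rho>" if "traces J C \<sigma> \<rho>" for C \<sigma> \<rho>
    proof -
      have sub: "{t. Inl t \<in> I} \<subseteq> {t. Inl t \<in> J}" "{k. Inr k \<in> I} \<subseteq> {k. Inr k \<in> J}" using IJ by auto
      from that obtain F where F: "subgrp F" "{t. Inl t \<in> J} \<subseteq> F" "additive_on F \<sigma>" "additive_on F \<rho>"
        and gt: "\<forall>t\<in>{t. Inl t \<in> J}. gt C t \<longleftrightarrow> 0 < \<rho> t"
        and cng: "\<forall>t\<in>{t. Inl t \<in> J}. \<forall>k\<in>{k. Inr k \<in> J}. t \<in> cng C k \<longleftrightarrow> \<sigma> t \<in> cng {0} k"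
        unfolding traces_def by (elim exE conjE)
      show ?thesis unfolding traces_def
      proof (intro exI[of _ F] conjI ballI)
        show "{t. Inl t \<in> I} \<subseteq> F" using sub(1) F(2) by (rule subset_trans)
        show "gt C t \<longleftrightarrow> 0 < \<rho> t" if "t \<in> {t. Inl t \<in> I}" for t
          by (rule bspec[OF gt subsetD[OF sub(1) that]])
        show "t \<in> cng C k \<longleftrightarrow> \<sigma> t \<in> cng {0} k" if "t \<in> {t. Inl t \<in> I}" "k \<in> {k. Inr k \<in> I}" for t k
          by (rule bspec[OF bspec[OF cng subsetD[OF sub(1) that(1)]] subsetD[OF sub(2) that(2)]])
      qed (fact F)+
    qed
    with g show "good I \<kappa>" unfolding good_def by blast
  next
    fix I :: "('a + int) set" assume "finite I"
    then have fin: "finite {t. Inl t \<in> I}" "finite {k. Inr k \<in> I}"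
      using finite_vimageI[of I Inl] finite_vimageI[of I Inr] by (auto simp: vimage_def)
    have "\<forall>j\<in>{..<r}. \<exists>p. traces I (Cs ! j) (fst p) (snd p)"
    proof
      fix j assume "j \<in> {..<r}"
      then have "convex_subgroup (Cs ! j)" using Cs convex by (auto simp: r_def)
      from ex_local_coordinates[OF this fin zero_less_one[where 'a = real]] obtain F and \<sigma> :: "'a \<Rightarrow> 'a" and \<rho> :: "'a \<Rightarrow> real" where
        "subgrp F \<and> {t. Inl t \<in> I} \<subseteq> F \<and> additive_on F \<sigma> \<and> additive_on F \<rho> \<and>
        (\<forall>t\<in>{t. Inl t \<in> I}. gt (Cs ! j) t \<longleftrightarrow> 0 < \<rho> t) \<and>
        (\<forall>t\<in>{t. Inl t \<in> I}. \<forall>k\<in>{k. Inr k \<in> I}. t \<in> cng (Cs ! j) k \<longleftrightarrow> \<sigma> t \<in> cng {0} k)"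
        by (elim exE)
      then have "traces I (Cs ! j) \<sigma> \<rho>" unfolding traces_def by (rule exI)
      then show "\<exists>p. traces I (Cs ! j) (fst p) (snd p)" by (intro exI[of _ "(\<sigma>, \<rho>)"]) simp
    qed
    from bchoice[OF this] obtain p where p: "\<forall>j\<in>{..<r}. traces I (Cs ! j) (fst (p j)) (snd (p j))" ..
    define \<kappa> where "\<kappa> a l = (if even l then Inl (fst (p (l div 2)) a) else Inr (snd (p (l div 2)) a))" for a l
    have "\<exists>\<sigma> \<rho>. traces I (Cs ! j) \<sigma> \<rho> \<and> (\<forall>a. \<kappa> a (2 * j) = Inl (\<sigma> a) \<and> \<kappa> a (2 * j + 1) = Inr (\<rho> a))"
      if "j < r" for j
      using bspec[OF p, of j] that
      by (intro exI[of _ "fst (p j)"] exI[of _ "snd (p j)"]) (simp add: \<kappa>_def)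
    then have "good I \<kappa>" unfolding good_def by blast
    moreover have "\<forall>a j. \<kappa> a j \<in> universe ?B" by (simp add: disjoint_union_simps group_universe)
    ultimately show "\<exists>\<kappa>. good I \<kappa> \<and> (\<forall>a j. \<kappa> a j \<in> universe ?B)" by blast
  next
    fix S0 :: "(nat \<Rightarrow> 'a) set set" and V :: "nat set"
    assume S0: "finite S0" "S0 \<subseteq> atoms" and V: "finite V"
    have "\<forall>X\<in>S0. \<exists>f. affine f \<and> (\<exists>C\<in>\<C>. X = {e. gt C (f e)} \<or> (\<exists>k>0. X = {e. f e \<in> cng C k}))"
      using S0(2) unfolding atoms_def by blast
    from bchoice[OF this] obtain fx where fx: "\<forall>X\<in>S0. affine (fx X) \<and>
      (\<exists>C\<in>\<C>. X = {e. gt C (fx X e)} \<or> (\<exists>k>0. X = {e. fx X e \<in> cng C k}))" ..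
    have "\<exists>cst. \<forall>f\<in>fx ` S0. \<exists>n N. \<forall>e. f (\<lambda>i. if i \<in> V then e i else cst i) =
        (\<Sum>i<N. zmul (n i) (if i \<in> V then e i else cst i))"
      by (rule constants_as_variables) (use S0(1) V fx in auto)
    then obtain cst where cst: "\<forall>f\<in>fx ` S0. \<exists>n N. \<forall>e. f (\<lambda>i. if i \<in> V then e i else cst i) =
        (\<Sum>i<N. zmul (n i) (if i \<in> V then e i else cst i))" ..
    have "\<exists>lf info. is_formula (lang ?B) lf \<and> (\<forall>e. finite (info e)) \<and> (\<forall>e \<kappa>. good (info e) \<kappa> \<longrightarrow>
        ((\<lambda>i. if i \<in> V then e i else cst i) \<in> X \<longleftrightarrow>
          sat ?B (block_env (2 * r) \<kappa> (\<lambda>i. if i \<in> V then e i else cst i)) lf))" if X: "X \<in> S0" for X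
    proof -
      let ?e = "\<lambda>e i. if i \<in> V then e i else cst i"
      obtain n N where nN: "\<And>e. fx X (?e e) = (\<Sum>i<N. zmul (n i) (?e e i))"
        using cst X by blast
      obtain C where C: "C \<in> \<C>" "X = {e. gt C (fx X e)} \<or> (\<exists>k>0. X = {e. fx X e \<in> cng C k})"
        using fx X by blast
      obtain j where j: "j < r" "Cs ! j = C" using C(1) Cs by (metis in_set_conv_nth r_def)
      have blk: "block_env (2 * r) \<kappa> d (2 * r * i + l) = \<kappa> (d i) l" if "l < 2 * r" for \<kappa> :: "'a \<Rightarrow> nat \<Rightarrow> 'a + real" and d i l
        using that by (simp add: block_env_def)
      \<comment> \<open>Besides the value to be tested, the arguments are listed, because they must
        lie in the subgroup on which the maps are additive.\<close>
      define base :: "(nat \<Rightarrow> 'a) \<Rightarrow> ('a + int) set"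
        where "base e = Inl ` insert (fx X (?e e)) (?e e ` {..<N})" for e
      from C(2) show ?thesis
      proof
        assume X: "X = {e. gt C (fx X e)}"
        let ?Y = "solutions (ordered_group_struct :: (_, _, real) struct) N (lin_gt n N)"
        let ?lf = "rel_fm (Rel_Right ?Y) (\<lambda>i. 2 * r * i + (2 * j + 1)) N :: (unit, ('a, real) du_sym) fm"
        have "zero_definable (ordered_group_struct :: (_, _, real) struct) N ?Y"
          unfolding solutions_def by (intro zero_definable_formula is_formula_lin fv_lin) (auto simp: group_lang)
        then have "is_formula (lang ?B) ?lf" by (intro is_formula_rel_fm) (simp add: disjoint_union_simps)
        moreover have "?e e \<in> X \<longleftrightarrow> sat ?B (block_env (2 * r) \<kappa> (?e e)) ?lf" if g: "good (base e) \<kappa>" for e \<kappa>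
        proof -
          obtain \<sigma> \<rho> where tr: "traces (base e) C \<sigma> \<rho>" and \<kappa>: "\<And>a. \<kappa> a (2 * j + 1) = Inr (\<rho> a)"
            using g j unfolding good_def by blast
          obtain F where F: "subgrp F" "{t. Inl t \<in> base e} \<subseteq> F" "additive_on F \<rho>"
              "\<forall>t\<in>{t. Inl t \<in> base e}. gt C t \<longleftrightarrow> 0 < \<rho> t"
            using tr unfolding traces_def by blast
          have "?e e \<in> X \<longleftrightarrow> gt C (fx X (?e e))" by (subst X) simp
          also have "\<dots> \<longleftrightarrow> 0 < \<rho> (fx X (?e e))" by (rule bspec[OF F(4)]) (simp add: base_def)
          also have "\<rho> (fx X (?e e)) = (\<Sum>i<N. zmul (n i) (\<rho> (?e e i)))"
            unfolding nN by (rule additive_on_lin[OF F(3,1)], rule subsetD[OF F(2)]) (simp add: base_def)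
          also have "0 < \<dots> \<longleftrightarrow> map (\<lambda>i. \<rho> (?e e i)) [0..<N] \<in> ?Y"
            by (subst mem_solutions) (simp_all add: fv_lin group_universe sat_lin_gt)
          also have "\<dots> \<longleftrightarrow> sat ?B (block_env (2 * r) \<kappa> (?e e)) ?lf"
            by (rule sat_rel_fm_right[symmetric], subst blk) (use j \<kappa> in auto)
          finally show ?thesis .
        qed
        moreover have "finite (base e)" for e by (simp add: base_def)
        ultimately show ?thesis by (intro exI[of _ ?lf] exI[of _ base]) blast
      next
        assume "\<exists>k>0. X = {e. fx X e \<in> cng C k}"
        then obtain k where X: "X = {e. fx X e \<in> cng C k}" by blast
        let ?Y = "solutions (group_struct :: (_, _, 'a) struct) N (lin_cng k n N)"
        let ?lf = "rel_fm (Rel_Left ?Y) (\<lambda>i. 2 * r * i + 2 * j) N :: (unit, ('a, real) du_sym) fm"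
        have "zero_definable (group_struct :: (_, _, 'a) struct) N ?Y"
          unfolding solutions_def by (intro zero_definable_formula is_formula_lin fv_lin) (auto simp: group_lang)
        then have "is_formula (lang ?B) ?lf" by (intro is_formula_rel_fm) (simp add: disjoint_union_simps)
        moreover have "?e e \<in> X \<longleftrightarrow> sat ?B (block_env (2 * r) \<kappa> (?e e)) ?lf" if g: "good (insert (Inr k) (base e)) \<kappa>" for e \<kappa>
        proof -
          obtain \<sigma> \<rho> where tr: "traces (insert (Inr k) (base e)) C \<sigma> \<rho>" and \<kappa>: "\<And>a. \<kappa> a (2 * j) = Inl (\<sigma> a)"
            using g j unfolding good_def by blast
          obtain F where F: "subgrp F" "{t. Inl t \<in> insert (Inr k) (base e)} \<subseteq> F" "additive_on F \<sigma>"
              "\<forall>t\<in>{t. Inl t \<in> insert (Inr k) (base e)}. \<forall>l\<in>{l. Inr l \<in> insert (Inr k) (base e)}. t \<in> cng C l \<longleftrightarrow> \<sigma> t \<in> cng {0} l"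
            using tr unfolding traces_def by blast
          have "?e e \<in> X \<longleftrightarrow> fx X (?e e) \<in> cng C k" by (subst X) simp
          also have "\<dots> \<longleftrightarrow> \<sigma> (fx X (?e e)) \<in> cng {0} k"
            by (rule bspec[OF bspec[OF F(4)]]) (simp_all add: base_def)
          also have "\<sigma> (fx X (?e e)) = (\<Sum>i<N. zmul (n i) (\<sigma> (?e e i)))"
            unfolding nN by (rule additive_on_lin[OF F(3,1)], rule subsetD[OF F(2)]) (simp add: base_def)
          also have "\<dots> \<in> cng {0} k \<longleftrightarrow> map (\<lambda>i. \<sigma> (?e e i)) [0..<N] \<in> ?Y"
            by (subst mem_solutions) (simp_all add: fv_lin group_universe sat_lin_cng[OF plus_struct_group(1)])
          also have "\<dots> \<longleftrightarrow> sat ?B (block_env (2 * r) \<kappa> (?e e)) ?lf"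
            by (rule sat_rel_fm_left[symmetric], subst blk) (use j \<kappa> in auto)
          finally show ?thesis .
        qed
        moreover have "finite (insert (Inr k) (base e))" for e by (simp add: base_def)
        ultimately show ?thesis by (intro exI[of _ ?lf] exI[of _ "\<lambda>e. insert (Inr k) (base e)"]) blast
      qed
    qed
    then show "\<exists>cst. \<forall>X\<in>S0. \<exists>lf info. is_formula (lang ?B) lf \<and> (\<forall>e. finite (info e)) \<and>
      (\<forall>e \<kappa>. good (info e) \<kappa> \<longrightarrow> ((\<lambda>i. if i \<in> V then e i else cst i) \<in> X \<longleftrightarrow>
          sat ?B (block_env (2 * r) \<kappa> (\<lambda>i. if i \<in> V then e i else cst i)) lf))"
      by (intro exI[of _ cst] ballI)
  qed (rule sat_boolgen)
  then show ?thesis using r0 by (intro exI[of _ "2 * r"]) simp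
qed

end

section \<open>From the disjoint union to the ordered group\<close>

lemma boolgen_vimage:
  assumes "E \<in> boolgen S"
  shows "{e. h e \<in> E} \<in> boolgen ((\<lambda>X. {e. h e \<in> X}) ` S)"
proof -
  obtain S0 where S0: "S0 \<subseteq> S" "finite S0"
    and det: "\<forall>x y. (\<forall>X\<in>S0. x \<in> X \<longleftrightarrow> y \<in> X) \<longrightarrow> (x \<in> E \<longleftrightarrow> y \<in> E)"
    using assms unfolding boolgen_def by (elim CollectE exE conjE)
  show ?thesis
  proof (rule boolgenI[of "(\<lambda>X. {e. h e \<in> X}) ` S0"])
    fix x y assume *: "\<And>X. X \<in> (\<lambda>X. {e. h e \<in> X}) ` S0 \<Longrightarrow> x \<in> X \<longleftrightarrow> y \<in> X" and x: "x \<in> {e. h e \<in> E}"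
    have "\<forall>X\<in>S0. h x \<in> X \<longleftrightarrow> h y \<in> X"
    proof
      fix X assume "X \<in> S0"
      from *[OF imageI[OF this]] show "h x \<in> X \<longleftrightarrow> h y \<in> X" by simp
    qed
    from det[THEN spec, THEN spec, THEN mp, OF this] x show "y \<in> {e. h e \<in> E}" by simp
  qed (use S0 in auto)
qed

text \<open>A variable on the other side is read as \<open>0\<close>. This default is harmless
  because \<open>0\<close> is definable, so that it can be written back into a formula of the
  component.\<close>

definition lft :: "'a :: zero + 'b \<Rightarrow> 'a" where "lft x = (case x of Inl a \<Rightarrow> a | Inr _ \<Rightarrow> 0)"
definition rgt :: "'a + 'b :: zero \<Rightarrow> 'b" where "rgt x = (case x of Inl _ \<Rightarrow> 0 | Inr b \<Rightarrow> b)"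

lemma lft_simps [simp]: "lft (Inl a) = a" "lft (Inr b) = 0" by (simp_all add: lft_def)
lemma rgt_simps [simp]: "rgt (Inl a) = 0" "rgt (Inr b) = b" by (simp_all add: rgt_def)

definition proj_sets :: "('f, 'p, 'c) struct \<Rightarrow> ('s \<Rightarrow> 'c) \<Rightarrow> (nat \<Rightarrow> 's) set set" where
  "proj_sets M pr = {{e. sat M (pr \<circ> e) \<chi>} | \<chi>. is_formula (lang M) \<chi>}"

text \<open>All formulas of the components, quantifiers included, serve as generators, so that
  elimination in the disjoint union only has to separate the two sides.\<close>

definition du_gens :: "(nat \<Rightarrow> 'h :: linordered_ab_group_add + real) set set" where
  "du_gens = {{e. isl (e i)} | i. True} \<union> proj_sets (group_struct :: (_, _, 'h) struct) lft \<union>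
    proj_sets (ordered_group_struct :: (_, _, real) struct) rgt"

lemma du_gens_isl: "{e. isl (e i)} \<in> boolgen du_gens"
  by (rule boolgen_gen) (auto simp: du_gens_def)

lemma du_gens_left:
  "is_formula (lang (group_struct :: (_, _, 'h :: linordered_ab_group_add) struct)) \<chi> \<Longrightarrow>
    {e. sat (group_struct :: (_, _, 'h) struct) (lft \<circ> e) \<chi>} \<in> boolgen du_gens"
  by (rule boolgen_gen) (unfold du_gens_def proj_sets_def, blast)

lemma du_gens_right:
  "is_formula (lang (ordered_group_struct :: (_, _, real) struct)) \<chi> \<Longrightarrow>
    {e. sat (ordered_group_struct :: (_, _, real) struct) (rgt \<circ> e) \<chi>} \<in> boolgen du_gens"
  by (rule boolgen_gen) (unfold du_gens_def proj_sets_def, blast)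

text \<open>The quantified \<open>a\<close> occurs only in a formula of one component, which can
  absorb the quantifier.\<close>

definition separated ::
    "'s set set \<Rightarrow> nat \<Rightarrow> ('f, 'p, 'c) struct \<Rightarrow> ('s \<Rightarrow> nat \<Rightarrow> 'c) \<Rightarrow> ('c \<Rightarrow> 's \<Rightarrow> bool) \<Rightarrow> bool" where
  "separated S i M pr R \<longleftrightarrow> (\<exists>\<chi> E. is_formula (lang M) \<chi> \<and> {e. E e} \<in> boolgen S \<and>
    (\<forall>a e. R a e \<longleftrightarrow> sat M ((pr e)(i := a)) \<chi> \<and> E e))"

lemma separated_formula: "is_formula (lang M) \<chi> \<Longrightarrow> separated S i M pr (\<lambda>a e. sat M ((pr e)(i := a)) \<chi>)"
  unfolding separated_def by (intro exI[of _ \<chi>] exI[of _ "\<lambda>_. True"]) (simp add: boolgen_UNIV)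

lemma separated_side: "{e. E e} \<in> boolgen S \<Longrightarrow> separated S i M pr (\<lambda>a e. E e)"
  unfolding separated_def by (intro exI[of _ "Eq (Var 0) (Var 0)"] exI[of _ E]) simp

lemma separated_conj:
  assumes "separated S i M pr R" "separated S i M pr R'"
  shows "separated S i M pr (\<lambda>a e. R a e \<and> R' a e)"
proof -
  obtain \<chi> E where 1: "is_formula (lang M) \<chi>" "{e. E e} \<in> boolgen S" "\<forall>a e. R a e \<longleftrightarrow> sat M ((pr e)(i := a)) \<chi> \<and> E e"
    using assms(1) unfolding separated_def by (elim exE conjE)
  obtain \<chi>' E' where 2: "is_formula (lang M) \<chi>'" "{e. E' e} \<in> boolgen S" "\<forall>a e. R' a e \<longleftrightarrow> sat M ((pr e)(i := a)) \<chi>' \<and> E' e"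
    using assms(2) unfolding separated_def by (elim exE conjE)
  show ?thesis unfolding separated_def
    by (intro exI[of _ "Conj \<chi> \<chi>'"] exI[of _ "\<lambda>e. E e \<and> E' e"]) (use 1 2 boolgen_conj in auto)
qed

lemma separated_ball:
  assumes "finite A" "\<And>X. X \<in> A \<Longrightarrow> separated S i M pr (R X)"
  shows "separated S i M pr (\<lambda>a e. \<forall>X\<in>A. R X a e)"
  using assms
proof (induction A rule: finite_induct)
  case empty
  then show ?case using separated_side[of "\<lambda>_. True"] by (simp add: boolgen_UNIV)
next
  case (insert X A)
  have "separated S i M pr (\<lambda>a e. R X a e \<and> (\<forall>X\<in>A. R X a e))"
    by (rule separated_conj) (use insert in auto)
  then show ?case by simp
qed

lemma separated_exists:
  assumes "separated S i M pr R" "universe M = UNIV"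
    and "\<And>\<chi>. is_formula (lang M) \<chi> \<Longrightarrow> {e. sat M (pr e) \<chi>} \<in> boolgen S"
  shows "{e. \<exists>a. R a e} \<in> boolgen S"
proof -
  obtain \<chi> E where 1: "is_formula (lang M) \<chi>" "{e. E e} \<in> boolgen S" "\<forall>a e. R a e \<longleftrightarrow> sat M ((pr e)(i := a)) \<chi> \<and> E e"
    using assms(1) unfolding separated_def by (elim exE conjE)
  have "{e. \<exists>a. R a e} = {e. sat M (pr e) (Ex i \<chi>) \<and> E e}" using 1(3) assms(2) by simp
  also have "\<dots> \<in> boolgen S" using 1 by (intro boolgen_conj assms(3)) auto
  finally show ?thesis .
qed

text \<open>The equation \<open>x + x = x\<close> defines \<open>0\<close> in a language without a
  constant for it.\<close>

lemma sat_zero_at: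
  assumes M: "plus_struct M"
  shows "sat M (e(i := 0)) \<chi> \<longleftrightarrow> sat M e (Ex i (Conj (Eq (Fn Plus [Var i, Var i]) (Var i)) \<chi>))"
  using M by (auto simp: plus_struct_def)

lemma boolgen_zero_at:
  assumes M: "plus_struct M" and \<chi>: "is_formula (lang M) \<chi>"
    and all: "\<And>\<chi>. is_formula (lang M) \<chi> \<Longrightarrow> {e. sat M (pr e) \<chi>} \<in> boolgen S"
  shows "{e. sat M ((pr e)(i := 0)) \<chi>} \<in> boolgen S"
  unfolding sat_zero_at[OF M] by (rule all) (use M \<chi> in \<open>simp add: plus_struct_def numeral_2_eq_2\<close>)

lemma upd_isl: "isl ((e(i := Inl a)) j) \<longleftrightarrow> j = i \<or> isl (e j)" "isl ((e(i := Inr b)) j) \<longleftrightarrow> j \<noteq> i \<and> isl (e j)"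
  by auto

lemma upd_proj:
  "lft \<circ> e(i := Inl a) = (lft \<circ> e)(i := a)" "lft \<circ> e(i := Inr b) = (lft \<circ> e)(i := 0)"
  "rgt \<circ> e(i := Inl a) = (rgt \<circ> e)(i := 0)" "rgt \<circ> e(i := Inr b) = (rgt \<circ> e)(i := b)"
  by auto

text \<open>A new value on one side leaves \<open>0\<close> in the projection to the other side;
  literals of the other side therefore become side conditions.\<close>

lemma du_literal_separated:
  fixes X :: "(nat \<Rightarrow> 'h :: linordered_ab_group_add + real) set"
  assumes "X \<in> du_gens"
  shows "separated du_gens i (group_struct :: (_, _, 'h) struct) (\<lambda>e. lft \<circ> e) (\<lambda>a e. e(i := Inl a) \<in> X)" (is ?A)
    "separated du_gens i (group_struct :: (_, _, 'h) struct) (\<lambda>e. lft \<circ> e) (\<lambda>a e. e(i := Inl a) \<notin> X)" (is ?B)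
    "separated du_gens i (ordered_group_struct :: (_, _, real) struct) (\<lambda>e. rgt \<circ> e) (\<lambda>a e. e(i := Inr a) \<in> X)" (is ?C)
    "separated du_gens i (ordered_group_struct :: (_, _, real) struct) (\<lambda>e. rgt \<circ> e) (\<lambda>a e. e(i := Inr a) \<notin> X)" (is ?D)
proof -
  let ?G = "group_struct :: (_, _, 'h) struct" and ?R = "ordered_group_struct :: (_, _, real) struct"
  consider (i) j where "X = {e. isl (e j)}"
    | (l) \<chi> where "X = {e. sat ?G (lft \<circ> e) \<chi>}" "is_formula (lang ?G) \<chi>"
    | (r) \<chi> where "X = {e. sat ?R (rgt \<circ> e) \<chi>}" "is_formula (lang ?R) \<chi>"
    using assms unfolding du_gens_def proj_sets_def by blast
  then have *: "?A \<and> ?B \<and> ?C \<and> ?D"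
  proof cases
    case i
    show ?thesis unfolding i mem_Collect_eq upd_isl
      by (intro conjI separated_side boolgen_not boolgen_disj boolgen_conj boolgen_const du_gens_isl)
  next
    case l
    have 0: "{e. sat ?G ((lft \<circ> e)(i := 0)) \<chi>} \<in> boolgen (du_gens :: (nat \<Rightarrow> 'h + real) set set)"
      by (rule boolgen_zero_at[OF plus_struct_group(1) l(2) du_gens_left])
    show ?thesis unfolding l(1) mem_Collect_eq upd_proj
      using l(2) by (intro conjI separated_formula separated_side[OF 0] separated_side[OF boolgen_not[OF 0]]
          separated_formula[of ?G "Neg \<chi>", unfolded sat.simps]) simp_all
  next
    case r
    have 0: "{e. sat ?R ((rgt \<circ> e)(i := 0)) \<chi>} \<in> boolgen (du_gens :: (nat \<Rightarrow> 'h + real) set set)"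
      by (rule boolgen_zero_at[OF plus_struct_group(2) r(2) du_gens_right])
    show ?thesis unfolding r(1) mem_Collect_eq upd_proj
      using r(2) by (intro conjI separated_formula separated_side[OF 0] separated_side[OF boolgen_not[OF 0]]
          separated_formula[of ?R "Neg \<chi>", unfolded sat.simps]) simp_all
  qed
  show ?A by (rule *[THEN conjunct1])
  show ?B by (rule *[THEN conjunct2, THEN conjunct1])
  show ?C by (rule *[THEN conjunct2, THEN conjunct2, THEN conjunct1])
  show ?D by (rule *[THEN conjunct2, THEN conjunct2, THEN conjunct2])
qed

lemma du_exists:
  fixes E :: "(nat \<Rightarrow> 'h :: linordered_ab_group_add + real) set"
  assumes "E \<in> boolgen du_gens"
  shows "{e. \<exists>z. e(i := z) \<in> E} \<in> boolgen du_gens"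
proof (rule boolgen_exists[OF _ assms])
  fix P Q :: "(nat \<Rightarrow> 'h + real) set set"
  assume PQ: "finite P" "finite Q" "P \<subseteq> du_gens" "Q \<subseteq> du_gens"
  have "{e. \<exists>z. (\<forall>X\<in>P. e(i := z) \<in> X) \<and> (\<forall>X\<in>Q. e(i := z) \<notin> X)} =
    {e. (\<exists>a. (\<forall>X\<in>P. e(i := Inl a) \<in> X) \<and> (\<forall>X\<in>Q. e(i := Inl a) \<notin> X)) \<or>
      (\<exists>b. (\<forall>X\<in>P. e(i := Inr b) \<in> X) \<and> (\<forall>X\<in>Q. e(i := Inr b) \<notin> X))}"
    by (simp only: split_sum_ex)
  also have "\<dots> \<in> boolgen du_gens"
  proof (rule boolgen_disj)
    show "{e. \<exists>a. (\<forall>X\<in>P. e(i := Inl a) \<in> X) \<and> (\<forall>X\<in>Q. e(i := Inl a) \<notin> X)} \<in> boolgen du_gens"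
    proof (rule separated_exists[OF separated_conj[OF separated_ball[OF PQ(1)] separated_ball[OF PQ(2)]]
          group_universe(1) du_gens_left])
    qed (use PQ(3,4) in \<open>auto intro: du_literal_separated(1) du_literal_separated(2)\<close>)
    show "{e. \<exists>a. (\<forall>X\<in>P. e(i := Inr a) \<in> X) \<and> (\<forall>X\<in>Q. e(i := Inr a) \<notin> X)} \<in> boolgen du_gens"
    proof (rule separated_exists[OF separated_conj[OF separated_ball[OF PQ(1)] separated_ball[OF PQ(2)]]
          group_universe(2) du_gens_right])
    qed (use PQ(3,4) in \<open>auto intro: du_literal_separated(3) du_literal_separated(4)\<close>)
  qed
  finally show "{e. \<exists>z. (\<forall>X\<in>P. e(i := z) \<in> X) \<and> (\<forall>X\<in>Q. e(i := z) \<notin> X)} \<in> boolgen du_gens" .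
qed

lemma zero_definable_renamed:
  assumes "zero_definable M n X" "universe M = UNIV"
  obtains \<chi> where "is_formula (lang M) \<chi>" "\<And>e. map (\<lambda>j. e (h j)) [0..<n] \<in> X \<longleftrightarrow> sat M e \<chi>"
proof -
  obtain \<phi> d where \<phi>: "is_formula (lang M) \<phi>" "d ` (fv \<phi> - {..<n}) \<subseteq> {}"
      "X = {xs \<in> tuples M n. sat M (\<lambda>i. if i < n then xs ! i else d i) \<phi>}"
    using assms(1) unfolding definable_over_def by blast
  have "map (\<lambda>j. e (h j)) [0..<n] \<in> X \<longleftrightarrow> sat M e (ren h \<phi>)" for e
  proof -
    have "sat M (\<lambda>i. if i < n then map (\<lambda>j. e (h j)) [0..<n] ! i else d i) \<phi> \<longleftrightarrow> sat M (e \<circ> h) \<phi>"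
      by (rule sat_cong) (use \<phi>(2) in auto)
    then show ?thesis using assms(2) by (simp add: \<phi>(3) tuples_def sat_ren)
  qed
  then show thesis using that \<phi>(1) is_formula_ren by blast
qed

lemma du_sat_boolgen:
  "is_formula (lang (group_reals :: (_, _, 'h :: linordered_ab_group_add + real) struct)) \<phi> \<Longrightarrow>
    {e. sat (group_reals :: (_, _, 'h + real) struct) e \<phi>} \<in> boolgen du_gens"
proof (induction \<phi>)
  case (Eq s t)
  let ?G = "group_struct :: (_, _, 'h) struct" and ?R = "ordered_group_struct :: (_, _, real) struct"
  obtain i j where st: "s = Var i" "t = Var j"
    using Eq by (cases s; cases t) (auto simp: disjoint_union_simps)
  have "e i = e j \<longleftrightarrow> isl (e i) \<and> isl (e j) \<and> sat ?G (lft \<circ> e) (Eq (Var i) (Var j)) \<or>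
      \<not> isl (e i) \<and> \<not> isl (e j) \<and> sat ?R (rgt \<circ> e) (Eq (Var i) (Var j))" for e :: "nat \<Rightarrow> 'h + real"
    by (cases "e i"; cases "e j") auto
  then have "{e. sat (group_reals :: (_, _, 'h + real) struct) e (Eq s t)} =
      {e. isl (e i) \<and> isl (e j) \<and> sat ?G (lft \<circ> e) (Eq (Var i) (Var j)) \<or>
      \<not> isl (e i) \<and> \<not> isl (e j) \<and> sat ?R (rgt \<circ> e) (Eq (Var i) (Var j))}" by (simp add: st)
  also have "\<dots> \<in> boolgen du_gens"
    by (intro boolgen_disj boolgen_conj boolgen_not du_gens_isl du_gens_left du_gens_right) simp_all
  finally show ?case .
next
  case (Rel p ts)
  let ?G = "group_struct :: (_, _, 'h) struct" and ?R = "ordered_group_struct :: (_, _, real) struct"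
  let ?M = "group_reals :: (_, _, 'h + real) struct"
  define n where "n = length ts"
  have pn: "(p, n) \<in> Rels (lang ?M)" using Rel by (simp add: n_def)
  have "\<forall>t\<in>set ts. \<exists>i. t = Var i"
  proof
    fix t assume "t \<in> set ts"
    then have "is_term (lang ?M) t" using Rel by (auto simp: list_all_iff)
    then show "\<exists>i. t = Var i" by (cases t) (auto simp: disjoint_union_simps)
  qed
  from bchoice[OF this] obtain vi where vi: "\<forall>t\<in>set ts. t = Var (vi t)" ..
  define h where "h j = vi (ts ! j)" for j
  have vals: "map (tm_val ?M e) ts = map (\<lambda>j. e (h j)) [0..<n]" for e
  proof (rule nth_equalityI)
    fix j assume "j < length (map (tm_val ?M e) ts)"
    then have "j < n" "ts ! j = Var (h j)" using vi by (auto simp: n_def h_def)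
    then show "map (tm_val ?M e) ts ! j = map (\<lambda>j. e (h j)) [0..<n] ! j" by (simp add: n_def)
  qed (simp add: n_def)
  show ?case
  proof (cases p)
    case In_Left
    then have "n = 1" using pn by (simp add: disjoint_union_simps)
    then have "sat ?M e (Rel p ts) \<longleftrightarrow> isl (e (h 0))" for e
      unfolding sat.simps vals by (cases "e (h 0)") (auto simp: In_Left disjoint_union_def group_universe)
    then show ?thesis using du_gens_isl by simp
  next
    case In_Right
    then have "n = 1" using pn by (simp add: disjoint_union_simps)
    then have "sat ?M e (Rel p ts) \<longleftrightarrow> \<not> isl (e (h 0))" for e
      unfolding sat.simps vals by (cases "e (h 0)") (auto simp: In_Right disjoint_union_def group_universe)
    then show ?thesis using boolgen_not[OF du_gens_isl] by simp
  next
    case (Rel_Left X)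
    then have "zero_definable ?G n X" using pn by (simp add: disjoint_union_simps)
    then obtain \<chi> where \<chi>: "is_formula (lang ?G) \<chi>" "\<And>e. map (\<lambda>j. e (h j)) [0..<n] \<in> X \<longleftrightarrow> sat ?G e \<chi>"
      by (rule zero_definable_renamed[OF _ group_universe(1), of n X h]) (rule that)
    have "sat ?M e (Rel p ts) \<longleftrightarrow> (\<forall>j\<in>{..<n}. isl (e (h j))) \<and> sat ?G (lft \<circ> e) \<chi>" for e
    proof -
      have "map (\<lambda>j. e (h j)) [0..<n] \<in> map Inl ` X \<longleftrightarrow>
          (\<forall>j\<in>{..<n}. isl (e (h j))) \<and> map (\<lambda>j. (lft \<circ> e) (h j)) [0..<n] \<in> X" (is "?l \<longleftrightarrow> ?i \<and> ?r")
      proof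
        assume ?l
        then obtain xs where xs: "xs \<in> X" "map (\<lambda>j. e (h j)) [0..<n] = map Inl xs" by blast
        have len: "length xs = n" using arg_cong[OF xs(2), of length] by simp
        have nth: "e (h j) = Inl (xs ! j)" if "j < n" for j
          using arg_cong[OF xs(2), of "\<lambda>l. l ! j"] that len by simp
        have "map (\<lambda>j. (lft \<circ> e) (h j)) [0..<n] = xs"
          by (rule nth_equalityI) (use nth len in auto)
        then show "?i \<and> ?r" using nth xs(1) by auto
      next
        assume ir: "?i \<and> ?r"
        have "map (\<lambda>j. e (h j)) [0..<n] = map Inl (map (\<lambda>j. (lft \<circ> e) (h j)) [0..<n])"
        proof (rule nth_equalityI)
          fix j assume "j < length (map (\<lambda>j. e (h j)) [0..<n])"
          then have "j < n" "isl (e (h j))" using ir by auto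
          then show "map (\<lambda>j. e (h j)) [0..<n] ! j = map Inl (map (\<lambda>j. (lft \<circ> e) (h j)) [0..<n]) ! j"
            by (cases "e (h j)") auto
        qed simp
        then show ?l using ir by blast
      qed
      then show ?thesis unfolding sat.simps vals \<chi>(2) by (simp add: Rel_Left disjoint_union_def)
    qed
    then have "{e. sat ?M e (Rel p ts)} = {e. (\<forall>j\<in>{..<n}. isl (e (h j))) \<and> sat ?G (lft \<circ> e) \<chi>}" by simp
    also have "\<dots> \<in> boolgen du_gens"
      by (intro boolgen_conj boolgen_ball du_gens_isl du_gens_left \<chi>(1)) simp
    finally show ?thesis .
  next
    case (Rel_Right X)
    then have "zero_definable ?R n X" using pn by (simp add: disjoint_union_simps)
    then obtain \<chi> where \<chi>: "is_formula (lang ?R) \<chi>" "\<And>e. map (\<lambda>j. e (h j)) [0..<n] \<in> X \<longleftrightarrow> sat ?R e \<chi>"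
      by (rule zero_definable_renamed[OF _ group_universe(2), of n X h]) (rule that)
    have "sat ?M e (Rel p ts) \<longleftrightarrow> (\<forall>j\<in>{..<n}. \<not> isl (e (h j))) \<and> sat ?R (rgt \<circ> e) \<chi>" for e
    proof -
      have "map (\<lambda>j. e (h j)) [0..<n] \<in> map Inr ` X \<longleftrightarrow>
          (\<forall>j\<in>{..<n}. \<not> isl (e (h j))) \<and> map (\<lambda>j. (rgt \<circ> e) (h j)) [0..<n] \<in> X" (is "?l \<longleftrightarrow> ?i \<and> ?r")
      proof
        assume ?l
        then obtain xs where xs: "xs \<in> X" "map (\<lambda>j. e (h j)) [0..<n] = map Inr xs" by blast
        have len: "length xs = n" using arg_cong[OF xs(2), of length] by simp
        have nth: "e (h j) = Inr (xs ! j)" if "j < n" for j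
          using arg_cong[OF xs(2), of "\<lambda>l. l ! j"] that len by simp
        have "map (\<lambda>j. (rgt \<circ> e) (h j)) [0..<n] = xs"
          by (rule nth_equalityI) (use nth len in auto)
        then show "?i \<and> ?r" using nth xs(1) by auto
      next
        assume ir: "?i \<and> ?r"
        have "map (\<lambda>j. e (h j)) [0..<n] = map Inr (map (\<lambda>j. (rgt \<circ> e) (h j)) [0..<n])"
        proof (rule nth_equalityI)
          fix j assume "j < length (map (\<lambda>j. e (h j)) [0..<n])"
          then have "j < n" "\<not> isl (e (h j))" using ir by auto
          then show "map (\<lambda>j. e (h j)) [0..<n] ! j = map Inr (map (\<lambda>j. (rgt \<circ> e) (h j)) [0..<n]) ! j"
            by (cases "e (h j)") auto
        qed simp
        then show ?l using ir by blast
      qed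
      then show ?thesis unfolding sat.simps vals \<chi>(2) by (simp add: Rel_Right disjoint_union_def)
    qed
    then have "{e. sat ?M e (Rel p ts)} = {e. (\<forall>j\<in>{..<n}. \<not> isl (e (h j))) \<and> sat ?R (rgt \<circ> e) \<chi>}" by simp
    also have "\<dots> \<in> boolgen du_gens"
      by (intro boolgen_conj boolgen_ball boolgen_not du_gens_isl du_gens_right \<chi>(1)) simp
    finally show ?thesis .
  qed
next
  case (Neg \<phi>)
  then show ?case by (simp add: boolgen_not)
next
  case (Conj \<phi> \<psi>)
  then show ?case by (simp add: boolgen_conj)
next
  case (Ex i \<phi>)
  let ?M = "group_reals :: (_, _, 'h + real) struct"
  have "{e. \<exists>z. e(i := z) \<in> {e. sat ?M e \<phi>}} \<in> boolgen du_gens"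
    using Ex by (intro du_exists) auto
  moreover have "universe ?M = UNIV" by (simp add: disjoint_union_simps group_universe)
  ultimately show ?case by simp
qed

lemma zmul_real: "zmul n (x :: real) = of_int n * x"
  by (induction n rule: int_induct[where k = 0]) (simp_all add: zmul_succ zmul_pred algebra_simps)

text \<open>By divisibility the remainder can be made \<open>0\<close>. Thus the elimination for
  regular chains also covers the real component.\<close>

lemma regular_chain_real: "regular_chain {{0}, UNIV :: real set}"
proof
  show "convex_subgroup C" if "C \<in> {{0}, UNIV :: real set}" for C
    using that by (auto simp: convex_subgroup_def)
  fix C C' :: "real set" and a b :: real and n :: int
  assume "0 < b" "0 < n"
  then have "0 \<le> zmul n b" by (intro zmul_nonneg) auto
  moreover have "a - zmul n (a / of_int n) = 0" using \<open>0 < n\<close> by (simp add: zmul_real)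
  ultimately show "\<exists>g. - zmul n b \<le> a - zmul n g \<and> a - zmul n g \<le> zmul n b" by (intro exI[of _ "a / of_int n"]) simp
qed auto

text \<open>Formulas of the group stay whole, since group elements will be coded by themselves; only
  the real side has to be reduced to signs of affine functions.\<close>

definition du_atoms :: "(nat \<Rightarrow> 'h :: linordered_ab_group_add + real) set set" where
  "du_atoms = {{e. isl (e i)} | i. True} \<union> proj_sets (group_struct :: (_, _, 'h) struct) lft \<union>
    {{e. 0 < f (rgt \<circ> e)} | f. affine f}"

lemma du_gens_atoms: "(du_gens :: (nat \<Rightarrow> 'h :: linordered_ab_group_add + real) set set) \<subseteq> boolgen du_atoms"
proof
  interpret regular_chain "{{0}, UNIV :: real set}" by (rule regular_chain_real)
  fix X :: "(nat \<Rightarrow> 'h + real) set" assume "X \<in> du_gens"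
  then consider "X \<in> {{e. isl (e i)} | i. True} \<union> proj_sets (group_struct :: (_, _, 'h) struct) lft"
    | \<chi> where "X = {e. sat (ordered_group_struct :: (_, _, real) struct) (rgt \<circ> e) \<chi>}"
      "is_formula (lang (ordered_group_struct :: (_, _, real) struct)) \<chi>"
    unfolding du_gens_def proj_sets_def[of ordered_group_struct] by blast
  then show "X \<in> boolgen du_atoms"
  proof cases
    case 1
    then show ?thesis by (intro boolgen_gen) (auto simp: du_atoms_def)
  next
    case 2
    have "{e. rgt \<circ> e \<in> Y} \<in> boolgen (du_atoms :: (nat \<Rightarrow> 'h + real) set set)" if "Y \<in> atoms" for Y
    proof -
      \<comment> \<open>The reals are divisible, so congruences with positive modulus are
        vacuous.\<close>
      have cng: "cng C k = (UNIV :: real set)" if "C \<in> {{0}, UNIV}" "0 < k" for C k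
      proof -
        have "x \<in> cng C k" for x
          using that by (intro cngI[of _ _ "x / of_int k"]) (auto simp: zmul_real)
        then show ?thesis by blast
      qed
      obtain C f where "affine f" "C \<in> {{0}, UNIV}" "Y = {e. gt C (f e)} \<or> (\<exists>k>0. Y = {e. f e \<in> cng C k})"
        using \<open>Y \<in> atoms\<close> unfolding atoms_def by (elim UnE CollectE exE conjE) metis+
      then consider "Y = {e. 0 < f e}" "affine f" | "Y = {}" | "Y = UNIV" using cng by (auto simp: gt_def)
      then show ?thesis
      proof cases
        case 1
        then show ?thesis by (intro boolgen_gen) (auto simp: du_atoms_def)
      next
        case 2
        then show ?thesis using boolgen_const[of False] by simp
      next
        case 3
        then show ?thesis using boolgen_const[of True] by simp
      qed
    qed
    then have "(\<lambda>Y. {e. rgt \<circ> e \<in> Y}) ` atoms \<subseteq> boolgen (du_atoms :: (nat \<Rightarrow> 'h + real) set set)" by blast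
    from boolgen_mono[OF this boolgen_vimage[OF sat_boolgen[OF 2(2)]]] show ?thesis by (simp add: 2(1))
  qed
qed

lemma sat_group_formula:
  fixes e :: "nat \<Rightarrow> 'h :: linordered_ab_group_add"
  assumes "is_formula (lang (group_struct :: (_, _, 'h) struct)) \<chi>"
  shows "sat ordered_group_struct e \<chi> \<longleftrightarrow> sat group_struct e \<chi>"
    "is_formula (lang (ordered_group_struct :: (_, _, 'h) struct)) \<chi>"
proof -
  have tm: "tm_val (ordered_group_struct :: (_, _, 'h) struct) e t = tm_val group_struct e t" for e t
    by (induction t) (auto simp: group_struct_def ordered_group_struct_def cong: map_cong)
  show "sat ordered_group_struct e \<chi> \<longleftrightarrow> sat group_struct e \<chi>"
    using assms by (induction \<chi> arbitrary: e) (auto simp: tm group_universe group_lang)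
  have "is_term (lang (group_struct :: (_, _, 'h) struct)) t = is_term (lang (ordered_group_struct :: (_, _, 'h) struct)) t" for t
    by (induction t) (auto simp: group_lang list_all_iff)
  then show "is_formula (lang (ordered_group_struct :: (_, _, 'h) struct)) \<chi>"
    using assms by (induction \<chi>) (auto simp: group_lang)
qed

text \<open>Formulas of the group are carried over by renaming variables; only the real numbers
  require a local map, whose values are multiples of the positive element \<open>h0\<close>.\<close>

theorem translates_disjoint_union:
  fixes h0 :: "'h :: linordered_ab_group_add"
  assumes h0: "0 < h0"
  shows "\<exists>\<psi> cst. locally_translates (ordered_group_struct :: (_, _, 'h) struct) (group_reals :: (_, _, 'h + real) struct) 3 \<psi> cst"
proof -
  let ?A = "group_reals :: (_, _, 'h + real) struct"
  let ?B = "ordered_group_struct :: (_, _, 'h) struct"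
  let ?G = "group_struct :: (_, _, 'h) struct"
  define traces where "traces I \<rho> \<longleftrightarrow> (\<exists>F. subgrp F \<and> I \<subseteq> F \<and> additive_on F \<rho> \<and> (\<forall>t\<in>I. 0 < t \<longleftrightarrow> 0 < \<rho> t))"
    for I and \<rho> :: "real \<Rightarrow> 'h"
  \<comment> \<open>The tag is \<open>0\<close> on the left and \<open>h0\<close> on the right, so
    the side is tested by the equation \<open>x + x = x\<close>.\<close>
  define code where "code \<rho> x j = (if j = 0 then if isl x then 0 else h0 else if j = 1 then lft x else \<rho> (rgt x))"
    for \<rho> :: "real \<Rightarrow> 'h" and x and j :: nat
  define good where "good I \<kappa> \<longleftrightarrow> (\<exists>\<rho>. traces I \<rho> \<and> \<kappa> = code \<rho>)" for I \<kappa>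
  show ?thesis
  proof (rule locally_translates_boolgen[of good ?B ?A du_atoms])
    fix I J :: "real set" and \<kappa> assume g: "good J \<kappa>" and IJ: "I \<subseteq> J"
    from g obtain \<rho> F where \<rho>: "\<kappa> = code \<rho>"
      and F: "subgrp F" "J \<subseteq> F" "additive_on F \<rho>" "\<forall>t\<in>J. 0 < t \<longleftrightarrow> 0 < \<rho> t"
      unfolding good_def traces_def by (elim exE conjE)
    have "traces I \<rho>" unfolding traces_def
    proof (intro exI[of _ F] conjI ballI)
      show "I \<subseteq> F" using IJ F(2) by (rule subset_trans)
      show "0 < t \<longleftrightarrow> 0 < \<rho> t" if "t \<in> I" for t by (rule bspec[OF F(4) subsetD[OF IJ that]])
    qed (fact F)+
    with \<rho> show "good I \<kappa>" unfolding good_def by blast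
  next
    fix I :: "real set" assume I: "finite I"
    have C: "convex_subgroup {0 :: real}" by (auto simp: convex_subgroup_def)
    obtain F and \<sigma> :: "real \<Rightarrow> real" and \<rho> :: "real \<Rightarrow> 'h" where
      "subgrp F \<and> I \<subseteq> F \<and> additive_on F \<sigma> \<and> additive_on F \<rho> \<and>
      (\<forall>t\<in>I. gt {0} t \<longleftrightarrow> 0 < \<rho> t) \<and> (\<forall>t\<in>I. \<forall>k\<in>({} :: int set). t \<in> cng {0} k \<longleftrightarrow> \<sigma> t \<in> cng {0} k)"
      using ex_local_coordinates[OF C I finite.emptyI h0] by (elim exE)
    then have "traces I \<rho>" unfolding traces_def by (intro exI[of _ F]) (simp add: gt_def)
    then show "\<exists>\<kappa>. good I \<kappa> \<and> (\<forall>a j. \<kappa> a j \<in> universe ?B)"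
      unfolding good_def by (auto simp: group_universe)
  next
    fix \<phi> assume "is_formula (lang ?A) \<phi>"
    from boolgen_mono[OF du_gens_atoms du_sat_boolgen[OF this]] show "{e. sat ?A e \<phi>} \<in> boolgen du_atoms" .
  next
    fix S0 :: "(nat \<Rightarrow> 'h + real) set set" and V :: "nat set"
    assume S0: "finite S0" "S0 \<subseteq> du_atoms" and V: "finite V"
    define lin where "lin X f \<longleftrightarrow> affine f \<and> X = {e. 0 < f (rgt \<circ> e)}" for X :: "(nat \<Rightarrow> 'h + real) set" and f
    \<comment> \<open>An atom may have several affine descriptions; one is fixed, which leaves
      finitely many constant terms to be stored.\<close>
    define fx where "fx X = (SOME f. lin X f)" for X
    have fx: "lin X (fx X)" if "lin X f" for X f unfolding fx_def by (rule someI[of "lin X", OF that])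
    define \<F> where "\<F> = fx ` {X\<in>S0. \<exists>f. lin X f}"
    have "\<exists>cst. \<forall>f\<in>\<F>. \<exists>n N. \<forall>e. f (\<lambda>i. if i \<in> V then e i else cst i) =
        (\<Sum>i<N. zmul (n i) (if i \<in> V then e i else cst i))"
      by (rule constants_as_variables) (use S0(1) V fx in \<open>auto simp: \<F>_def lin_def\<close>)
    then obtain cst where cst: "\<forall>f\<in>\<F>. \<exists>n N. \<forall>e. f (\<lambda>i. if i \<in> V then e i else cst i) =
        (\<Sum>i<N. zmul (n i) (if i \<in> V then e i else cst i))" ..
    \<comment> \<open>The stored constants belong to affine functions on the reals, hence
      \<open>Inr\<close>.\<close>
    have "\<exists>lf info. is_formula (lang ?B) lf \<and> (\<forall>e. finite (info e)) \<and> (\<forall>e \<kappa>. good (info e) \<kappa> \<longrightarrow>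
        ((\<lambda>i. if i \<in> V then e i else Inr (cst i)) \<in> X \<longleftrightarrow>
          sat ?B (block_env 3 \<kappa> (\<lambda>i. if i \<in> V then e i else Inr (cst i))) lf))" if X: "X \<in> S0" for X
    proof -
      let ?e = "\<lambda>e i. if i \<in> V then e i else Inr (cst i)"
      have blk: "block_env 3 (code \<rho>) d (3 * i + l) = code \<rho> (d i) l" if "l < 3" for \<rho> d i l
        using that by (simp add: block_env_def)
      consider (i) i where "X = {e. isl (e i)}"
        | (l) \<chi> where "X = {e. sat ?G (lft \<circ> e) \<chi>}" "is_formula (lang ?G) \<chi>"
        | (r) f where "lin X f"
        using X S0(2) unfolding du_atoms_def proj_sets_def lin_def by blast
      then show ?thesis
      proof cases
        case (i i)
        let ?lf = "Eq (Fn Plus [Var (3 * i + 0), Var (3 * i + 0)]) (Var (3 * i + 0)) :: (group_fun, order_rel) fm"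
        have "is_formula (lang ?B) ?lf" by (simp add: group_lang)
        moreover have "?e e \<in> X \<longleftrightarrow> sat ?B (block_env 3 \<kappa> (?e e)) ?lf" if g: "good {} \<kappa>" for e \<kappa>
        proof -
          obtain \<rho> where \<rho>: "\<kappa> = code \<rho>" using g by (auto simp: good_def)
          have "sat ?B (block_env 3 \<kappa> (?e e)) ?lf \<longleftrightarrow> code \<rho> (?e e i) 0 = 0"
            unfolding \<rho> sat.simps tm_val.simps list.map blk[OF zero_less_numeral] by (simp add: ordered_group_struct_def)
          also have "\<dots> \<longleftrightarrow> isl (?e e i)" using less_imp_neq[OF h0] by (simp add: code_def)
          finally show ?thesis by (simp add: i)
        qed
        ultimately show ?thesis by (intro exI[of _ ?lf] exI[of _ "\<lambda>_. {}"]) blast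
      next
        case l
        let ?lf = "ren (\<lambda>i. 3 * i + 1) \<chi>"
        have "is_formula (lang ?B) ?lf" using sat_group_formula(2)[OF l(2)] by (simp add: is_formula_ren)
        moreover have "?e e \<in> X \<longleftrightarrow> sat ?B (block_env 3 \<kappa> (?e e)) ?lf" if g: "good {} \<kappa>" for e \<kappa>
        proof -
          obtain \<rho> where \<rho>: "\<kappa> = code \<rho>" using g by (auto simp: good_def)
          have "block_env 3 \<kappa> (?e e) \<circ> (\<lambda>i. 3 * i + 1) = lft \<circ> ?e e"
          proof
            fix i show "(block_env 3 \<kappa> (?e e) \<circ> (\<lambda>i. 3 * i + 1)) i = (lft \<circ> ?e e) i"
              unfolding \<rho> comp_apply by (subst blk) (simp_all add: code_def)
          qed
          then show ?thesis unfolding sat_ren l(1) mem_Collect_eq using sat_group_formula(1)[OF l(2)] by simp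
        qed
        ultimately show ?thesis by (intro exI[of _ ?lf] exI[of _ "\<lambda>_. {}"]) blast
      next
        case r
        then have fX: "lin X (fx X)" by (rule fx)
        have "fx X \<in> \<F>" using X r by (auto simp: \<F>_def)
        then obtain n N where nN: "\<And>e. fx X (\<lambda>i. if i \<in> V then e i else cst i) =
            (\<Sum>i<N. zmul (n i) (if i \<in> V then e i else cst i))" using cst by blast
        have re: "rgt \<circ> ?e e = (\<lambda>i. if i \<in> V then (rgt \<circ> e) i else cst i)" for e :: "nat \<Rightarrow> 'h + real" by auto
        have nN': "fx X (rgt \<circ> ?e e) = (\<Sum>i<N. zmul (n i) (rgt (?e e i)))" for e :: "nat \<Rightarrow> 'h + real"
          using nN[of "rgt \<circ> e"] unfolding re by (auto intro!: sum.cong)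
        define info where "info e = insert (fx X (rgt \<circ> ?e e)) ((\<lambda>i. rgt (?e e i)) ` {..<N})" for e :: "nat \<Rightarrow> 'h + real"
        let ?lf = "ren (\<lambda>i. 3 * i + 2) (lin_gt n N)"
        have "is_formula (lang ?B) ?lf" by (simp add: is_formula_ren is_formula_lin group_lang)
        moreover have "?e e \<in> X \<longleftrightarrow> sat ?B (block_env 3 \<kappa> (?e e)) ?lf" if "good (info e) \<kappa>" for e \<kappa>
        proof -
          obtain \<rho> F where \<rho>: "\<kappa> = code \<rho>" and F: "subgrp F" "info e \<subseteq> F" "additive_on F \<rho>" "\<forall>t\<in>info e. 0 < t \<longleftrightarrow> 0 < \<rho> t"
            using \<open>good (info e) \<kappa>\<close> unfolding good_def traces_def by blast
          have "?e e \<in> X \<longleftrightarrow> 0 < fx X (rgt \<circ> ?e e)" using fX unfolding lin_def by blast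
          also have "\<dots> \<longleftrightarrow> 0 < \<rho> (fx X (rgt \<circ> ?e e))" by (rule bspec[OF F(4)]) (simp add: info_def)
          also have "\<rho> (fx X (rgt \<circ> ?e e)) = (\<Sum>i<N. zmul (n i) (\<rho> (rgt (?e e i))))"
            unfolding nN' by (rule additive_on_lin[OF F(3,1)], rule subsetD[OF F(2)]) (simp add: info_def)
          also have "\<dots> = (\<Sum>i<N. zmul (n i) ((block_env 3 \<kappa> (?e e) \<circ> (\<lambda>i. 3 * i + 2)) i))"
            unfolding \<rho> comp_apply by (rule sum.cong, rule refl, subst blk) (simp_all add: code_def)
          also have "0 < \<dots> \<longleftrightarrow> sat ?B (block_env 3 \<kappa> (?e e)) ?lf" unfolding sat_ren sat_lin_gt ..
          finally show ?thesis .
        qed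
        moreover have "finite (info e)" for e by (simp add: info_def)
        ultimately show ?thesis by (intro exI[of _ ?lf] exI[of _ info]) blast
      qed
    qed
    then show "\<exists>cst. \<forall>X\<in>S0. \<exists>lf info. is_formula (lang ?B) lf \<and> (\<forall>e. finite (info e)) \<and>
      (\<forall>e \<kappa>. good (info e) \<kappa> \<longrightarrow> ((\<lambda>i. if i \<in> V then e i else cst i) \<in> X \<longleftrightarrow>
          sat ?B (block_env 3 \<kappa> (\<lambda>i. if i \<in> V then e i else cst i)) lf))"
      by (intro exI[of _ "\<lambda>i. Inr (cst i)"] ballI)
  qed
qed

section \<open>Regularity of the chain, and conclusion\<close>

section \<open>Regularity of the definable convex subgroups\<close>

lemma definable_subset:
  fixes \<phi> :: "(group_fun, order_rel) fm" and a :: "'h :: linordered_ab_group_add"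
  assumes "is_formula (lang (ordered_group_struct :: (_, _, 'h) struct)) \<phi>"
    and "\<And>x. x \<in> C \<longleftrightarrow> sat ordered_group_struct ((\<lambda>_. a)(0 := x)) \<phi>"
  shows "definable (ordered_group_struct :: (_, _, 'h) struct) 1 ((\<lambda>x. [x]) ` C)"
  unfolding definable_over_def
proof (intro exI[of _ \<phi>] exI[of _ "\<lambda>_. a"] conjI assms(1))
  let ?M = "ordered_group_struct :: (_, _, 'h) struct"
  have "sat ?M (\<lambda>i. if i < 1 then [x] ! i else a) \<phi> \<longleftrightarrow> x \<in> C" for x
    unfolding assms(2) by (rule sat_cong) auto
  then have "xs \<in> tuples ?M 1 \<and> sat ?M (\<lambda>i. if i < 1 then xs ! i else a) \<phi> \<longleftrightarrow> xs \<in> (\<lambda>x. [x]) ` C" for xs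
    by (cases xs; cases "tl xs") (auto simp: tuples_def group_universe)
  then show "(\<lambda>x. [x]) ` C = {xs \<in> tuples ?M 1. sat ?M (\<lambda>i. if i < 1 then xs ! i else a) \<phi>}" by blast
qed (simp add: group_universe)

lemma trivial_definable_convex_subgroups:
  "{0} \<in> (definable_convex_subgroups :: 'h :: linordered_ab_group_add set set)"
  "UNIV \<in> (definable_convex_subgroups :: 'h set set)"
proof -
  have "definable (ordered_group_struct :: (_, _, 'h) struct) 1 ((\<lambda>x. [x]) ` {0})"
    by (rule definable_subset[of "Eq (Fn Plus [Var 0, Var 0]) (Var 0)" _ 0]) (simp_all add: ordered_group_struct_def)
  then show "{0} \<in> (definable_convex_subgroups :: 'h set set)"
    by (auto simp: definable_convex_subgroups_def convex_subgroup_def)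
  have "definable (ordered_group_struct :: (_, _, 'h) struct) 1 ((\<lambda>x. [x]) ` UNIV)"
    by (rule definable_subset[of "Eq (Var 0) (Var 0)" _ 0]) simp_all
  then show "UNIV \<in> (definable_convex_subgroups :: 'h set set)"
    by (auto simp: definable_convex_subgroups_def convex_subgroup_def)
qed

text \<open>For positive \<open>n\<close> and \<open>b\<close> this says that \<open>a\<close> lies
  in \<open>n H\<close> plus the convex subgroup generated by \<open>b\<close>: by
  \<open>near_multiple_double\<close> the bound \<open>n b\<close> may be replaced by larger
  multiples of \<open>b\<close>.\<close>

definition near_multiple :: "int \<Rightarrow> 'h :: linordered_ab_group_add \<Rightarrow> 'h \<Rightarrow> bool" where
  "near_multiple n a b \<longleftrightarrow> (\<exists>g. - zmul n b \<le> a - zmul n g \<and> a - zmul n g \<le> zmul n b)"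

text \<open>The largest convex subgroup \<open>E\<close> with \<open>a \<notin> E + n H\<close>.\<close>

definition far_subgroup :: "int \<Rightarrow> 'h :: linordered_ab_group_add \<Rightarrow> 'h set" where
  "far_subgroup n a = {b. \<not> near_multiple n a b \<and> \<not> near_multiple n a (- b)}"

lemma far_subgroup_definable:
  fixes a :: "'h :: linordered_ab_group_add"
  shows "definable (ordered_group_struct :: (_, _, 'h) struct) 1 ((\<lambda>x. [x]) ` far_subgroup n a)"
proof -
  \<comment> \<open>The coefficients of the variables \<open>0\<close>, \<open>1\<close> and
    \<open>2\<close>, which hold \<open>x\<close>, the element \<open>g\<close> and the parameter
    \<open>a\<close>.\<close>
  define c :: "int \<Rightarrow> int \<Rightarrow> int \<Rightarrow> nat \<Rightarrow> int" where "c p q r i = (if i = 0 then p else if i = 1 then q else r)" for p q r i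
  let ?F = "\<lambda>p q r. Neg (lin_gt (c p q r) 3)"
  \<comment> \<open>The value \<open>m = n\<close> tests \<open>x\<close> and \<open>m = - n\<close>
    tests \<open>- x\<close>; the coefficient of \<open>g\<close> is the same in both.\<close>
  let ?near = "\<lambda>m. Ex 1 (Conj (?F (- m) n (- 1)) (?F (- m) (- n) 1))"
  have val: "sat ordered_group_struct ((\<lambda>_. a)(0 := x, 1 := g)) (?F p q r) \<longleftrightarrow> zmul p x + zmul q g + zmul r a \<le> 0" for x g p q r
    by (simp add: sat_lin_gt not_less c_def eval_nat_numeral)
  have near: "sat ordered_group_struct ((\<lambda>_. a)(0 := x)) (?near m) \<longleftrightarrow>
      (\<exists>g. - zmul m x \<le> a - zmul n g \<and> a - zmul n g \<le> zmul m x)" for x m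
    unfolding sat.simps(4,5) val group_universe
    by (auto simp: algebra_simps zmul_minus_one)
  show ?thesis
  proof (rule definable_subset[of "Conj (Neg (?near n)) (Neg (?near (- n)))" _ a])
    show "x \<in> far_subgroup n a \<longleftrightarrow> sat ordered_group_struct ((\<lambda>_. a)(0 := x)) (Conj (Neg (?near n)) (Neg (?near (- n))))" for x
      unfolding sat.simps(3,4) near by (simp add: far_subgroup_def near_multiple_def)
  qed (simp add: is_formula_lin group_lang)
qed

lemma near_multiple_mono:
  assumes "0 < n" "b \<le> b'" "near_multiple n a b"
  shows "near_multiple n a b'"
  using assms(3) zmul_mono_right[of n b b'] assms(1,2) unfolding near_multiple_def
  by (meson less_imp_le neg_le_iff_le order_trans)

text \<open>Changing \<open>g\<close> by \<open>b\<close> in the direction of the remainder moves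
  the remainder by \<open>n b\<close>, back into the smaller interval. This is the reason for the
  bound \<open>n b\<close> instead of \<open>b\<close>, and it makes \<open>far_subgroup\<close>
  closed under addition.\<close>

lemma near_multiple_double:
  assumes n: "0 < n" and b: "near_multiple n a (b + b)"
  shows "near_multiple n a b"
proof -
  obtain g where g: "- zmul n (b + b) \<le> a - zmul n g" "a - zmul n g \<le> zmul n (b + b)"
    using b by (auto simp: near_multiple_def)
  show ?thesis
  proof (cases "0 \<le> a - zmul n g")
    case True
    have "a - zmul n (g + b) = a - zmul n g - zmul n b" by (simp add: zmul.scale_right_distrib algebra_simps)
    then show ?thesis unfolding near_multiple_def using True g(2)
      by (intro exI[of _ "g + b"]) (simp add: zmul.scale_right_distrib algebra_simps)
  next
    case False
    have "a - zmul n (g - b) = a - zmul n g + zmul n b" by (simp add: zmul.scale_right_diff_distrib algebra_simps)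
    then show ?thesis unfolding near_multiple_def using False g(1)
      by (intro exI[of _ "g - b"]) (simp add: zmul.scale_right_distrib algebra_simps)
  qed
qed

lemma far_subgroup_max:
  assumes "0 < n" shows "b \<in> far_subgroup n a \<longleftrightarrow> \<not> near_multiple n a (max b (- b))"
proof -
  have "near_multiple n a b \<Longrightarrow> near_multiple n a (max b (- b))"
    "near_multiple n a (- b) \<Longrightarrow> near_multiple n a (max b (- b))"
    by (rule near_multiple_mono[OF assms]; simp)+
  moreover have "max b (- b) = b \<or> max b (- b) = - b" by (simp add: max_def)
  ultimately show ?thesis unfolding far_subgroup_def mem_Collect_eq by metis
qed

text \<open>The element \<open>b\<close> excludes the empty set, which occurs exactly when
  \<open>a\<close> is in \<open>n H\<close>. The remaining work is with absolute values, on which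
  \<open>near_multiple\<close> is monotone.\<close>

lemma far_subgroup_convex:
  fixes a :: "'h :: linordered_ab_group_add"
  assumes n: "0 < n" and b: "b \<in> far_subgroup n a"
  shows "convex_subgroup (far_subgroup n a)"
proof -
  let ?m = "\<lambda>x :: 'h. max x (- x)"
  note iff = far_subgroup_max[OF n]
  have step: "y \<in> far_subgroup n a" if "?m y \<le> z" "\<not> near_multiple n a z" for y z
    using that near_multiple_mono[OF n that(1)] iff by blast
  have m0: "0 \<le> ?m x" for x :: 'h by (cases "0 \<le> x") (auto simp: le_max_iff_disj)
  show ?thesis
    unfolding convex_subgroup_def
  proof (intro conjI ballI allI impI)
    show "0 \<in> far_subgroup n a"
      by (rule step[of 0 "?m b"]) (use m0[of b] b iff in auto)
    show "- x \<in> far_subgroup n a" if "x \<in> far_subgroup n a" for x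
      using that by (auto simp: far_subgroup_def)
    fix x z assume x: "x \<in> far_subgroup n a" and z: "z \<in> far_subgroup n a"
    let ?M = "max (?m x) (?m z)"
    have "?M = ?m x \<or> ?M = ?m z" unfolding max_def[of "?m x" "?m z"] by simp
    then have M: "\<not> near_multiple n a ?M" using x z unfolding iff by metis
    have bounds: "x \<le> ?M" "- x \<le> ?M" "z \<le> ?M" "- z \<le> ?M" by (simp_all add: le_max_iff_disj)
    show "x + z \<in> far_subgroup n a"
    proof (rule step)
      show "\<not> near_multiple n a (?M + ?M)" using near_multiple_double[OF n] M by blast
      have "x + z \<le> ?M + ?M" "- x + - z \<le> ?M + ?M" by (intro add_mono bounds)+
      then show "?m (x + z) \<le> ?M + ?M" by (simp add: add.commute)
    qed
    fix y assume "x \<le> y \<and> y \<le> z"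
    then have "y \<le> ?M" "- y \<le> ?M" using bounds by (meson neg_le_iff_le order_trans)+
    then show "y \<in> far_subgroup n a" using M by (intro step[of y ?M]) simp_all
  qed
qed

theorem definable_convex_subgroups_regular:
  assumes fin: "finite (definable_convex_subgroups :: 'h :: linordered_ab_group_add set set)"
  shows "regular_chain (definable_convex_subgroups :: 'h set set)"
proof
  let ?C = "definable_convex_subgroups :: 'h set set"
  show conv: "convex_subgroup C" if "C \<in> ?C" for C using that by (simp add: definable_convex_subgroups_def)
  fix C C' :: "'h set" and a b and n :: int
  assume n: "next_in ?C C C'" and a: "a \<in> C'" and b: "0 < b" "b \<notin> C" and n0: "0 < n"
  show "\<exists>g. - zmul n b \<le> a - zmul n g \<and> a - zmul n g \<le> zmul n b"
  proof (rule ccontr)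
    assume "\<not> ?thesis"
    then have "\<not> near_multiple n a b" by (simp add: near_multiple_def)
    moreover have "max b (- b) = b"
      using b(1) by (intro max_absorb1) (meson less_imp_le neg_le_0_iff_le order_trans)
    ultimately have bE: "b \<in> far_subgroup n a" by (simp add: far_subgroup_max[OF n0])
    then have E: "far_subgroup n a \<in> ?C"
      using far_subgroup_convex[OF n0] far_subgroup_definable by (auto simp: definable_convex_subgroups_def)
    have "C \<in> ?C" using n by (simp add: next_in_def)
    then have "C \<subset> far_subgroup n a"
      using convex_subgroup_linear[OF conv conv, of C "far_subgroup n a"] E bE b(2) by auto
    then have "a \<in> far_subgroup n a" using n E a unfolding next_in_def by blast
    then have far: "\<not> near_multiple n a (max a (- a))" by (simp add: far_subgroup_max[OF n0])
    \<comment> \<open>With the absolute value of \<open>a\<close> as bound, \<open>g = 0\<close> is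
      near enough, so \<open>a\<close> never lies in its own \<open>far_subgroup\<close>.\<close>
    let ?m = "max a (- a)"
    have "0 \<le> ?m" by (cases "0 \<le> a") (auto simp: le_max_iff_disj)
    then have "?m \<le> zmul n ?m" using zmul_mono_left[of 1 n ?m] n0 by simp
    then have "a \<le> zmul n ?m" "- a \<le> zmul n ?m" by (meson max.cobounded1 max.cobounded2 order_trans)+
    then have "near_multiple n a ?m" unfolding near_multiple_def by (intro exI[of _ 0]) (simp add: minus_le_iff)
    with far show False ..
  qed
qed (fact fin trivial_definable_convex_subgroups)+

text \<open>An archimedean group has no convex subgroups besides the two trivial ones: multiples of
  one positive element of \<open>C\<close> exceed everything.\<close>

lemma archimedean_definable_convex_subgroups:
  assumes "archimedean_group TYPE('h :: linordered_ab_group_add)"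
  shows "finite (definable_convex_subgroups :: 'h set set)"
proof (rule finite_subset)
  show "definable_convex_subgroups \<subseteq> {{0}, UNIV :: 'h set}"
  proof
    fix C :: "'h set" assume "C \<in> definable_convex_subgroups"
    then have C: "convex_subgroup C" by (simp add: definable_convex_subgroups_def)
    note sC = convex_subgroup_subgrp[OF C]
    show "C \<in> {{0}, UNIV}"
    proof (cases "C = {0}")
      case False
      then obtain x where x: "x \<in> C" "x \<noteq> 0" using subgrp_0[OF sC] by blast
      define a where "a = max x (- x)"
      have a: "a \<in> C" "0 < a" using x subgrp_minus[OF sC x(1)]
        by (auto simp: a_def max_def not_le neg_less_0_iff_less)
      have pos: "b \<in> C" if b: "0 < b" for b
      proof -
        obtain n :: nat where "b < (\<Sum>i<n. a)" using assms a(2) b unfolding archimedean_group_def by blast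
        moreover have "(\<Sum>i<n. a) \<in> C" by (rule subgrp_sum[OF sC a(1)])
        ultimately show ?thesis using convex_subgroup_between[OF C subgrp_0[OF sC], of "\<Sum>i<n. a" b] b by simp
      qed
      have "b \<in> C" for b
        using pos[of b] pos[of "- b"] subgrp_minus[OF sC, of "- b"] subgrp_0[OF sC]
        by (cases b "0 :: 'h" rule: linorder_cases) auto
      then show ?thesis by blast
    qed simp
  qed
qed simp

lemma is_structure_ordered_group: "is_structure (ordered_group_struct :: (_, _, 'a :: linordered_ab_group_add) struct)"
  by (auto simp: is_structure_def group_universe)

lemma is_structure_group_reals: "is_structure (group_reals :: (_, _, 'a :: linordered_ab_group_add + real) struct)"
  by (auto simp: is_structure_def disjoint_union_simps group_universe)

lemma finite_convex_subgroups_trace_equivalent: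
  assumes nontrivial: "\<exists>x :: 'h :: linordered_ab_group_add. x \<noteq> 0"
    and fin: "finite (definable_convex_subgroups :: 'h set set)"
  shows "trace_equivalent TYPE('u) (ordered_group_struct :: (_, _, 'h) struct) (group_reals :: (_, _, 'h + real) struct)"
  unfolding trace_equivalent_def
proof
  obtain x :: 'h where "x \<noteq> 0" using nontrivial by blast
  then have "0 < x \<or> 0 < - x" by auto
  then obtain h0 :: 'h where "0 < h0" by blast
  then obtain \<psi> cst where "locally_translates (ordered_group_struct :: (_, _, 'h) struct) (group_reals :: (_, _, 'h + real) struct) 3 \<psi> cst"
    using translates_disjoint_union by blast
  \<comment> \<open>Relation symbols are indexed by sets of tuples, so \<open>{[a]}\<close> and
    \<open>{[r]}\<close> give enough formulas to embed the universe.\<close>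
  moreover define h :: "'h + real \<Rightarrow> (group_fun, order_rel) fm + (unit, ('h, real) du_sym) fm" where
    "h x = (case x of Inl a \<Rightarrow> Inr (Rel (Rel_Left {[a]}) []) | Inr r \<Rightarrow> Inr (Rel (Rel_Right {[r]}) []))" for x
  have "inj h" by (auto simp: inj_def h_def split: sum.splits)
  ultimately show "theory_trace_defines TYPE('u) (lang (ordered_group_struct :: (_, _, 'h) struct)) (Th (ordered_group_struct :: (_, _, 'h) struct))
      (lang (group_reals :: (_, _, 'h + real) struct)) (Th (group_reals :: (_, _, 'h + real) struct))"
    by (intro locally_translates_trace_defines[OF is_structure_group_reals is_structure_ordered_group]) auto
next
  interpret regular_chain "definable_convex_subgroups :: 'h set set" by (rule definable_convex_subgroups_regular[OF fin])
  obtain m \<psi> cst where "0 < m" "locally_translates (group_reals :: (_, _, 'h + real) struct) (ordered_group_struct :: (_, _, 'h) struct) m \<psi> cst"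
    using translates_ordered_group by blast
  moreover define h :: "'h \<Rightarrow> (unit, ('h, real) du_sym) fm + (group_fun, order_rel) fm" where
    "h a = Inl (Rel (Rel_Left {[a]}) [])" for a
  have "inj h" by (auto simp: inj_def h_def)
  ultimately show "theory_trace_defines TYPE('u) (lang (group_reals :: (_, _, 'h + real) struct)) (Th (group_reals :: (_, _, 'h + real) struct))
      (lang (ordered_group_struct :: (_, _, 'h) struct)) (Th (ordered_group_struct :: (_, _, 'h) struct))"
    by (intro locally_translates_trace_defines[OF is_structure_ordered_group is_structure_group_reals])
qed

theorem theorem5p18:
  assumes nontrivial: "\<exists>x :: 'h :: linordered_ab_group_add. x \<noteq> 0"
  shows "(finite (definable_convex_subgroups :: 'h set set) \<longrightarrow>
            trace_equivalent TYPE('u)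
              (ordered_group_struct :: (_, _, 'h) struct)
              (disjoint_union (group_struct :: (_, _, 'h) struct)
                              (ordered_group_struct :: (_, _, real) struct))) \<and>
         (archimedean_group TYPE('h) \<longrightarrow>
            trace_equivalent TYPE('u)
              (ordered_group_struct :: (_, _, 'h) struct)
              (disjoint_union (group_struct :: (_, _, 'h) struct)
                              (ordered_group_struct :: (_, _, real) struct)))"
  using finite_convex_subgroups_trace_equivalent[OF nontrivial] archimedean_definable_convex_subgroups by blast

end
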